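(* Let $\mathbf{C}$ be a dagger compact category. Then $\mathrm{CPM}(\mathbf{C})$ and $\mathrm{CP}^\infty(\mathbf{C})$ are isomorphic dagger symmetric monoidal categories (that is, $\mathrm{CP}^\infty(\mathbf{C})$ carries a dagger making it a dagger symmetric monoidal category isomorphic, as such, to $\mathrm{CPM}(\mathbf{C})$). Hence if $\mathbf{C}$ is a dagger compact category, then so is $\mathrm{CP}^\infty(\mathbf{C})$.
   Context: A dagger compact category is a dagger symmetric monoidal category $\mathbf{C}$ (identity-on-objects involutive contravariant $\dagger$ with $(f\otimes g)^\dagger=f^\dagger\otimes g^\dagger$, and unitary coherence isomorphisms $\alpha,\lambda,\rho$ and symmetry $\sigma$) in which every object $A$ has a dual $A^*$ with unit (cup) $\eta_A\colon I\to A^*\otimes A$ and counit $\eta_A^\dagger\circ\sigma_{A,A^*}\colon A\otimes A^*\to I$. The functor $(-)_*$ sends $f\colon A\to B$ to $f_*=(f^\dagger)^*\colon A^*\to B^*$ (the dual of $f^\dagger$) and reverses the order of tensor products, so that $f\colon A\to X\otimes B$ gives $f_*\colon A^*\to B^*\otimes X^*$. Coherence isomorphisms are suppressed below. $\mathrm{CPM}(\mathbf{C})$: objects are those of $\mathbf{C}$. Morphisms $A\to B$ are those morphisms $A^*\otimes A\to B^*\otimes B$ of $\mathbf{C}$ of the form $(1_{B^*}\otimes\eta_X^\dagger\otimes 1_B)(f_*\otimes f)$ for some object $X$ and some $f\colon A\to X\otimes B$ in $\mathbf{C}$ (a Kraus morphism). Identities, composition and dagger are those of $\mathbf{C}$.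 The tensor unit and tensor of objects are those of $\mathbf{C}$; the tensor product of the morphisms with Kraus morphisms $f\colon A\to X\otimes B$ and $g\colon C\to Y\otimes D$ is the morphism with Kraus morphism $(1_X\otimes\sigma_{B,Y}\otimes 1_D)(f\otimes g)\colon A\otimes C\to(X\otimes Y)\otimes(B\otimes D)$. The cup of $A$ in $\mathrm{CPM}(\mathbf{C})$ is $(\eta_A)_*\otimes\eta_A$. This makes $\mathrm{CPM}(\mathbf{C})$ a dagger compact category. $\mathrm{CP}^\infty(\mathbf{C})$: for $f\colon A\to X\otimes B$ and $g\colon A\to X'\otimes B$ write $f\sim g$ when $(f^\dagger\otimes 1_Y)(1_X\otimes h^\dagger h)(f\otimes 1_Y)=(g^\dagger\otimes 1_Y)(1_{X'}\otimes h^\dagger h)(g\otimes 1_Y)$ for all objects $Y,Z$ and all $h\colon B\otimes Y\to Z$ in $\mathbf{C}$. Objects of $\mathrm{CP}^\infty(\mathbf{C})$ are those of $\mathbf{C}$; morphisms $A\to B$ are $\sim$-classes $[f]$ of morphisms $f\colon A\to X\otimes B$, with $X$ any object; the identity on $A$ is $[\lambda_A^\dagger]$; for $f\colon A\to X\otimes B$, $g\colon B\to Y\otimes C$, $[g]\circ[f]=[\alpha_{X,Y,C}^\dagger(1_X\otimes g)f]$. It is symmetric monoidal with unit and tensor of objects as in $\mathbf{C}$, with $[f]\otimes[g]=[(1_X\otimes\sigma_{B,Y}\otimes 1_D)(f\otimes g)]$ for $f\colon A\to X\otimes B$, $g\colon C\to Y\otimes D$, and with coherence isomorphisms and symmetry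 given by the classes $[\lambda^\dagger c]$ of the corresponding isomorphisms $c$ of $\mathbf{C}$. *)

theory Defs
  imports Main
begin

section \<open>Symmetric monoidal categories\<close>

text \<open>
  Categories are given by a set of objects and a set of arrows, each arrow having one domain and one
  codomain; composition, tensor, dagger etc. are only constrained on the carrier sets.
  Tensor of objects is written \<open>\<otimes>\<close>, tensor of arrows \<open>\<boxtimes>\<close>. The structural isomorphisms are oriented
  \<open>\<alpha> A B D : (A \<otimes> B) \<otimes> D \<rightarrow> A \<otimes> (B \<otimes> D)\<close>, \<open>\<ll> A : I \<otimes> A \<rightarrow> A\<close>, \<open>\<rho> A : A \<otimes> I \<rightarrow> A\<close>.
\<close>

record ('o, 'm) smcat =
  Ob :: "'o set"
  Arr :: "'m set"
  Dom :: "'m \<Rightarrow> 'o"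
  Cod :: "'m \<Rightarrow> 'o"
  Id :: "'o \<Rightarrow> 'm" ("\<one>\<index>")
  Comp :: "'m \<Rightarrow> 'm \<Rightarrow> 'm" (infixr "\<cdot>\<index>" 60)
  Unit :: 'o ("\<I>\<index>")
  TenO :: "'o \<Rightarrow> 'o \<Rightarrow> 'o" (infixr "\<otimes>\<index>" 70)
  TenA :: "'m \<Rightarrow> 'm \<Rightarrow> 'm" (infixr "\<boxtimes>\<index>" 70)
  Assoc :: "'o \<Rightarrow> 'o \<Rightarrow> 'o \<Rightarrow> 'm" ("\<alpha>\<index>")
  Lunit :: "'o \<Rightarrow> 'm" ("\<ll>\<index>")
  Runit :: "'o \<Rightarrow> 'm" ("\<rho>\<index>")
  Symm :: "'o \<Rightarrow> 'o \<Rightarrow> 'm" ("\<sigma>\<index>")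

record ('o, 'm) dsmcat = "('o, 'm) smcat" +
  Dag :: "'m \<Rightarrow> 'm" ("(_\<dagger>\<index>)" [1000] 999)

record ('o, 'm) dccat = "('o, 'm) dsmcat" +
  Dual :: "'o \<Rightarrow> 'o" ("(_\<^bold>*\<index>)" [1000] 999)
  Cup :: "'o \<Rightarrow> 'm" ("\<eta>\<index>")

definition hom :: "('o, 'm, 'x) smcat_scheme \<Rightarrow> 'o \<Rightarrow> 'o \<Rightarrow> 'm set" where
  "hom C A B = {f \<in> Arr C. Dom C f = A \<and> Cod C f = B}"

locale category =
  fixes C :: "('o, 'm, 'x) smcat_scheme" (structure)
  assumes dom_ob: "f \<in> Arr C \<Longrightarrow> Dom C f \<in> Ob C"
    and cod_ob: "f \<in> Arr C \<Longrightarrow> Cod C f \<in> Ob C"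
    and id_hom: "A \<in> Ob C \<Longrightarrow> \<one> A \<in> hom C A A"
    and comp_hom: "f \<in> hom C A B \<Longrightarrow> g \<in> hom C B D \<Longrightarrow> g \<cdot> f \<in> hom C A D"
    and comp_id: "f \<in> hom C A B \<Longrightarrow> f \<cdot> \<one> A = f"
    and id_comp: "f \<in> hom C A B \<Longrightarrow> \<one> B \<cdot> f = f"
    and comp_assoc: "f \<in> hom C A B \<Longrightarrow> g \<in> hom C B D \<Longrightarrow> h \<in> hom C D E \<Longrightarrow>
      (h \<cdot> g) \<cdot> f = h \<cdot> (g \<cdot> f)"

definition iso_hom :: "('o, 'm, 'x) smcat_scheme \<Rightarrow> 'o \<Rightarrow> 'o \<Rightarrow> 'm set" where
  "iso_hom C A B = {f \<in> hom C A B. \<exists>g \<in> hom C B A. Comp C g f = Id C A \<and> Comp C f g = Id C B}"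

locale symmetric_monoidal_category = category C
  for C :: "('o, 'm, 'x) smcat_scheme" (structure) +
  assumes unit_ob: "\<I> \<in> Ob C"
    and tensor_ob: "A \<in> Ob C \<Longrightarrow> B \<in> Ob C \<Longrightarrow> A \<otimes> B \<in> Ob C"
    and tensor_hom: "f \<in> hom C A B \<Longrightarrow> g \<in> hom C A' B' \<Longrightarrow> f \<boxtimes> g \<in> hom C (A \<otimes> A') (B \<otimes> B')"
    and tensor_id: "A \<in> Ob C \<Longrightarrow> B \<in> Ob C \<Longrightarrow> \<one> A \<boxtimes> \<one> B = \<one> (A \<otimes> B)"
    and tensor_comp: "f \<in> hom C A B \<Longrightarrow> g \<in> hom C B D \<Longrightarrow>
      f' \<in> hom C A' B' \<Longrightarrow> g' \<in> hom C B' D' \<Longrightarrow>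
      (g \<cdot> f) \<boxtimes> (g' \<cdot> f') = (g \<boxtimes> g') \<cdot> (f \<boxtimes> f')"
    and assoc_iso: "A \<in> Ob C \<Longrightarrow> B \<in> Ob C \<Longrightarrow> D \<in> Ob C \<Longrightarrow>
      \<alpha> A B D \<in> iso_hom C ((A \<otimes> B) \<otimes> D) (A \<otimes> (B \<otimes> D))"
    and assoc_natural: "f \<in> hom C A A' \<Longrightarrow> g \<in> hom C B B' \<Longrightarrow> h \<in> hom C D D' \<Longrightarrow>
      \<alpha> A' B' D' \<cdot> ((f \<boxtimes> g) \<boxtimes> h) = (f \<boxtimes> (g \<boxtimes> h)) \<cdot> \<alpha> A B D"
    and lunit_iso: "A \<in> Ob C \<Longrightarrow> \<ll> A \<in> iso_hom C (\<I> \<otimes> A) A"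
    and lunit_natural: "f \<in> hom C A B \<Longrightarrow> \<ll> B \<cdot> (\<one> \<I> \<boxtimes> f) = f \<cdot> \<ll> A"
    and runit_iso: "A \<in> Ob C \<Longrightarrow> \<rho> A \<in> iso_hom C (A \<otimes> \<I>) A"
    and runit_natural: "f \<in> hom C A B \<Longrightarrow> \<rho> B \<cdot> (f \<boxtimes> \<one> \<I>) = f \<cdot> \<rho> A"
    and symm_iso: "A \<in> Ob C \<Longrightarrow> B \<in> Ob C \<Longrightarrow> \<sigma> A B \<in> iso_hom C (A \<otimes> B) (B \<otimes> A)"
    and symm_natural: "f \<in> hom C A A' \<Longrightarrow> g \<in> hom C B B' \<Longrightarrow>
      \<sigma> A' B' \<cdot> (f \<boxtimes> g) = (g \<boxtimes> f) \<cdot> \<sigma> A B"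
    and symm_symm: "A \<in> Ob C \<Longrightarrow> B \<in> Ob C \<Longrightarrow> \<sigma> B A \<cdot> \<sigma> A B = \<one> (A \<otimes> B)"
    and pentagon: "A \<in> Ob C \<Longrightarrow> B \<in> Ob C \<Longrightarrow> D \<in> Ob C \<Longrightarrow> E \<in> Ob C \<Longrightarrow>
      (\<one> A \<boxtimes> \<alpha> B D E) \<cdot> \<alpha> A (B \<otimes> D) E \<cdot> (\<alpha> A B D \<boxtimes> \<one> E) =
      \<alpha> A B (D \<otimes> E) \<cdot> \<alpha> (A \<otimes> B) D E"
    and triangle: "A \<in> Ob C \<Longrightarrow> B \<in> Ob C \<Longrightarrow>
      (\<one> A \<boxtimes> \<ll> B) \<cdot> \<alpha> A \<I> B = \<rho> A \<boxtimes> \<one> B"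
    and hexagon: "A \<in> Ob C \<Longrightarrow> B \<in> Ob C \<Longrightarrow> D \<in> Ob C \<Longrightarrow>
      \<alpha> B D A \<cdot> \<sigma> A (B \<otimes> D) \<cdot> \<alpha> A B D =
      (\<one> B \<boxtimes> \<sigma> A D) \<cdot> \<alpha> B A D \<cdot> (\<sigma> A B \<boxtimes> \<one> D)"

section \<open>Dagger symmetric monoidal and dagger compact categories\<close>

locale dagger_symmetric_monoidal_category = symmetric_monoidal_category C
  for C :: "('o, 'm, 'x) dsmcat_scheme" (structure) +
  assumes dag_hom: "f \<in> hom C A B \<Longrightarrow> f\<dagger> \<in> hom C B A"
    and dag_id: "A \<in> Ob C \<Longrightarrow> (\<one> A)\<dagger> = \<one> A"
    and dag_comp: "f \<in> hom C A B \<Longrightarrow> g \<in> hom C B D \<Longrightarrow> (g \<cdot> f)\<dagger> = f\<dagger> \<cdot> g\<dagger>"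
    and dag_dag: "f \<in> Arr C \<Longrightarrow> (f\<dagger>)\<dagger> = f"
    and dag_tensor: "f \<in> Arr C \<Longrightarrow> g \<in> Arr C \<Longrightarrow> (f \<boxtimes> g)\<dagger> = f\<dagger> \<boxtimes> g\<dagger>"
    and assoc_unitary: "A \<in> Ob C \<Longrightarrow> B \<in> Ob C \<Longrightarrow> D \<in> Ob C \<Longrightarrow>
      (\<alpha> A B D)\<dagger> \<cdot> \<alpha> A B D = \<one> ((A \<otimes> B) \<otimes> D) \<and> \<alpha> A B D \<cdot> (\<alpha> A B D)\<dagger> = \<one> (A \<otimes> (B \<otimes> D))"
    and lunit_unitary: "A \<in> Ob C \<Longrightarrow>
      (\<ll> A)\<dagger> \<cdot> \<ll> A = \<one> (\<I> \<otimes> A) \<and> \<ll> A \<cdot> (\<ll> A)\<dagger> = \<one> A"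
    and runit_unitary: "A \<in> Ob C \<Longrightarrow>
      (\<rho> A)\<dagger> \<cdot> \<rho> A = \<one> (A \<otimes> \<I>) \<and> \<rho> A \<cdot> (\<rho> A)\<dagger> = \<one> A"
    and symm_unitary: "A \<in> Ob C \<Longrightarrow> B \<in> Ob C \<Longrightarrow>
      (\<sigma> A B)\<dagger> \<cdot> \<sigma> A B = \<one> (A \<otimes> B) \<and> \<sigma> A B \<cdot> (\<sigma> A B)\<dagger> = \<one> (B \<otimes> A)"

definition counit :: "('o, 'm, 'x) dccat_scheme \<Rightarrow> 'o \<Rightarrow> 'm" ("\<epsilon>\<index>") where
  "counit C A = Comp C (Dag C (Cup C A)) (Symm C A (Dual C A))"

locale dagger_compact_category = dagger_symmetric_monoidal_category C
  for C :: "('o, 'm, 'x) dccat_scheme" (structure) +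
  assumes dual_ob: "A \<in> Ob C \<Longrightarrow> A\<^bold>* \<in> Ob C"
    and cup_hom: "A \<in> Ob C \<Longrightarrow> \<eta> A \<in> hom C \<I> (A\<^bold>* \<otimes> A)"
    and snake: "A \<in> Ob C \<Longrightarrow>
      \<ll> A \<cdot> (\<epsilon> A \<boxtimes> \<one> A) \<cdot> (\<alpha> A (A\<^bold>*) A)\<dagger> \<cdot> (\<one> A \<boxtimes> \<eta> A) \<cdot> (\<rho> A)\<dagger> = \<one> A"
    and snake_dual: "A \<in> Ob C \<Longrightarrow>
      \<rho> (A\<^bold>*) \<cdot> (\<one> (A\<^bold>*) \<boxtimes> \<epsilon> A) \<cdot> \<alpha> (A\<^bold>*) A (A\<^bold>*) \<cdot> (\<eta> A \<boxtimes> \<one> (A\<^bold>*)) \<cdot> (\<ll> (A\<^bold>*))\<dagger> = \<one> (A\<^bold>*)"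

text \<open>
  A strict isomorphism: the structure, including the coherence isomorphisms and the dagger,
  is preserved on the nose.
\<close>

definition dsmc_iso ::
  "('o, 'm, 'x) dsmcat_scheme \<Rightarrow> ('p, 'n, 'y) dsmcat_scheme \<Rightarrow> ('o \<Rightarrow> 'p) \<Rightarrow> ('m \<Rightarrow> 'n) \<Rightarrow> bool" where
  "dsmc_iso C D F0 F \<longleftrightarrow>
    bij_betw F0 (Ob C) (Ob D) \<and> bij_betw F (Arr C) (Arr D) \<and>
    (\<forall>f \<in> Arr C. Dom D (F f) = F0 (Dom C f) \<and> Cod D (F f) = F0 (Cod C f)) \<and>
    (\<forall>A \<in> Ob C. F (Id C A) = Id D (F0 A)) \<and>
    (\<forall>f \<in> Arr C. \<forall>g \<in> Arr C. Cod C f = Dom C g \<longrightarrow> F (Comp C g f) = Comp D (F g) (F f)) \<and>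
    F0 (Unit C) = Unit D \<and>
    (\<forall>A \<in> Ob C. \<forall>B \<in> Ob C. F0 (TenO C A B) = TenO D (F0 A) (F0 B)) \<and>
    (\<forall>f \<in> Arr C. \<forall>g \<in> Arr C. F (TenA C f g) = TenA D (F f) (F g)) \<and>
    (\<forall>A \<in> Ob C. \<forall>B \<in> Ob C. \<forall>E \<in> Ob C. F (Assoc C A B E) = Assoc D (F0 A) (F0 B) (F0 E)) \<and>
    (\<forall>A \<in> Ob C. F (Lunit C A) = Lunit D (F0 A)) \<and>
    (\<forall>A \<in> Ob C. F (Runit C A) = Runit D (F0 A)) \<and>
    (\<forall>A \<in> Ob C. \<forall>B \<in> Ob C. F (Symm C A B) = Symm D (F0 A) (F0 B)) \<and>
    (\<forall>f \<in> Arr C. F (Dag C f) = Dag D (F f))"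

definition dsmc_isomorphic ::
  "('o, 'm, 'x) dsmcat_scheme \<Rightarrow> ('p, 'n, 'y) dsmcat_scheme \<Rightarrow> bool" where
  "dsmc_isomorphic C D \<longleftrightarrow>
    dagger_symmetric_monoidal_category C \<and> dagger_symmetric_monoidal_category D \<and>
    (\<exists>F0 F. dsmc_iso C D F0 F)"

definition with_dagger :: "('o, 'm) smcat \<Rightarrow> ('m \<Rightarrow> 'm) \<Rightarrow> ('o, 'm) dsmcat" where
  "with_dagger C d = smcat.extend C (dsmcat.fields d)"

definition with_duals :: "('o, 'm) dsmcat \<Rightarrow> ('o \<Rightarrow> 'o) \<Rightarrow> ('o \<Rightarrow> 'm) \<Rightarrow> ('o, 'm) dccat" where
  "with_duals C du cu = dsmcat.extend C (dccat.fields du cu)"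

section \<open>Kraus morphisms\<close>

context
  fixes C :: "('o, 'm, 'x) dsmcat_scheme" (structure)
begin

text \<open>
  A Kraus morphism \<open>f : A \<rightarrow> X \<otimes> B\<close> is kept together with its ancilla \<open>X\<close>, because \<open>X\<close> need
  not be determined by the object \<open>X \<otimes> B\<close>.
\<close>

definition kraus :: "'o \<Rightarrow> 'o \<Rightarrow> ('o \<times> 'm) set" where
  "kraus A B = {(X, f). X \<in> Ob C \<and> f \<in> hom C A (X \<otimes> B)}"

text \<open>\<open>1 \<otimes> \<sigma> \<otimes> 1 : (X \<otimes> B) \<otimes> (Y \<otimes> D) \<rightarrow> (X \<otimes> Y) \<otimes> (B \<otimes> D)\<close>, with associators.\<close>

definition middle_swap :: "'o \<Rightarrow> 'o \<Rightarrow> 'o \<Rightarrow> 'o \<Rightarrow> 'm" where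
  "middle_swap X B Y D =
    (\<alpha> X Y (B \<otimes> D))\<dagger> \<cdot> (\<one> X \<boxtimes> (\<alpha> Y B D \<cdot> (\<sigma> B Y \<boxtimes> \<one> D) \<cdot> (\<alpha> B Y D)\<dagger>)) \<cdot> \<alpha> X B (Y \<otimes> D)"

definition kraus_tensor :: "'o \<Rightarrow> 'o \<Rightarrow> 'o \<times> 'm \<Rightarrow> 'o \<times> 'm \<Rightarrow> 'o \<times> 'm" where
  "kraus_tensor B D = (\<lambda>(X, f) (Y, g). (X \<otimes> Y, middle_swap X B Y D \<cdot> (f \<boxtimes> g)))"

definition kraus_comp :: "'o \<Rightarrow> 'o \<times> 'm \<Rightarrow> 'o \<times> 'm \<Rightarrow> 'o \<times> 'm" where
  "kraus_comp D = (\<lambda>(Y, g) (X, f). (X \<otimes> Y, (\<alpha> X Y D)\<dagger> \<cdot> (\<one> X \<boxtimes> g) \<cdot> f))"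

text \<open>\<open>(f\<^sup>\<dagger> \<otimes> 1)(1 \<otimes> h\<^sup>\<dagger>h)(f \<otimes> 1) : A \<otimes> Y \<rightarrow> A \<otimes> Y\<close> for \<open>f : A \<rightarrow> X \<otimes> B\<close> and \<open>h : B \<otimes> Y \<rightarrow> Z\<close>.\<close>

definition kraus_test :: "'o \<Rightarrow> 'o \<Rightarrow> 'm \<Rightarrow> 'o \<times> 'm \<Rightarrow> 'm" where
  "kraus_test B Y h = (\<lambda>(X, f).
    (f\<dagger> \<boxtimes> \<one> Y) \<cdot> (\<alpha> X B Y)\<dagger> \<cdot> (\<one> X \<boxtimes> (h\<dagger> \<cdot> h)) \<cdot> \<alpha> X B Y \<cdot> (f \<boxtimes> \<one> Y))"

definition kraus_rel :: "'o \<Rightarrow> 'o \<Rightarrow> (('o \<times> 'm) \<times> ('o \<times> 'm)) set" where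
  "kraus_rel A B = {(p, q). p \<in> kraus A B \<and> q \<in> kraus A B \<and>
    (\<forall>Y \<in> Ob C. \<forall>Z \<in> Ob C. \<forall>h \<in> hom C (B \<otimes> Y) Z. kraus_test B Y h p = kraus_test B Y h q)}"

definition kraus_class :: "'o \<Rightarrow> 'o \<Rightarrow> 'o \<times> 'm \<Rightarrow> ('o \<times> 'm) set" where
  "kraus_class A B p = kraus_rel A B `` {p}"

definition pure_class :: "'m \<Rightarrow> 'o \<times> 'o \<times> ('o \<times> 'm) set" where
  "pure_class c = (Dom C c, Cod C c, kraus_class (Dom C c) (Cod C c) (\<I>, (\<ll> (Cod C c))\<dagger> \<cdot> c))"

end

section \<open>The category CP-infinity\<close>

text \<open>
  An arrow \<open>A \<rightarrow> B\<close> is a triple of \<open>A\<close>, \<open>B\<close> and an equivalence class. Operations on classes are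
  given by the union over all representatives; this union is again a class
  exactly because the operation does not depend on the representatives.
\<close>

definition CPinf :: "('o, 'm, 'x) dsmcat_scheme \<Rightarrow> ('o, 'o \<times> 'o \<times> ('o \<times> 'm) set) smcat" where
  "CPinf C = \<lparr>
    Ob = Ob C,
    Arr = {(A, B, F). A \<in> Ob C \<and> B \<in> Ob C \<and> F \<in> kraus C A B // kraus_rel C A B},
    Dom = (\<lambda>(A, B, F). A),
    Cod = (\<lambda>(A, B, F). B),
    Id = (\<lambda>A. (A, A, kraus_class C A A (Unit C, Dag C (Lunit C A)))),
    Comp = (\<lambda>(B', D, G) (A, B, F).
      (A, D, \<Union>q \<in> G. \<Union>p \<in> F. kraus_class C A D (kraus_comp C D q p))),
    Unit = Unit C,
    TenO = TenO C,
    TenA = (\<lambda>(A, B, F) (A', B', F'). (TenO C A A', TenO C B B',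
      \<Union>p \<in> F. \<Union>q \<in> F'. kraus_class C (TenO C A A') (TenO C B B') (kraus_tensor C B B' p q))),
    Assoc = (\<lambda>A B D. pure_class C (Assoc C A B D)),
    Lunit = (\<lambda>A. pure_class C (Lunit C A)),
    Runit = (\<lambda>A. pure_class C (Runit C A)),
    Symm = (\<lambda>A B. pure_class C (Symm C A B)) \<rparr>"

section \<open>The category CPM\<close>

context
  fixes C :: "('o, 'm, 'x) dccat_scheme" (structure)
begin

text \<open>The transpose \<open>f\<^sup>* : B\<^sup>* \<rightarrow> A\<^sup>*\<close> of \<open>f : A \<rightarrow> B\<close>, and \<open>f\<^sub>* = (f\<^sup>\<dagger>)\<^sup>* : A\<^sup>* \<rightarrow> B\<^sup>*\<close>.\<close>

definition transp :: "'m \<Rightarrow> 'm" where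
  "transp f = (let A = Dom C f; B = Cod C f in
    \<rho> (A\<^bold>*) \<cdot> (\<one> (A\<^bold>*) \<boxtimes> \<epsilon> B) \<cdot> \<alpha> (A\<^bold>*) B (B\<^bold>*) \<cdot> ((\<one> (A\<^bold>*) \<boxtimes> f) \<boxtimes> \<one> (B\<^bold>*)) \<cdot>
    (\<eta> A \<boxtimes> \<one> (B\<^bold>*)) \<cdot> (\<ll> (B\<^bold>*))\<dagger>)"

definition conj_arr :: "'m \<Rightarrow> 'm" where
  "conj_arr f = transp (f\<dagger>)"

text \<open>
  The nested cup \<open>I \<rightarrow> (B\<^sup>* \<otimes> X\<^sup>*) \<otimes> (X \<otimes> B)\<close>, which exhibits \<open>B\<^sup>* \<otimes> X\<^sup>*\<close> as a dual of \<open>X \<otimes> B\<close>, and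
  the resulting coherence isomorphism \<open>(X \<otimes> B)\<^sup>* \<rightarrow> B\<^sup>* \<otimes> X\<^sup>*\<close>.
\<close>

definition nested_cup :: "'o \<Rightarrow> 'o \<Rightarrow> 'm" where
  "nested_cup X B =
    (\<alpha> (B\<^bold>*) (X\<^bold>*) (X \<otimes> B))\<dagger> \<cdot>
    (\<one> (B\<^bold>*) \<boxtimes> (\<alpha> (X\<^bold>*) X B \<cdot> (\<eta> X \<boxtimes> \<one> B) \<cdot> (\<ll> B)\<dagger>)) \<cdot> \<eta> B"

definition dual_tensor :: "'o \<Rightarrow> 'o \<Rightarrow> 'm" where
  "dual_tensor X B =
    \<rho> (B\<^bold>* \<otimes> X\<^bold>*) \<cdot> (\<one> (B\<^bold>* \<otimes> X\<^bold>*) \<boxtimes> \<epsilon> (X \<otimes> B)) \<cdot>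
    \<alpha> (B\<^bold>* \<otimes> X\<^bold>*) (X \<otimes> B) ((X \<otimes> B)\<^bold>*) \<cdot>
    (nested_cup X B \<boxtimes> \<one> ((X \<otimes> B)\<^bold>*)) \<cdot> (\<ll> ((X \<otimes> B)\<^bold>*))\<dagger>"

text \<open>\<open>1 \<otimes> \<eta>\<^sup>\<dagger> \<otimes> 1 : (B\<^sup>* \<otimes> X\<^sup>*) \<otimes> (X \<otimes> B) \<rightarrow> B\<^sup>* \<otimes> B\<close>, with associators and unitor.\<close>

definition ancilla_cap :: "'o \<Rightarrow> 'o \<Rightarrow> 'm" where
  "ancilla_cap X B =
    (\<one> (B\<^bold>*) \<boxtimes> (\<ll> B \<cdot> ((\<eta> X)\<dagger> \<boxtimes> \<one> B) \<cdot> (\<alpha> (X\<^bold>*) X B)\<dagger>)) \<cdot> \<alpha> (B\<^bold>*) (X\<^bold>*) (X \<otimes> B)"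

definition cpm_map :: "'o \<Rightarrow> 'o \<times> 'm \<Rightarrow> 'm" where
  "cpm_map B = (\<lambda>(X, f). ancilla_cap X B \<cdot> ((dual_tensor X B \<cdot> conj_arr f) \<boxtimes> f))"

definition doubled :: "'m \<Rightarrow> 'o \<times> 'o \<times> 'm" where
  "doubled c = (Dom C c, Cod C c, conj_arr c \<boxtimes> c)"

end

text \<open>
  An arrow \<open>A \<rightarrow> B\<close> is a triple of \<open>A\<close>, \<open>B\<close> and an arrow \<open>A\<^sup>* \<otimes> A \<rightarrow> B\<^sup>* \<otimes> B\<close>. The coherence
  isomorphisms are the images of those of \<open>C\<close> under the functor \<open>c \<mapsto> c\<^sub>* \<otimes> c\<close>.
\<close>

definition CPM :: "('o, 'm, 'x) dccat_scheme \<Rightarrow> ('o, 'o \<times> 'o \<times> 'm) dccat" where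
  "CPM C = \<lparr>
    Ob = Ob C,
    Arr = {(A, B, \<phi>). A \<in> Ob C \<and> B \<in> Ob C \<and> (\<exists>p \<in> kraus C A B. \<phi> = cpm_map C B p)},
    Dom = (\<lambda>(A, B, \<phi>). A),
    Cod = (\<lambda>(A, B, \<phi>). B),
    Id = (\<lambda>A. (A, A, Id C (TenO C (Dual C A) A))),
    Comp = (\<lambda>(B', D, \<psi>) (A, B, \<phi>). (A, D, Comp C \<psi> \<phi>)),
    Unit = Unit C,
    TenO = TenO C,
    TenA = (\<lambda>(A, B, \<phi>) (A', B', \<psi>). (TenO C A A', TenO C B B',
      THE \<omega>. \<exists>p \<in> kraus C A B. \<exists>q \<in> kraus C A' B'.
        \<phi> = cpm_map C B p \<and> \<psi> = cpm_map C B' q \<and>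
        \<omega> = cpm_map C (TenO C B B') (kraus_tensor C B B' p q))),
    Assoc = (\<lambda>A B D. doubled C (Assoc C A B D)),
    Lunit = (\<lambda>A. doubled C (Lunit C A)),
    Runit = (\<lambda>A. doubled C (Runit C A)),
    Symm = (\<lambda>A B. doubled C (Symm C A B)),
    Dag = (\<lambda>(A, B, \<phi>). (B, A, Dag C \<phi>)),
    Dual = Dual C,
    Cup = (\<lambda>A. doubled C (Cup C A)) \<rparr>"

end

theory Submission
  imports Defs
begin

text \<open>
  The functor \<open>D c = c\<^sub>* \<otimes> c\<close> on \<open>C\<close> is symmetric monoidal, with unitary structure maps
  \<open>s : D A \<otimes> D B \<rightarrow> D (A \<otimes> B)\<close>, and \<open>cpm_map B (X, f)\<close> is \<open>(\<eta>\<^sub>X\<^sup>\<dagger> \<otimes> 1) s\<^sup>\<dagger> (D f)\<close>. Hence Kraus composition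
  becomes composition, the Kraus tensor becomes \<open>s (\<phi> \<otimes> \<psi>) s\<^sup>\<dagger>\<close>, and the coherence equations and snakes
  of CPM are images under \<open>D\<close> of those of \<open>C\<close>. The arrows of CPM are closed under the dagger
  because \<open>\<eta>\<^sub>X\<close>, as an arrow \<open>I \<rightarrow> X\<close> of CPM, has itself as Kraus morphism with ancilla \<open>X\<^sup>*\<close>.
  Bending the input wire turns the test \<open>(f\<^sup>\<dagger> \<otimes> 1)(1 \<otimes> h\<^sup>\<dagger>h)(f \<otimes> 1)\<close> into a composite of \<open>cpm_map B (X, f)\<close>
  with a morphism that depends only on \<open>h\<close>, and \<open>h = \<epsilon>\<^sub>B\<close> recovers \<open>cpm_map B (X, f)\<close>. So \<open>\<sim>\<close> is equality
  of \<open>cpm_map\<close>, and the structure of CPM carries over to CP-infinity.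
\<close>

section \<open>Whiskering calculus\<close>

text \<open>Three obstacles shape the proof. \<open>C\<close> is not strict, so every diagram
  carries associators. An equation is therefore tested on \<open>A \<otimes> Z\<close> for all
  \<open>Z\<close>: on right-nested products the symmetry is an adjacent transposition, cups and
  caps insert and delete neighbouring pairs, and the Yang-Baxter, sliding and snake equations do the
  rest. Second, conjugation is defined with \<open>\<epsilon>\<close>, a cap after a crossing, while
  CPM discards with the bare dagger of \<open>\<eta>\<close>. The crossings that this leaves behind
  vanish because the partial trace of the symmetry is the identity (\<open>loopz\<close>,
  \<open>loopn\<close>). Third, \<open>C\<close> says nothing about the domain of an ill-typed
  composite, which would burden each rewrite step with typing conditions. The calculus is developed
  where these domains are unconditional, for a copy of \<open>C\<close> whose arrows record their
  types, and the results are carried back. The naturality laws of CPM concern arbitrary arrows, not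
  only images under \<open>D\<close>. Apart from the maps \<open>s\<close>, they need that
  \<open>\<eta> \<I>\<close> is unitary; both halves of this come from the snakes at
  \<open>\<I>\<close>.\<close>

locale typed_dsmc = dagger_symmetric_monoidal_category C
  for C :: "('o, 'm, 'x) dsmcat_scheme" (structure) +
  assumes dom_comp [simp]: "Dom C (g \<cdot> f) = Dom C f"
    and cod_comp [simp]: "Cod C (g \<cdot> f) = Cod C g"
    and dom_tensor [simp]: "Dom C (f \<boxtimes> g) = Dom C f \<otimes> Dom C g"
    and cod_tensor [simp]: "Cod C (f \<boxtimes> g) = Cod C f \<otimes> Cod C g"
    and dom_dag [simp]: "Dom C (f\<dagger>) = Cod C f"
    and cod_dag [simp]: "Cod C (f\<dagger>) = Dom C f"
    and dom_id [simp]: "Dom C (\<one> A) = A"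
    and cod_id [simp]: "Cod C (\<one> A) = A"
    and dom_assoc [simp]: "Dom C (\<alpha> A B D) = (A \<otimes> B) \<otimes> D"
    and cod_assoc [simp]: "Cod C (\<alpha> A B D) = A \<otimes> (B \<otimes> D)"
    and dom_lunit [simp]: "Dom C (\<ll> A) = \<I> \<otimes> A"
    and cod_lunit [simp]: "Cod C (\<ll> A) = A"
    and dom_runit [simp]: "Dom C (\<rho> A) = A \<otimes> \<I>"
    and cod_runit [simp]: "Cod C (\<rho> A) = A"
    and dom_symm [simp]: "Dom C (\<sigma> A B) = A \<otimes> B"
    and cod_symm [simp]: "Cod C (\<sigma> A B) = B \<otimes> A"
begin

declare unit_ob [simp] tensor_ob [simp] dom_ob [simp] cod_ob [simp]

lemma hom_iff [simp]: "f \<in> hom C A B \<longleftrightarrow> f \<in> Arr C \<and> Dom C f = A \<and> Cod C f = B"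
  by (simp add: hom_def)

lemma arr_comp [simp]: "g \<in> Arr C \<Longrightarrow> f \<in> Arr C \<Longrightarrow> Dom C g = Cod C f \<Longrightarrow> g \<cdot> f \<in> Arr C"
  using comp_hom [of f "Dom C f" "Cod C f" g "Cod C g"] by simp

lemma arr_tensor [simp]: "f \<in> Arr C \<Longrightarrow> g \<in> Arr C \<Longrightarrow> f \<boxtimes> g \<in> Arr C"
  using tensor_hom [of f "Dom C f" "Cod C f" g "Dom C g" "Cod C g"] by simp

lemma arr_dag [simp]: "f \<in> Arr C \<Longrightarrow> f\<dagger> \<in> Arr C"
  using dag_hom [of f "Dom C f" "Cod C f"] by simp

lemma arr_id [simp]: "A \<in> Ob C \<Longrightarrow> \<one> A \<in> Arr C"
  using id_hom by simp

lemma arr_assoc [simp]: "A \<in> Ob C \<Longrightarrow> B \<in> Ob C \<Longrightarrow> D \<in> Ob C \<Longrightarrow> \<alpha> A B D \<in> Arr C"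
  using assoc_iso by (simp add: iso_hom_def)

lemma arr_lunit [simp]: "A \<in> Ob C \<Longrightarrow> \<ll> A \<in> Arr C"
  using lunit_iso by (simp add: iso_hom_def)

lemma arr_runit [simp]: "A \<in> Ob C \<Longrightarrow> \<rho> A \<in> Arr C"
  using runit_iso by (simp add: iso_hom_def)

lemma arr_symm [simp]: "A \<in> Ob C \<Longrightarrow> B \<in> Ob C \<Longrightarrow> \<sigma> A B \<in> Arr C"
  using symm_iso by (simp add: iso_hom_def)

lemma comp_assoc' [simp]:
  "f \<in> Arr C \<Longrightarrow> g \<in> Arr C \<Longrightarrow> h \<in> Arr C \<Longrightarrow> Dom C h = Cod C g \<Longrightarrow> Dom C g = Cod C f \<Longrightarrow>
    (h \<cdot> g) \<cdot> f = h \<cdot> g \<cdot> f"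
  by (rule comp_assoc) auto

lemma comp_id' [simp]: "f \<in> Arr C \<Longrightarrow> A = Dom C f \<Longrightarrow> f \<cdot> \<one> A = f"
  by (rule comp_id) auto

lemma id_comp' [simp]: "f \<in> Arr C \<Longrightarrow> B = Cod C f \<Longrightarrow> \<one> B \<cdot> f = f"
  by (rule id_comp) auto

lemma dag_comp' [simp]:
  "f \<in> Arr C \<Longrightarrow> g \<in> Arr C \<Longrightarrow> Dom C g = Cod C f \<Longrightarrow> (g \<cdot> f)\<dagger> = f\<dagger> \<cdot> g\<dagger>"
  by (rule dag_comp) auto

declare dag_dag [simp] dag_id [simp] dag_tensor [simp] tensor_id [simp]

text \<open>Composites are nested to the right, so \<open>a \<cdot> b\<close> is no longer a subterm
  once a factor \<open>k\<close> follows it. This rule turns an equation for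
  \<open>a \<cdot> b\<close> into its variant with such a factor; most primed lemmas arise in this
  way.\<close>

lemma reassoc:
  assumes "a \<cdot> b = c" "a \<in> Arr C" "b \<in> Arr C" "k \<in> Arr C" "Dom C a = Cod C b" "Dom C b = Cod C k"
  shows "a \<cdot> b \<cdot> k = c \<cdot> k"
  using assms comp_assoc' by metis

lemma tensor_comp':
  "f \<in> Arr C \<Longrightarrow> g \<in> Arr C \<Longrightarrow> f' \<in> Arr C \<Longrightarrow> g' \<in> Arr C \<Longrightarrow> Dom C g = Cod C f \<Longrightarrow> Dom C g' = Cod C f' \<Longrightarrow>
   (g \<boxtimes> g') \<cdot> (f \<boxtimes> f') = (g \<cdot> f) \<boxtimes> (g' \<cdot> f')"
  "f \<in> Arr C \<Longrightarrow> g \<in> Arr C \<Longrightarrow> f' \<in> Arr C \<Longrightarrow> g' \<in> Arr C \<Longrightarrow> Dom C g = Cod C f \<Longrightarrow> Dom C g' = Cod C f' \<Longrightarrow>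
   k \<in> Arr C \<Longrightarrow> Cod C k = Dom C f \<otimes> Dom C f' \<Longrightarrow>
   (g \<boxtimes> g') \<cdot> (f \<boxtimes> f') \<cdot> k = ((g \<cdot> f) \<boxtimes> (g' \<cdot> f')) \<cdot> k"
proof -
  show *: "(g \<boxtimes> g') \<cdot> (f \<boxtimes> f') = (g \<cdot> f) \<boxtimes> (g' \<cdot> f')"
    if "f \<in> Arr C" "g \<in> Arr C" "f' \<in> Arr C" "g' \<in> Arr C" "Dom C g = Cod C f" "Dom C g' = Cod C f'"
    for f g f' g'
    using that tensor_comp [of f "Dom C f" "Cod C f" g "Cod C g" f' "Dom C f'" "Cod C f'" g' "Cod C g'"]
    by simp
  show "(g \<boxtimes> g') \<cdot> (f \<boxtimes> f') \<cdot> k = ((g \<cdot> f) \<boxtimes> (g' \<cdot> f')) \<cdot> k"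
    if "f \<in> Arr C" "g \<in> Arr C" "f' \<in> Arr C" "g' \<in> Arr C" "Dom C g = Cod C f" "Dom C g' = Cod C f'"
     "k \<in> Arr C" "Cod C k = Dom C f \<otimes> Dom C f'"
    for f g f' g' k
    using that by (intro reassoc *) auto
qed

lemma unitary_simps [simp]:
  "A \<in> Ob C \<Longrightarrow> B \<in> Ob C \<Longrightarrow> D \<in> Ob C \<Longrightarrow> (\<alpha> A B D)\<dagger> \<cdot> \<alpha> A B D = \<one> ((A \<otimes> B) \<otimes> D)"
  "A \<in> Ob C \<Longrightarrow> B \<in> Ob C \<Longrightarrow> D \<in> Ob C \<Longrightarrow> \<alpha> A B D \<cdot> (\<alpha> A B D)\<dagger> = \<one> (A \<otimes> (B \<otimes> D))"
  "A \<in> Ob C \<Longrightarrow> (\<ll> A)\<dagger> \<cdot> \<ll> A = \<one> (\<I> \<otimes> A)"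
  "A \<in> Ob C \<Longrightarrow> \<ll> A \<cdot> (\<ll> A)\<dagger> = \<one> A"
  "A \<in> Ob C \<Longrightarrow> (\<rho> A)\<dagger> \<cdot> \<rho> A = \<one> (A \<otimes> \<I>)"
  "A \<in> Ob C \<Longrightarrow> \<rho> A \<cdot> (\<rho> A)\<dagger> = \<one> A"
  "A \<in> Ob C \<Longrightarrow> B \<in> Ob C \<Longrightarrow> \<sigma> B A \<cdot> \<sigma> A B = \<one> (A \<otimes> B)"
  using assoc_unitary lunit_unitary runit_unitary symm_symm by auto

lemma unitary_simps' [simp]:
  "A \<in> Ob C \<Longrightarrow> B \<in> Ob C \<Longrightarrow> D \<in> Ob C \<Longrightarrow> k \<in> Arr C \<Longrightarrow> Cod C k = (A \<otimes> B) \<otimes> D \<Longrightarrow>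
    (\<alpha> A B D)\<dagger> \<cdot> \<alpha> A B D \<cdot> k = k"
  "A \<in> Ob C \<Longrightarrow> B \<in> Ob C \<Longrightarrow> D \<in> Ob C \<Longrightarrow> k \<in> Arr C \<Longrightarrow> Cod C k = A \<otimes> (B \<otimes> D) \<Longrightarrow>
    \<alpha> A B D \<cdot> (\<alpha> A B D)\<dagger> \<cdot> k = k"
  "A \<in> Ob C \<Longrightarrow> k \<in> Arr C \<Longrightarrow> Cod C k = \<I> \<otimes> A \<Longrightarrow> (\<ll> A)\<dagger> \<cdot> \<ll> A \<cdot> k = k"
  "A \<in> Ob C \<Longrightarrow> k \<in> Arr C \<Longrightarrow> Cod C k = A \<Longrightarrow> \<ll> A \<cdot> (\<ll> A)\<dagger> \<cdot> k = k"
  "A \<in> Ob C \<Longrightarrow> k \<in> Arr C \<Longrightarrow> Cod C k = A \<otimes> \<I> \<Longrightarrow> (\<rho> A)\<dagger> \<cdot> \<rho> A \<cdot> k = k"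
  "A \<in> Ob C \<Longrightarrow> k \<in> Arr C \<Longrightarrow> Cod C k = A \<Longrightarrow> \<rho> A \<cdot> (\<rho> A)\<dagger> \<cdot> k = k"
  "A \<in> Ob C \<Longrightarrow> B \<in> Ob C \<Longrightarrow> k \<in> Arr C \<Longrightarrow> Cod C k = A \<otimes> B \<Longrightarrow> \<sigma> B A \<cdot> \<sigma> A B \<cdot> k = k"
  by (simp_all flip: comp_assoc')

text \<open>Both sides are inverse to \<open>\<sigma> A B\<close>: the dagger by unitarity, the
  reverse symmetry by involutivity.\<close>

lemma dag_symm [simp]:
  assumes "A \<in> Ob C" "B \<in> Ob C" shows "(\<sigma> A B)\<dagger> = \<sigma> B A"
proof -
  have "(\<sigma> A B)\<dagger> = (\<sigma> A B)\<dagger> \<cdot> \<sigma> A B \<cdot> \<sigma> B A" using assms by simp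
  also have "\<dots> = \<sigma> B A"
    using reassoc [of "(\<sigma> A B)\<dagger>" "\<sigma> A B" _ "\<sigma> B A"] symm_unitary [OF assms] assms by simp
  finally show ?thesis .
qed

text \<open>
  A morphism \<open>f : A \<rightarrow> B\<close> is determined by its action \<open>f \<rhd> Z\<close> on the head of right-nested products
  \<open>A \<otimes> Z\<close>, and \<open>A \<lhd> h\<close> is the action of \<open>h\<close> below the head. Rewriting an equation into this form
  for an arbitrary tail \<open>Z\<close> moves the inverse associators to the left and the associators to the right,
  where they cancel.
\<close>

definition lw :: "'o \<Rightarrow> 'm \<Rightarrow> 'm" (infixr "\<lhd>" 75) where
  "A \<lhd> h = \<one> A \<boxtimes> h"

definition act :: "'m \<Rightarrow> 'o \<Rightarrow> 'm" (infixl "\<rhd>" 76) where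
  "f \<rhd> Z = f \<boxtimes> \<one> Z"

lemma lw_simps [simp]:
  "Dom C (A \<lhd> h) = A \<otimes> Dom C h"
  "Cod C (A \<lhd> h) = A \<otimes> Cod C h"
  "A \<in> Ob C \<Longrightarrow> h \<in> Arr C \<Longrightarrow> A \<lhd> h \<in> Arr C"
  "A \<in> Ob C \<Longrightarrow> B \<in> Ob C \<Longrightarrow> A \<lhd> \<one> B = \<one> (A \<otimes> B)"
  "A \<in> Ob C \<Longrightarrow> h \<in> Arr C \<Longrightarrow> (A \<lhd> h)\<dagger> = A \<lhd> h\<dagger>"
  by (simp_all add: lw_def)

lemma lw_comp:
  "A \<in> Ob C \<Longrightarrow> h \<in> Arr C \<Longrightarrow> k \<in> Arr C \<Longrightarrow> Dom C h = Cod C k \<Longrightarrow> A \<lhd> (h \<cdot> k) = A \<lhd> h \<cdot> A \<lhd> k"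
  by (simp add: lw_def tensor_comp')

lemma lw_merge:
  "A \<in> Ob C \<Longrightarrow> h \<in> Arr C \<Longrightarrow> k \<in> Arr C \<Longrightarrow> Dom C h = Cod C k \<Longrightarrow> A \<lhd> h \<cdot> A \<lhd> k = A \<lhd> (h \<cdot> k)"
  "A \<in> Ob C \<Longrightarrow> h \<in> Arr C \<Longrightarrow> k \<in> Arr C \<Longrightarrow> Dom C h = Cod C k \<Longrightarrow> r \<in> Arr C \<Longrightarrow> Cod C r = A \<otimes> Dom C k \<Longrightarrow>
    A \<lhd> h \<cdot> A \<lhd> k \<cdot> r = A \<lhd> (h \<cdot> k) \<cdot> r"
  by (simp_all add: lw_comp)

lemma act_simps [simp]:
  "Dom C (f \<rhd> Z) = Dom C f \<otimes> Z"
  "Cod C (f \<rhd> Z) = Cod C f \<otimes> Z"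
  "Z \<in> Ob C \<Longrightarrow> f \<in> Arr C \<Longrightarrow> f \<rhd> Z \<in> Arr C"
  "A \<in> Ob C \<Longrightarrow> Z \<in> Ob C \<Longrightarrow> \<one> A \<rhd> Z = \<one> (A \<otimes> Z)"
  "Z \<in> Ob C \<Longrightarrow> f \<in> Arr C \<Longrightarrow> (f \<rhd> Z)\<dagger> = f\<dagger> \<rhd> Z"
  by (simp_all add: act_def)

lemma act_comp:
  "Z \<in> Ob C \<Longrightarrow> h \<in> Arr C \<Longrightarrow> k \<in> Arr C \<Longrightarrow> Dom C h = Cod C k \<Longrightarrow> (h \<cdot> k) \<rhd> Z = h \<rhd> Z \<cdot> k \<rhd> Z"
  by (simp add: act_def tensor_comp')

text \<open>The interchange law, oriented so that actions on the head move to the right. Here and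
  below, objects that have to agree are linked by equational hypotheses, so that simp can match
  objects that become equal only after rewriting.\<close>

lemma act_lw:
  assumes "f \<in> Arr C" "h \<in> Arr C" "A = Dom C f" "Z = Cod C h"
  shows "f \<rhd> Z \<cdot> A \<lhd> h = Cod C f \<lhd> h \<cdot> f \<rhd> Dom C h"
  using assms by (simp add: lw_def act_def tensor_comp')

lemmas act_lw' = act_lw [THEN reassoc]

lemma tensor_split: "f \<in> Arr C \<Longrightarrow> g \<in> Arr C \<Longrightarrow> f \<boxtimes> g = Cod C f \<lhd> g \<cdot> f \<rhd> Dom C g"
  by (simp add: lw_def act_def tensor_comp')

lemma assoc_natural':
  assumes "f \<in> Arr C" "g \<in> Arr C" "h \<in> Arr C"
  shows "\<alpha> (Cod C f) (Cod C g) (Cod C h) \<cdot> ((f \<boxtimes> g) \<boxtimes> h) = (f \<boxtimes> (g \<boxtimes> h)) \<cdot> \<alpha> (Dom C f) (Dom C g) (Dom C h)"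
  using assms by (intro assoc_natural) auto

lemma assoc_lw:
  assumes "A \<in> Ob C" "B \<in> Ob C" "h \<in> Arr C" "Z = Cod C h" "E = A \<otimes> B"
  shows "\<alpha> A B Z \<cdot> E \<lhd> h = A \<lhd> B \<lhd> h \<cdot> \<alpha> A B (Dom C h)"
  using assms assoc_natural' [of "\<one> A" "\<one> B" h] by (simp add: lw_def)

lemmas assoc_lw' = assoc_lw [THEN reassoc]

lemma lw_dag_assoc:
  assumes "A \<in> Ob C" "B \<in> Ob C" "h \<in> Arr C" "Z = Dom C h" "E = A \<otimes> B"
  shows "E \<lhd> h \<cdot> (\<alpha> A B Z)\<dagger> = (\<alpha> A B (Cod C h))\<dagger> \<cdot> A \<lhd> B \<lhd> h"
  using arg_cong [OF assoc_lw [OF assms(1,2) arr_dag [OF assms(3)] refl assms(5)], of "Dag C"] assms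
  by simp

lemmas lw_dag_assoc' = lw_dag_assoc [THEN reassoc]

lemma act_tensor:
  assumes "f \<in> Arr C" "g \<in> Arr C" "Z \<in> Ob C"
  shows "(f \<boxtimes> g) \<rhd> Z = (\<alpha> (Cod C f) (Cod C g) Z)\<dagger> \<cdot> Cod C f \<lhd> (g \<rhd> Z) \<cdot> f \<rhd> (Dom C g \<otimes> Z) \<cdot> \<alpha> (Dom C f) (Dom C g) Z"
proof -
  have "(f \<boxtimes> g) \<rhd> Z = (\<alpha> (Cod C f) (Cod C g) Z)\<dagger> \<cdot> \<alpha> (Cod C f) (Cod C g) Z \<cdot> ((f \<boxtimes> g) \<rhd> Z)"
    using assms by simp
  also have "\<alpha> (Cod C f) (Cod C g) Z \<cdot> ((f \<boxtimes> g) \<rhd> Z) = (f \<boxtimes> (g \<rhd> Z)) \<cdot> \<alpha> (Dom C f) (Dom C g) Z"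
    using assms assoc_natural' [of f g "\<one> Z"] by (simp add: act_def)
  also have "f \<boxtimes> (g \<rhd> Z) = Cod C f \<lhd> (g \<rhd> Z) \<cdot> f \<rhd> (Dom C g \<otimes> Z)"
    using assms by (simp add: tensor_split)
  finally show ?thesis using assms by simp
qed

lemma act_lw_act:
  assumes "A \<in> Ob C" "g \<in> Arr C" "Z \<in> Ob C"
  shows "(A \<lhd> g) \<rhd> Z = (\<alpha> A (Cod C g) Z)\<dagger> \<cdot> A \<lhd> (g \<rhd> Z) \<cdot> \<alpha> A (Dom C g) Z"
  using assms act_tensor [of "\<one> A" g Z] by (simp flip: lw_def)

lemma act_act:
  assumes "B \<in> Ob C" "f \<in> Arr C" "Z \<in> Ob C"
  shows "(f \<rhd> B) \<rhd> Z = (\<alpha> (Cod C f) B Z)\<dagger> \<cdot> f \<rhd> (B \<otimes> Z) \<cdot> \<alpha> (Dom C f) B Z"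
  using assms act_tensor [of f "\<one> B" Z] by (simp flip: act_def)

text \<open>The pentagon, solved for the associator that acts on a head; none is left inside
  \<open>\<rhd>\<close>.\<close>

lemma act_assoc:
  assumes "A \<in> Ob C" "B \<in> Ob C" "D \<in> Ob C" "Z \<in> Ob C"
  shows "\<alpha> A B D \<rhd> Z = (\<alpha> A (B \<otimes> D) Z)\<dagger> \<cdot> A \<lhd> (\<alpha> B D Z)\<dagger> \<cdot> \<alpha> A B (D \<otimes> Z) \<cdot> \<alpha> (A \<otimes> B) D Z"
proof -
  have "A \<lhd> \<alpha> B D Z \<cdot> \<alpha> A (B \<otimes> D) Z \<cdot> (\<alpha> A B D \<rhd> Z) = \<alpha> A B (D \<otimes> Z) \<cdot> \<alpha> (A \<otimes> B) D Z"
    using pentagon assms by (simp add: lw_def act_def)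
  then have "(\<alpha> A (B \<otimes> D) Z)\<dagger> \<cdot> (A \<lhd> \<alpha> B D Z)\<dagger> \<cdot> A \<lhd> \<alpha> B D Z \<cdot> \<alpha> A (B \<otimes> D) Z \<cdot> (\<alpha> A B D \<rhd> Z)
     = (\<alpha> A (B \<otimes> D) Z)\<dagger> \<cdot> (A \<lhd> \<alpha> B D Z)\<dagger> \<cdot> \<alpha> A B (D \<otimes> Z) \<cdot> \<alpha> (A \<otimes> B) D Z" by simp
  moreover have "(A \<lhd> \<alpha> B D Z)\<dagger> \<cdot> A \<lhd> \<alpha> B D Z \<cdot> k = k" if "k \<in> Arr C" "Cod C k = A \<otimes> (B \<otimes> D) \<otimes> Z" for k
    using assms that by (simp flip: lw_comp comp_assoc')
  ultimately show ?thesis using assms by simp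
qed

lemma act_runit:
  "A \<in> Ob C \<Longrightarrow> Z \<in> Ob C \<Longrightarrow> \<rho> A \<rhd> Z = A \<lhd> \<ll> Z \<cdot> \<alpha> A \<I> Z"
  using triangle by (simp add: lw_def act_def)

lemma lunit_natural':
  "h \<in> Arr C \<Longrightarrow> Z = Cod C h \<Longrightarrow> \<ll> Z \<cdot> \<I> \<lhd> h = h \<cdot> \<ll> (Dom C h)"
  using lunit_natural [of h "Dom C h" "Cod C h"] by (simp add: lw_def)

lemmas lunit_natural'' = lunit_natural' [THEN reassoc]

lemma lw_dag_lunit:
  assumes "h \<in> Arr C" "Z = Dom C h" shows "\<I> \<lhd> h \<cdot> (\<ll> Z)\<dagger> = (\<ll> (Cod C h))\<dagger> \<cdot> h"
  using arg_cong [OF lunit_natural' [OF arr_dag [OF assms(1)] refl], of "Dag C"] assms by simp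

lemmas lw_dag_lunit' = lw_dag_lunit [THEN reassoc]

lemma runit_natural':
  "f \<in> Arr C \<Longrightarrow> Z = Cod C f \<Longrightarrow> \<rho> Z \<cdot> f \<rhd> \<I> = f \<cdot> \<rho> (Dom C f)"
  using runit_natural [of f "Dom C f" "Cod C f"] by (simp add: act_def)

text \<open>The tail \<open>\<I>\<close> is enough: the right unitor is natural and invertible, so
  \<open>f \<rhd> \<I>\<close> determines \<open>f\<close>. The premise for all \<open>Z\<close>
  presents the goal in the form that the rewrite rules normalize.\<close>

lemma act_eqI:
  assumes "f \<in> Arr C" "g \<in> Arr C" "Dom C f = Dom C g" "Cod C f = Cod C g"
    and "\<And>Z. Z \<in> Ob C \<Longrightarrow> f \<rhd> Z = g \<rhd> Z"
  shows "f = g"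
proof -
  have "f \<cdot> \<rho> (Dom C f) = g \<cdot> \<rho> (Dom C f)"
    using assms runit_natural' [of f "Cod C f"] runit_natural' [of g "Cod C f"] by simp
  then have "(f \<cdot> \<rho> (Dom C f)) \<cdot> (\<rho> (Dom C f))\<dagger> = (g \<cdot> \<rho> (Dom C f)) \<cdot> (\<rho> (Dom C f))\<dagger>" by simp
  then show ?thesis using assms by simp
qed

lemma lw_unit_cancel:
  assumes "f \<in> Arr C" "g \<in> Arr C" "Dom C f = Dom C g" "Cod C f = Cod C g" "\<I> \<lhd> f = \<I> \<lhd> g"
  shows "f = g"
proof -
  have "f \<cdot> \<ll> (Dom C f) = g \<cdot> \<ll> (Dom C f)"
    using assms lunit_natural' [of f "Cod C f"] lunit_natural' [of g "Cod C f"] by simp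
  then have "(f \<cdot> \<ll> (Dom C f)) \<cdot> (\<ll> (Dom C f))\<dagger> = (g \<cdot> \<ll> (Dom C f)) \<cdot> (\<ll> (Dom C f))\<dagger>" by simp
  then show ?thesis using assms by simp
qed

text \<open>Kelly's argument: compare both sides after whiskering with the unit, where the pentagon applies.\<close>

lemma act_lunit:
  assumes "A \<in> Ob C" "Z \<in> Ob C"
  shows "\<ll> A \<rhd> Z = \<ll> (A \<otimes> Z) \<cdot> \<alpha> \<I> A Z"
proof (rule lw_unit_cancel)
  \<comment> \<open>The two pentagon factors that precede
    \<open>\<I> \<lhd> \<alpha> \<I> A Z\<close>. Since \<open>?k \<cdot> ?k\<dagger>\<close> is an
    identity, \<open>?k\<close> can be cancelled at the end.\<close>
  let ?k = "\<alpha> \<I> (\<I> \<otimes> A) Z \<cdot> (\<alpha> \<I> \<I> A \<rhd> Z)"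
  have "\<I> \<lhd> (\<ll> (A \<otimes> Z) \<cdot> \<alpha> \<I> A Z) \<cdot> ?k = \<I> \<lhd> \<ll> (A \<otimes> Z) \<cdot> \<alpha> \<I> \<I> (A \<otimes> Z) \<cdot> \<alpha> (\<I> \<otimes> \<I>) A Z"
    using assms pentagon [of \<I> \<I> A Z] by (simp add: lw_comp) (simp add: lw_def act_def)
  also have "\<dots> = \<rho> \<I> \<rhd> (A \<otimes> Z) \<cdot> \<alpha> (\<I> \<otimes> \<I>) A Z"
    using assms by (simp add: act_runit)
  also have "\<dots> = \<alpha> \<I> A Z \<cdot> (\<rho> \<I> \<rhd> A) \<rhd> Z"
    using assms by (simp add: act_act)
  also have "\<dots> = \<alpha> \<I> A Z \<cdot> (\<I> \<lhd> \<ll> A) \<rhd> Z \<cdot> \<alpha> \<I> \<I> A \<rhd> Z"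
    using assms by (simp add: act_runit act_comp)
  also have "\<dots> = \<I> \<lhd> (\<ll> A \<rhd> Z) \<cdot> ?k"
    using assms by (simp add: act_lw_act)
  finally have "(\<I> \<lhd> (\<ll> (A \<otimes> Z) \<cdot> \<alpha> \<I> A Z) \<cdot> ?k) \<cdot> ?k\<dagger> = (\<I> \<lhd> (\<ll> A \<rhd> Z) \<cdot> ?k) \<cdot> ?k\<dagger>" by simp
  moreover have "?k \<cdot> ?k\<dagger> = \<one> (\<I> \<otimes> (\<I> \<otimes> A) \<otimes> Z)"
    using assms by (simp add: act_assoc act_lw assoc_lw lw_dag_assoc) (simp flip: lw_comp comp_assoc')
  ultimately show "\<I> \<lhd> (\<ll> A \<rhd> Z) = \<I> \<lhd> (\<ll> (A \<otimes> Z) \<cdot> \<alpha> \<I> A Z)"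
    using assms by simp
qed (use assms in auto)


section \<open>Cancellation below a head, and the symmetry as an adjacent transposition\<close>

lemma lw_cancel [simp]:
  assumes "a \<in> Arr C" "b \<in> Arr C" "A \<in> Ob C" "Dom C a = Cod C b" "a \<cdot> b = \<one> (Dom C b)"
  shows "A \<lhd> a \<cdot> A \<lhd> b = \<one> (A \<otimes> Dom C b)"
  using assms by (simp flip: lw_comp)

lemma lw_cancel' [simp]:
  assumes "a \<in> Arr C" "b \<in> Arr C" "A \<in> Ob C" "Dom C a = Cod C b" "a \<cdot> b = \<one> (Dom C b)"
    and "k \<in> Arr C" "Cod C k = A \<otimes> Dom C b"
  shows "A \<lhd> a \<cdot> A \<lhd> b \<cdot> k = k"
  using reassoc [OF lw_cancel [OF assms(1-5)] _ _ assms(6)] assms by simp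

text \<open>The exchange of the first two factors of a right-nested product. Unlike
  \<open>\<sigma>\<close>, it composes with its neighbours without associators in between.\<close>

definition sw :: "'o \<Rightarrow> 'o \<Rightarrow> 'o \<Rightarrow> 'm" where
  "sw A B Z = \<alpha> B A Z \<cdot> \<sigma> A B \<rhd> Z \<cdot> (\<alpha> A B Z)\<dagger>"

lemma sw_simps [simp]:
  "A \<in> Ob C \<Longrightarrow> B \<in> Ob C \<Longrightarrow> Z \<in> Ob C \<Longrightarrow> sw A B Z \<in> Arr C"
  "Dom C (sw A B Z) = A \<otimes> (B \<otimes> Z)"
  "Cod C (sw A B Z) = B \<otimes> (A \<otimes> Z)"
  "A \<in> Ob C \<Longrightarrow> B \<in> Ob C \<Longrightarrow> Z \<in> Ob C \<Longrightarrow> (sw A B Z)\<dagger> = sw B A Z"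
  by (simp_all add: sw_def)

lemma sw_sw [simp]:
  assumes "A \<in> Ob C" "B \<in> Ob C" "Z \<in> Ob C"
  shows "sw A B Z \<cdot> sw B A Z = \<one> (B \<otimes> (A \<otimes> Z))"
proof -
  have "\<sigma> A B \<rhd> Z \<cdot> \<sigma> B A \<rhd> Z = \<one> ((B \<otimes> A) \<otimes> Z)"
    using assms by (simp flip: act_comp)
  from reassoc [OF this] show ?thesis using assms by (simp add: sw_def)
qed

lemma sw_sw' [simp]:
  assumes "A \<in> Ob C" "B \<in> Ob C" "Z \<in> Ob C" "k \<in> Arr C" "Cod C k = B \<otimes> (A \<otimes> Z)"
  shows "sw A B Z \<cdot> sw B A Z \<cdot> k = k"
  using reassoc [OF sw_sw [OF assms(1-3)] _ _ assms(4)] assms by simp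

lemma act_symm:
  "A \<in> Ob C \<Longrightarrow> B \<in> Ob C \<Longrightarrow> Z \<in> Ob C \<Longrightarrow> \<sigma> A B \<rhd> Z = (\<alpha> B A Z)\<dagger> \<cdot> sw A B Z \<cdot> \<alpha> A B Z"
  by (simp add: sw_def)

lemma sw_lw_lw:
  assumes "A \<in> Ob C" "B \<in> Ob C" "h \<in> Arr C" "Z = Cod C h"
  shows "sw A B Z \<cdot> A \<lhd> B \<lhd> h = B \<lhd> A \<lhd> h \<cdot> sw A B (Dom C h)"
proof -
  have "(\<alpha> A B Z)\<dagger> \<cdot> A \<lhd> B \<lhd> h = (A \<otimes> B) \<lhd> h \<cdot> (\<alpha> A B (Dom C h))\<dagger>"
    using lw_dag_assoc [of A B h] assms by simp
  then have "sw A B Z \<cdot> A \<lhd> B \<lhd> h = \<alpha> B A Z \<cdot> \<sigma> A B \<rhd> Z \<cdot> (A \<otimes> B) \<lhd> h \<cdot> (\<alpha> A B (Dom C h))\<dagger>"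
    using assms by (simp add: sw_def)
  also have "\<dots> = B \<lhd> A \<lhd> h \<cdot> sw A B (Dom C h)"
    using assms by (simp add: act_lw' assoc_lw' sw_def)
  finally show ?thesis .
qed

lemma symm_tensor:
  assumes "f \<in> Arr C" "g \<in> Arr C"
  shows "\<sigma> (Cod C f) (Cod C g) \<cdot> (f \<boxtimes> g) = (g \<boxtimes> f) \<cdot> \<sigma> (Dom C f) (Dom C g)"
  using assms by (intro symm_natural) auto

lemma dag_assoc_act:
  assumes "f \<in> Arr C" "B \<in> Ob C" "Z \<in> Ob C"
  shows "(\<alpha> (Cod C f) B Z)\<dagger> \<cdot> f \<rhd> (B \<otimes> Z) = (f \<rhd> B) \<rhd> Z \<cdot> (\<alpha> (Dom C f) B Z)\<dagger>"
  using assms by (simp add: act_act)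

lemma sw_act:
  assumes "f \<in> Arr C" "D \<in> Ob C" "Z \<in> Ob C" "B = Cod C f" "W = D \<otimes> Z"
  shows "sw B D Z \<cdot> f \<rhd> W = D \<lhd> (f \<rhd> Z) \<cdot> sw (Dom C f) D Z"
proof -
  have "\<sigma> (Cod C f) D \<cdot> f \<rhd> D = D \<lhd> f \<cdot> \<sigma> (Dom C f) D"
    using assms symm_tensor [of f "\<one> D"] by (simp add: act_def lw_def)
  then have *: "\<sigma> (Cod C f) D \<rhd> Z \<cdot> (f \<rhd> D) \<rhd> Z = (D \<lhd> f) \<rhd> Z \<cdot> \<sigma> (Dom C f) D \<rhd> Z"
    using assms by (simp flip: act_comp)
  have "sw B D Z \<cdot> f \<rhd> W = \<alpha> D B Z \<cdot> (\<sigma> (Cod C f) D \<rhd> Z \<cdot> (f \<rhd> D) \<rhd> Z) \<cdot> (\<alpha> (Dom C f) D Z)\<dagger>"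
    using assms by (simp add: sw_def dag_assoc_act)
  then show ?thesis unfolding * using assms by (simp add: sw_def act_lw_act)
qed

lemma sw_lw_act:
  assumes "f \<in> Arr C" "D \<in> Ob C" "Z \<in> Ob C" "B = Cod C f"
  shows "sw D B Z \<cdot> D \<lhd> (f \<rhd> Z) = f \<rhd> (D \<otimes> Z) \<cdot> sw D (Dom C f) Z"
proof -
  have "sw B D Z \<cdot> f \<rhd> (D \<otimes> Z) = D \<lhd> (f \<rhd> Z) \<cdot> sw (Dom C f) D Z"
    using assms by (intro sw_act) auto
  then have "sw D B Z \<cdot> (sw B D Z \<cdot> f \<rhd> (D \<otimes> Z)) \<cdot> sw D (Dom C f) Z =
      sw D B Z \<cdot> (D \<lhd> (f \<rhd> Z) \<cdot> sw (Dom C f) D Z) \<cdot> sw D (Dom C f) Z"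
    by simp
  then show ?thesis using assms by simp
qed

lemmas sw_lw_lw' = sw_lw_lw [THEN reassoc]

lemmas sw_act' = sw_act [THEN reassoc]

lemmas sw_lw_act' = sw_lw_act [THEN reassoc]

text \<open>The hexagon: to cross \<open>B \<otimes> D\<close> is to cross \<open>B\<close> and then
  \<open>D\<close>.\<close>

lemma sw_tensor_right:
  assumes "A \<in> Ob C" "B \<in> Ob C" "D \<in> Ob C" "Z \<in> Ob C"
  shows "sw A (B \<otimes> D) Z = (\<alpha> B D (A \<otimes> Z))\<dagger> \<cdot> B \<lhd> sw A D Z \<cdot> sw A B (D \<otimes> Z) \<cdot> A \<lhd> \<alpha> B D Z"
proof -
  have "\<alpha> B D A \<cdot> \<sigma> A (B \<otimes> D) \<cdot> \<alpha> A B D = B \<lhd> \<sigma> A D \<cdot> \<alpha> B A D \<cdot> \<sigma> A B \<rhd> D"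
    using assms hexagon by (simp add: act_def lw_def)
  then have "(\<alpha> B D A)\<dagger> \<cdot> (\<alpha> B D A \<cdot> \<sigma> A (B \<otimes> D) \<cdot> \<alpha> A B D) \<cdot> (\<alpha> A B D)\<dagger>
    = (\<alpha> B D A)\<dagger> \<cdot> (B \<lhd> \<sigma> A D \<cdot> \<alpha> B A D \<cdot> \<sigma> A B \<rhd> D) \<cdot> (\<alpha> A B D)\<dagger>"
    by simp
  then have *: "\<sigma> A (B \<otimes> D) = (\<alpha> B D A)\<dagger> \<cdot> B \<lhd> \<sigma> A D \<cdot> \<alpha> B A D \<cdot> \<sigma> A B \<rhd> D \<cdot> (\<alpha> A B D)\<dagger>"
    using assms by simp
  have d: "(\<alpha> A B D)\<dagger> \<rhd> Z = (\<alpha> (A \<otimes> B) D Z)\<dagger> \<cdot> (\<alpha> A B (D \<otimes> Z))\<dagger> \<cdot> A \<lhd> \<alpha> B D Z \<cdot> \<alpha> A (B \<otimes> D) Z" 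
    if "A \<in> Ob C" "B \<in> Ob C" "D \<in> Ob C" for A B D
    using arg_cong [OF act_assoc, of A B D Z "Dag C"] that assms by simp
  show ?thesis
    unfolding sw_def [of A "B \<otimes> D"] * using assms 
    by (simp add: act_comp d act_assoc act_act sw_def act_lw_act lw_comp)
 qed

lemma sw_tensor_left:
  assumes "A \<in> Ob C" "B \<in> Ob C" "D \<in> Ob C" "Z \<in> Ob C"
  shows "sw (A \<otimes> B) D Z = D \<lhd> (\<alpha> A B Z)\<dagger> \<cdot> sw A D (B \<otimes> Z) \<cdot> A \<lhd> sw B D Z \<cdot> \<alpha> A B (D \<otimes> Z)"
  using assms arg_cong [OF sw_tensor_right [of D A B Z], of "Dag C"] by simp

text \<open>Follows from the hexagon with two units by naturality in \<open>\<ll> \<I>\<close>.\<close>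

lemma sw_unit_right:
  assumes "A \<in> Ob C" "Z \<in> Ob C"
  shows "sw A \<I> Z = (\<ll> (A \<otimes> Z))\<dagger> \<cdot> A \<lhd> \<ll> Z"
proof -
  have "sw A \<I> Z \<cdot> A \<lhd> (\<ll> \<I> \<rhd> Z) = \<ll> \<I> \<rhd> (A \<otimes> Z) \<cdot> sw A (\<I> \<otimes> \<I>) Z"
    using assms by (simp add: sw_lw_act)
  also have "\<dots> = \<ll> (\<I> \<otimes> A \<otimes> Z) \<cdot> \<I> \<lhd> sw A \<I> Z \<cdot> sw A \<I> (\<I> \<otimes> Z) \<cdot> A \<lhd> \<alpha> \<I> \<I> Z"
    using assms by (simp add: sw_tensor_right act_lunit)
  also have "\<dots> = sw A \<I> Z \<cdot> \<ll> (A \<otimes> \<I> \<otimes> Z) \<cdot> sw A \<I> (\<I> \<otimes> Z) \<cdot> A \<lhd> \<alpha> \<I> \<I> Z"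
    using assms by (simp add: lunit_natural'')
  finally have "sw \<I> A Z \<cdot> (sw A \<I> Z \<cdot> A \<lhd> (\<ll> \<I> \<rhd> Z)) \<cdot> A \<lhd> (\<alpha> \<I> \<I> Z)\<dagger> =
    sw \<I> A Z \<cdot> (sw A \<I> Z \<cdot> \<ll> (A \<otimes> \<I> \<otimes> Z) \<cdot> sw A \<I> (\<I> \<otimes> Z) \<cdot> A \<lhd> \<alpha> \<I> \<I> Z) \<cdot> A \<lhd> (\<alpha> \<I> \<I> Z)\<dagger>"
    by simp
  then have "A \<lhd> \<ll> (\<I> \<otimes> Z) = \<ll> (A \<otimes> \<I> \<otimes> Z) \<cdot> sw A \<I> (\<I> \<otimes> Z)"
    using assms by (simp add: act_lunit lw_comp)
  \<comment> \<open>The preceding equation is the claim for the tail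
    \<open>\<I> \<otimes> Z\<close>. Composition with the left unitor of \<open>Z\<close> and its
    inverse on the two sides passes to \<open>Z\<close>.\<close>
  then have "A \<lhd> \<ll> Z \<cdot> (A \<lhd> \<ll> (\<I> \<otimes> Z)) \<cdot> A \<lhd> (\<I> \<lhd> (\<ll> Z)\<dagger>) = 
    A \<lhd> \<ll> Z \<cdot> (\<ll> (A \<otimes> \<I> \<otimes> Z) \<cdot> sw A \<I> (\<I> \<otimes> Z)) \<cdot> A \<lhd> (\<I> \<lhd> (\<ll> Z)\<dagger>)" by simp
  moreover have "A \<lhd> \<ll> Z \<cdot> (A \<lhd> \<ll> (\<I> \<otimes> Z)) \<cdot> A \<lhd> (\<I> \<lhd> (\<ll> Z)\<dagger>) = A \<lhd> \<ll> Z"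
    using assms by (simp add: lunit_natural' flip: lw_comp)
  moreover have "A \<lhd> \<ll> Z \<cdot> (\<ll> (A \<otimes> \<I> \<otimes> Z) \<cdot> sw A \<I> (\<I> \<otimes> Z)) \<cdot> A \<lhd> (\<I> \<lhd> (\<ll> Z)\<dagger>)
    = \<ll> (A \<otimes> Z) \<cdot> sw A \<I> Z"
    using assms by (simp add: sw_lw_lw lunit_natural'')
  ultimately have "A \<lhd> \<ll> Z = \<ll> (A \<otimes> Z) \<cdot> sw A \<I> Z" by simp
  then have "(\<ll> (A \<otimes> Z))\<dagger> \<cdot> (A \<lhd> \<ll> Z) = (\<ll> (A \<otimes> Z))\<dagger> \<cdot> \<ll> (A \<otimes> Z) \<cdot> sw A \<I> Z" by simp
  then show ?thesis using assms by simp
qed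

lemma sw_unit_left:
  "A \<in> Ob C \<Longrightarrow> Z \<in> Ob C \<Longrightarrow> sw \<I> A Z = A \<lhd> (\<ll> Z)\<dagger> \<cdot> \<ll> (A \<otimes> Z)"
  using arg_cong [OF sw_unit_right [of A Z], of "Dag C"] by simp

text \<open>Naturality of the crossing of \<open>A\<close> with a product, applied to
  \<open>\<sigma> B D\<close>; the hexagon then splits both crossings.\<close>

lemma yang_baxter:
  assumes "A \<in> Ob C" "B \<in> Ob C" "D \<in> Ob C" "Z \<in> Ob C"
  shows "sw B D (A \<otimes> Z) \<cdot> B \<lhd> sw A D Z \<cdot> sw A B (D \<otimes> Z) =
    D \<lhd> sw A B Z \<cdot> sw A D (B \<otimes> Z) \<cdot> A \<lhd> sw B D Z"
proof -
  have "sw A (D \<otimes> B) Z \<cdot> A \<lhd> (\<sigma> B D \<rhd> Z) = \<sigma> B D \<rhd> (A \<otimes> Z) \<cdot> sw A (B \<otimes> D) Z"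
    using assms by (simp add: sw_lw_act)
  then have "\<alpha> D B (A \<otimes> Z) \<cdot> (sw A (D \<otimes> B) Z \<cdot> A \<lhd> (\<sigma> B D \<rhd> Z)) \<cdot> A \<lhd> (\<alpha> B D Z)\<dagger> =
    \<alpha> D B (A \<otimes> Z) \<cdot> (\<sigma> B D \<rhd> (A \<otimes> Z) \<cdot> sw A (B \<otimes> D) Z) \<cdot> A \<lhd> (\<alpha> B D Z)\<dagger>" by simp
  then show ?thesis using assms by (simp add: act_symm sw_tensor_right lw_comp)
qed

lemmas whisker =
  lw_comp act_comp act_lw act_lw' assoc_lw assoc_lw' lw_dag_assoc lw_dag_assoc'
  act_tensor act_lw_act act_act act_assoc act_runit act_lunit act_symm
  sw_lw_lw sw_lw_lw' sw_act sw_act' sw_lw_act sw_lw_act' sw_tensor_left sw_tensor_right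
  sw_unit_left sw_unit_right lunit_natural' lunit_natural'' lw_dag_lunit lw_dag_lunit'

text \<open>\<open>lw_comp\<close> distributes \<open>\<lhd>\<close> over composites, so a rule for
  \<open>a \<cdot> b\<close> does not match below a head. The lifted versions, for one and two
  heads, do.\<close>

lemma lw_lift:
  assumes "a \<cdot> b = c" "a \<in> Arr C" "b \<in> Arr C" "D \<in> Ob C" "Dom C a = Cod C b"
  shows "D \<lhd> a \<cdot> D \<lhd> b = D \<lhd> c"
  using assms by (simp flip: lw_comp)

lemmas whisker_rules = act_lw assoc_lw lw_dag_assoc sw_lw_lw sw_act sw_lw_act lunit_natural' lw_dag_lunit
lemmas whisker1 = whisker_rules [THEN lw_lift] whisker_rules [THEN lw_lift, THEN reassoc]
lemmas whisker2 = whisker_rules [THEN lw_lift, THEN lw_lift] whisker_rules [THEN lw_lift, THEN lw_lift, THEN reassoc]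

lemma act_dag_assoc:
  assumes "A \<in> Ob C" "B \<in> Ob C" "D \<in> Ob C" "Z \<in> Ob C"
  shows "(\<alpha> A B D)\<dagger> \<rhd> Z = (\<alpha> (A \<otimes> B) D Z)\<dagger> \<cdot> (\<alpha> A B (D \<otimes> Z))\<dagger> \<cdot> A \<lhd> \<alpha> B D Z \<cdot> \<alpha> A (B \<otimes> D) Z"
  using arg_cong [OF act_assoc, of A B D Z "Dag C"] assms by simp

lemma act_dag_lunit:
  assumes "A \<in> Ob C" "Z \<in> Ob C"
  shows "(\<ll> A)\<dagger> \<rhd> Z = (\<alpha> \<I> A Z)\<dagger> \<cdot> (\<ll> (A \<otimes> Z))\<dagger>"
  using arg_cong [OF act_lunit, of A Z "Dag C"] assms by simp

lemma act_dag_runit: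
  assumes "A \<in> Ob C" "Z \<in> Ob C"
  shows "(\<rho> A)\<dagger> \<rhd> Z = (\<alpha> A \<I> Z)\<dagger> \<cdot> A \<lhd> (\<ll> Z)\<dagger>"
  using arg_cong [OF act_runit, of A Z "Dag C"] assms by simp

lemma lunit_symm: "A \<in> Ob C \<Longrightarrow> \<ll> A \<cdot> \<sigma> A \<I> = \<rho> A"
  by (rule act_eqI) (simp_all add: whisker)

text \<open>Naturality of the left unitor at \<open>\<ll> Z\<close> gives
  \<open>\<ll> (\<I> \<otimes> Z) = \<I> \<lhd> \<ll> Z\<close>, and these are the two unitors
  acting on \<open>Z\<close> up to the same associator.\<close>

lemma lunit_unit: "\<ll> \<I> = \<rho> \<I>"
proof (rule act_eqI)
  fix Z assume "Z \<in> Ob C"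
  then have "(\<ll> Z)\<dagger> \<cdot> \<ll> Z \<cdot> \<I> \<lhd> \<ll> Z = (\<ll> Z)\<dagger> \<cdot> \<ll> Z \<cdot> \<ll> (\<I> \<otimes> Z)"
    by (subst lunit_natural') simp_all
  then have "\<ll> (\<I> \<otimes> Z) = \<I> \<lhd> \<ll> Z"
    using \<open>Z \<in> Ob C\<close> by simp
  then show "\<ll> \<I> \<rhd> Z = \<rho> \<I> \<rhd> Z" using \<open>Z \<in> Ob C\<close> by (simp add: whisker)
qed auto

lemma symm_unit: "\<sigma> \<I> \<I> = \<one> (\<I> \<otimes> \<I>)"
proof -
  have "(\<ll> \<I>)\<dagger> \<cdot> \<ll> \<I> \<cdot> \<sigma> \<I> \<I> = (\<ll> \<I>)\<dagger> \<cdot> \<rho> \<I>"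
    by (simp only: lunit_symm unit_ob)
  then show ?thesis by (simp flip: lunit_unit)
qed

lemma sw_unit_unit: "Z \<in> Ob C \<Longrightarrow> sw \<I> \<I> Z = \<one> (\<I> \<otimes> \<I> \<otimes> Z)"
  by (simp add: sw_def symm_unit)

lemma act_sw:
  assumes "A \<in> Ob C" "B \<in> Ob C" "D \<in> Ob C" "Z \<in> Ob C"
  shows "sw A B D \<rhd> Z = (\<alpha> B (A \<otimes> D) Z)\<dagger> \<cdot> B \<lhd> (\<alpha> A D Z)\<dagger> \<cdot> sw A B (D \<otimes> Z) \<cdot> A \<lhd> \<alpha> B D Z \<cdot> \<alpha> A (B \<otimes> D) Z"
  unfolding sw_def using assms
  by (simp add: act_comp act_assoc act_dag_assoc act_act)

text \<open>Brings \<open>Q\<close> to the front, ahead of \<open>P\<close>. For duals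
  \<open>P\<close> of \<open>A\<close> and \<open>Q\<close> of \<open>B\<close> this collects the
  dual factors in reversed order, as in the dual of \<open>A \<otimes> B\<close>.\<close>

definition front :: "'o \<Rightarrow> 'o \<Rightarrow> 'o \<Rightarrow> 'o \<Rightarrow> 'm" where
  "front P A Q B = (\<alpha> Q P (A \<otimes> B))\<dagger> \<cdot> Q \<lhd> \<alpha> P A B \<cdot> sw (P \<otimes> A) Q B"

lemma front_simps [simp]:
  "P \<in> Ob C \<Longrightarrow> A \<in> Ob C \<Longrightarrow> Q \<in> Ob C \<Longrightarrow> B \<in> Ob C \<Longrightarrow> front P A Q B \<in> Arr C"
  "Dom C (front P A Q B) = (P \<otimes> A) \<otimes> (Q \<otimes> B)"
  "Cod C (front P A Q B) = (Q \<otimes> P) \<otimes> (A \<otimes> B)"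
  by (simp_all add: front_def)

lemma act_front:
  assumes "P \<in> Ob C" "A \<in> Ob C" "Q \<in> Ob C" "B \<in> Ob C" "Z \<in> Ob C"
  shows "front P A Q B \<rhd> Z = (\<alpha> (Q \<otimes> P) (A \<otimes> B) Z)\<dagger> \<cdot> (\<alpha> Q P ((A \<otimes> B) \<otimes> Z))\<dagger> \<cdot> Q \<lhd> P \<lhd> (\<alpha> A B Z)\<dagger> \<cdot>
    sw P Q (A \<otimes> B \<otimes> Z) \<cdot> P \<lhd> sw A Q (B \<otimes> Z) \<cdot> P \<lhd> A \<lhd> \<alpha> Q B Z \<cdot> \<alpha> P A ((Q \<otimes> B) \<otimes> Z) \<cdot> \<alpha> (P \<otimes> A) (Q \<otimes> B) Z"
  using assms by (simp add: front_def whisker act_dag_assoc act_sw)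

end

section \<open>Duals\<close>

locale typed_dcc = typed_dsmc C + dagger_compact_category C
  for C :: "('o, 'm, 'x) dccat_scheme" (structure) +
  assumes dom_cup [simp]: "Dom C (\<eta> A) = \<I>"
    and cod_cup [simp]: "Cod C (\<eta> A) = A\<^bold>* \<otimes> A"
begin

declare dual_ob [simp]

lemma arr_cup [simp]: "A \<in> Ob C \<Longrightarrow> \<eta> A \<in> Arr C"
  using cup_hom by simp

lemma counit_simps [simp]:
  "A \<in> Ob C \<Longrightarrow> \<epsilon> A \<in> Arr C"
  "Dom C (\<epsilon> A) = A \<otimes> A\<^bold>*"
  "Cod C (\<epsilon> A) = \<I>"
  by (simp_all add: counit_def)

text \<open>The cup as the insertion of a neighbouring pair ahead of any tail; \<open>capz\<close>
  is its dagger, the deletion of such a pair. Both are natural in the tail, so maps of the tail move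
  freely past them.\<close>

definition cupz :: "'o \<Rightarrow> 'o \<Rightarrow> 'm" where
  "cupz A Z = \<alpha> (A\<^bold>*) A Z \<cdot> \<eta> A \<rhd> Z \<cdot> (\<ll> Z)\<dagger>"

definition capz :: "'o \<Rightarrow> 'o \<Rightarrow> 'm" where
  "capz A Z = \<ll> Z \<cdot> (\<eta> A)\<dagger> \<rhd> Z \<cdot> (\<alpha> (A\<^bold>*) A Z)\<dagger>"

lemma cupz_simps [simp]:
  "A \<in> Ob C \<Longrightarrow> Z \<in> Ob C \<Longrightarrow> cupz A Z \<in> Arr C"
  "A \<in> Ob C \<Longrightarrow> Z \<in> Ob C \<Longrightarrow> capz A Z \<in> Arr C"
  "Dom C (cupz A Z) = Z"
  "Cod C (cupz A Z) = A\<^bold>* \<otimes> (A \<otimes> Z)"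
  "Dom C (capz A Z) = A\<^bold>* \<otimes> (A \<otimes> Z)"
  "Cod C (capz A Z) = Z"
  "A \<in> Ob C \<Longrightarrow> Z \<in> Ob C \<Longrightarrow> (cupz A Z)\<dagger> = capz A Z"
  "A \<in> Ob C \<Longrightarrow> Z \<in> Ob C \<Longrightarrow> (capz A Z)\<dagger> = cupz A Z"
  by (simp_all add: cupz_def capz_def)

lemma act_cup:
  "A \<in> Ob C \<Longrightarrow> Z \<in> Ob C \<Longrightarrow> \<eta> A \<rhd> Z = (\<alpha> (A\<^bold>*) A Z)\<dagger> \<cdot> cupz A Z \<cdot> \<ll> Z"
  "A \<in> Ob C \<Longrightarrow> Z \<in> Ob C \<Longrightarrow> (\<eta> A)\<dagger> \<rhd> Z = (\<ll> Z)\<dagger> \<cdot> capz A Z \<cdot> \<alpha> (A\<^bold>*) A Z"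
  by (simp_all add: cupz_def capz_def)

lemma cupz_natural:
  assumes "A \<in> Ob C" "h \<in> Arr C" "Z = Dom C h" "A' = A\<^bold>*"
  shows "A' \<lhd> A \<lhd> h \<cdot> cupz A Z = cupz A (Cod C h) \<cdot> h"
proof -
  have "\<eta> A \<rhd> Cod C h \<cdot> \<I> \<lhd> h = (A\<^bold>* \<otimes> A) \<lhd> h \<cdot> \<eta> A \<rhd> Dom C h"
    using assms by (simp add: act_lw)
  then have "(\<alpha> (A\<^bold>*) A (Cod C h) \<cdot> (\<eta> A \<rhd> Cod C h \<cdot> \<I> \<lhd> h)) \<cdot> (\<ll> (Dom C h))\<dagger> =
     (\<alpha> (A\<^bold>*) A (Cod C h) \<cdot> (A\<^bold>* \<otimes> A) \<lhd> h \<cdot> \<eta> A \<rhd> Dom C h) \<cdot> (\<ll> (Dom C h))\<dagger>"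
    by simp
  then show ?thesis using assms
    by (simp add: cupz_def assoc_lw' lw_dag_lunit del: act_lw)
qed

lemma capz_natural:
  assumes "A \<in> Ob C" "h \<in> Arr C" "Z = Cod C h" "A' = A\<^bold>*"
  shows "capz A Z \<cdot> A' \<lhd> A \<lhd> h = h \<cdot> capz A (Dom C h)"
  using arg_cong [OF cupz_natural [OF assms(1) arr_dag [OF assms(2)] refl assms(4)], of "Dag C"] assms
  by simp

lemmas cupz_natural' = cupz_natural [THEN reassoc]

lemmas capz_natural' = capz_natural [THEN reassoc]

lemma act_cupz:
  assumes "A \<in> Ob C" "W \<in> Ob C" "Z \<in> Ob C"
  shows "cupz A W \<rhd> Z = (\<alpha> (A\<^bold>*) (A \<otimes> W) Z)\<dagger> \<cdot> A\<^bold>* \<lhd> (\<alpha> A W Z)\<dagger> \<cdot> cupz A (W \<otimes> Z)"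
  unfolding cupz_def using assms
  by (simp add: act_comp act_assoc act_act act_dag_lunit)

lemma act_capz:
  assumes "A \<in> Ob C" "W \<in> Ob C" "Z \<in> Ob C"
  shows "capz A W \<rhd> Z = capz A (W \<otimes> Z) \<cdot> A\<^bold>* \<lhd> \<alpha> A W Z \<cdot> \<alpha> (A\<^bold>*) (A \<otimes> W) Z"
  using assms arg_cong [OF act_cupz [OF assms], of "Dag C"] by simp

text \<open>The symmetry is natural in \<open>\<eta> A\<close>, and crossing \<open>\<I>\<close> is
  only a unitor: a wire that crosses both legs of a cup has not crossed anything.\<close>

lemma cupz_slide:
  assumes "A \<in> Ob C" "D \<in> Ob C" "Z \<in> Ob C"
  shows "A\<^bold>* \<lhd> sw D A Z \<cdot> sw D (A\<^bold>*) (A \<otimes> Z) \<cdot> D \<lhd> cupz A Z = cupz A (D \<otimes> Z)"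
proof -
  have "sw D (A\<^bold>* \<otimes> A) Z \<cdot> D \<lhd> (\<eta> A \<rhd> Z) \<cdot> D \<lhd> (\<ll> Z)\<dagger> = \<eta> A \<rhd> (D \<otimes> Z) \<cdot> sw D \<I> Z \<cdot> D \<lhd> (\<ll> Z)\<dagger>"
    using assms by (simp add: sw_lw_act')
  then have "\<alpha> (A\<^bold>*) A (D \<otimes> Z) \<cdot> sw D (A\<^bold>* \<otimes> A) Z \<cdot> D \<lhd> (\<eta> A \<rhd> Z) \<cdot> D \<lhd> (\<ll> Z)\<dagger> = cupz A (D \<otimes> Z)"
    using assms by (simp add: sw_unit_right act_cup)
  then show ?thesis using assms by (simp add: sw_tensor_right cupz_def lw_comp)
qed

lemma capz_slide:
  assumes "A \<in> Ob C" "D \<in> Ob C" "Z \<in> Ob C"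
  shows "D \<lhd> capz A Z \<cdot> sw (A\<^bold>*) D (A \<otimes> Z) \<cdot> A\<^bold>* \<lhd> sw A D Z = capz A (D \<otimes> Z)"
  using arg_cong [OF cupz_slide [OF assms], of "Dag C"] assms by simp

lemma cupz_slide':
  assumes "A \<in> Ob C" "D \<in> Ob C" "Z \<in> Ob C"
  shows "sw D (A\<^bold>*) (A \<otimes> Z) \<cdot> D \<lhd> cupz A Z = A\<^bold>* \<lhd> sw A D Z \<cdot> cupz A (D \<otimes> Z)"
  using assms by (simp flip: cupz_slide)

text \<open>The snake for \<open>A\<close> after all associators and unitors have cancelled. The
  crossing is the one inside \<open>\<epsilon> A\<close>.\<close>

lemma snakez:
  assumes "A \<in> Ob C" "Z \<in> Ob C"
  shows "capz A (A \<otimes> Z) \<cdot> sw A (A\<^bold>*) (A \<otimes> Z) \<cdot> A \<lhd> cupz A Z = \<one> (A \<otimes> Z)"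
proof -
  have "(\<ll> A \<cdot> \<epsilon> A \<rhd> A \<cdot> (\<alpha> A (A\<^bold>*) A)\<dagger> \<cdot> A \<lhd> \<eta> A \<cdot> (\<rho> A)\<dagger>) \<rhd> Z = \<one> A \<rhd> Z"
    using snake assms by (simp add: act_def lw_def)
  then show ?thesis
    using assms by (simp add: counit_def whisker act_dag_assoc act_dag_runit act_cup act_cupz act_capz act_sw)
qed

lemma snakez_dual:
  assumes "A \<in> Ob C" "Z \<in> Ob C"
  shows "A\<^bold>* \<lhd> (capz A Z \<cdot> sw A (A\<^bold>*) Z) \<cdot> cupz A (A\<^bold>* \<otimes> Z) = \<one> (A\<^bold>* \<otimes> Z)"
proof -
  have "(\<rho> (A\<^bold>*) \<cdot> A\<^bold>* \<lhd> \<epsilon> A \<cdot> \<alpha> (A\<^bold>*) A (A\<^bold>*) \<cdot> \<eta> A \<rhd> A\<^bold>* \<cdot> (\<ll> (A\<^bold>*))\<dagger>) \<rhd> Z = \<one> (A\<^bold>*) \<rhd> Z"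
    using snake_dual assms by (simp add: act_def lw_def)
  then show ?thesis
    using assms by (simp add: counit_def whisker act_dag_assoc act_dag_lunit act_cup act_cupz act_capz act_sw)
qed

text \<open>The partial trace of the symmetry is the identity: sliding the cup across the wire turns
  the snake into this loop. It is the form in which the snake meets caps that are daggers of
  cups.\<close>

lemma loopz:
  assumes "A \<in> Ob C" "Z \<in> Ob C"
  shows "capz A (A \<otimes> Z) \<cdot> A\<^bold>* \<lhd> sw A A Z \<cdot> cupz A (A \<otimes> Z) = \<one> (A \<otimes> Z)"
  using snakez [OF assms] assms by (simp add: cupz_slide')

lemma snakez_dag:
  assumes "A \<in> Ob C" "Z \<in> Ob C"
  shows "capz A (A\<^bold>* \<otimes> Z) \<cdot> A\<^bold>* \<lhd> (sw (A\<^bold>*) A Z \<cdot> cupz A Z) = \<one> (A\<^bold>* \<otimes> Z)"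
  using arg_cong [OF snakez_dual [OF assms], of "Dag C"] assms by simp

text \<open>The loop over \<open>\<I>\<close>, whose crossing is trivial because
  \<open>\<sigma> \<I> \<I>\<close> is an identity. This holds on the tail
  \<open>\<I> \<otimes> Z\<close> and is carried to \<open>Z\<close> by the left unitor.\<close>

lemma unit_circle: "Z \<in> Ob C \<Longrightarrow> capz \<I> Z \<cdot> cupz \<I> Z = \<one> Z"
proof -
  assume Z: "Z \<in> Ob C"
  have *: "capz \<I> (\<I> \<otimes> Z) \<cdot> cupz \<I> (\<I> \<otimes> Z) = \<one> (\<I> \<otimes> Z)"
    using loopz [of \<I> Z] Z by (simp add: sw_unit_unit)
  have "\<one> Z = \<ll> Z \<cdot> (capz \<I> (\<I> \<otimes> Z) \<cdot> cupz \<I> (\<I> \<otimes> Z)) \<cdot> (\<ll> Z)\<dagger>"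
    unfolding * using Z by simp
  also have "cupz \<I> (\<I> \<otimes> Z) = \<I>\<^bold>* \<lhd> \<I> \<lhd> (\<ll> Z)\<dagger> \<cdot> cupz \<I> Z \<cdot> \<ll> Z"
    using Z by (simp add: cupz_natural')
  also have "\<ll> Z \<cdot> (capz \<I> (\<I> \<otimes> Z) \<cdot> \<dots>) \<cdot> (\<ll> Z)\<dagger> = capz \<I> Z \<cdot> cupz \<I> Z"
    using Z by (simp add: capz_natural')
  finally show ?thesis by simp
qed

text \<open>A map into a dual is determined by its contraction with \<open>A\<close>: a further cup
  bends the wire back, by \<open>snakez_dag\<close>. The equations for conjugates and for
  \<open>dual_tensor\<close> below are checked under a cap in this way.\<close>

lemma capz_eqI:
  assumes "A \<in> Ob C" "u \<in> Arr C" "v \<in> Arr C" "Dom C u = Dom C v" "Cod C u = A\<^bold>*" "Cod C v = A\<^bold>*"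
    and eq: "\<And>Z. Z \<in> Ob C \<Longrightarrow> capz A Z \<cdot> u \<rhd> (A \<otimes> Z) = capz A Z \<cdot> v \<rhd> (A \<otimes> Z)"
  shows "u = v"
proof (rule act_eqI)
  fix Z assume Z: "Z \<in> Ob C"
  have *: "w \<rhd> Z = (capz A (A\<^bold>* \<otimes> Z) \<cdot> w \<rhd> (A \<otimes> (A\<^bold>* \<otimes> Z))) \<cdot> Dom C w \<lhd> (sw (A\<^bold>*) A Z \<cdot> cupz A Z)"
    if "w \<in> Arr C" "Cod C w = A\<^bold>*" for w
  proof -
    have "w \<rhd> Z = (capz A (A\<^bold>* \<otimes> Z) \<cdot> A\<^bold>* \<lhd> (sw (A\<^bold>*) A Z \<cdot> cupz A Z)) \<cdot> w \<rhd> Z"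
      using snakez_dag assms Z that by simp
    then show ?thesis using assms Z that by (simp add: act_lw)
  qed
  show "u \<rhd> Z = v \<rhd> Z"
    using *[of u] *[of v] eq [of "A\<^bold>* \<otimes> Z"] assms Z by simp
qed (use assms in auto)

section \<open>Conjugation as a functor that commutes with the dagger\<close>

lemma conj_arr_simps [simp]:
  "f \<in> Arr C \<Longrightarrow> conj_arr C f \<in> Arr C"
  "Dom C (conj_arr C f) = (Dom C f)\<^bold>*"
  "Cod C (conj_arr C f) = (Cod C f)\<^bold>*"
  by (simp_all add: conj_arr_def transp_def Let_def)

lemma act_conj_arr:
  assumes "f \<in> Arr C" "Z \<in> Ob C" "Dom C f = A" "Cod C f = B"
  shows "conj_arr C f \<rhd> Z = B\<^bold>* \<lhd> (capz A Z \<cdot> sw A (A\<^bold>*) Z \<cdot> f\<dagger> \<rhd> (A\<^bold>* \<otimes> Z)) \<cdot> cupz B (A\<^bold>* \<otimes> Z)"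
proof -
  have [simp]: "A \<in> Ob C" "B \<in> Ob C" using assms by auto
  show ?thesis
    unfolding conj_arr_def transp_def counit_def Let_def lw_def [symmetric] act_def [symmetric]
    using assms by (simp add: whisker act_dag_assoc act_dag_lunit act_cup act_cupz act_capz act_sw)
      (simp add: lw_merge sw_act)
qed

text \<open>The contraction inside the transpose meets the cup of \<open>A\<close> in a snake;
  straightening it leaves \<open>f\<dagger>\<close>.\<close>

lemma conj_cup:
  assumes "f \<in> Arr C" "Z \<in> Ob C" "Dom C f = A" "Cod C f = B"
  shows "conj_arr C f \<rhd> (A \<otimes> Z) \<cdot> cupz A Z = B\<^bold>* \<lhd> (f\<dagger> \<rhd> Z) \<cdot> cupz B Z"
proof -
  have [simp]: "A \<in> Ob C" "B \<in> Ob C" using assms by auto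
  have c: "cupz B (A\<^bold>* \<otimes> A \<otimes> Z) \<cdot> cupz A Z = B\<^bold>* \<lhd> B \<lhd> cupz A Z \<cdot> cupz B Z"
    using assms by (simp add: cupz_natural)
  have "conj_arr C f \<rhd> (A \<otimes> Z) \<cdot> cupz A Z =
    B\<^bold>* \<lhd> (capz A (A \<otimes> Z) \<cdot> sw A (A\<^bold>*) (A \<otimes> Z) \<cdot> f\<dagger> \<rhd> (A\<^bold>* \<otimes> A \<otimes> Z) \<cdot> B \<lhd> cupz A Z) \<cdot> cupz B Z"
    using assms by (simp add: act_conj_arr c lw_comp)
  also have "capz A (A \<otimes> Z) \<cdot> sw A (A\<^bold>*) (A \<otimes> Z) \<cdot> f\<dagger> \<rhd> (A\<^bold>* \<otimes> A \<otimes> Z) \<cdot> B \<lhd> cupz A Z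
    = (capz A (A \<otimes> Z) \<cdot> sw A (A\<^bold>*) (A \<otimes> Z) \<cdot> A \<lhd> cupz A Z) \<cdot> f\<dagger> \<rhd> Z"
    using assms by (simp add: act_lw)
  also have "\<dots> = f\<dagger> \<rhd> Z" using assms by (subst snakez) simp_all
  finally show ?thesis .
qed

text \<open>Yang-Baxter moves the contraction of \<open>A\<close> with its dual past the spectator
  \<open>B\<close>.\<close>

lemma capz_sw_slide:
  assumes "A \<in> Ob C" "B \<in> Ob C" "Z \<in> Ob C"
  shows "capz A (B \<otimes> Z) \<cdot> sw A (A\<^bold>*) (B \<otimes> Z) =
    B \<lhd> (capz A Z \<cdot> sw A (A\<^bold>*) Z) \<cdot> sw A B (A\<^bold>* \<otimes> Z) \<cdot> A \<lhd> sw (A\<^bold>*) B Z"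
  using assms yang_baxter [of A "A\<^bold>*" B Z] by (simp add: lw_comp flip: capz_slide)

text \<open>The cup inside the transpose and the cap of \<open>B\<close> do not form a snake,
  because the latter lacks the crossing of \<open>\<epsilon> B\<close>. Once the inner contraction
  has been moved past \<open>B\<close>, they form a loop, which \<open>loopz\<close>
  removes.\<close>

lemma conj_cap:
  assumes "f \<in> Arr C" "Z \<in> Ob C" "Dom C f = A" "Cod C f = B"
  shows "capz B Z \<cdot> conj_arr C f \<rhd> (B \<otimes> Z) = capz A Z \<cdot> A\<^bold>* \<lhd> (f\<dagger> \<rhd> Z)"
proof -
  have [simp]: "A \<in> Ob C" "B \<in> Ob C" using assms by auto
  have "A \<lhd> sw (A\<^bold>*) B Z \<cdot> f\<dagger> \<rhd> (A\<^bold>* \<otimes> B \<otimes> Z) = f\<dagger> \<rhd> (B \<otimes> A\<^bold>* \<otimes> Z) \<cdot> B \<lhd> sw (A\<^bold>*) B Z"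
    using assms by (subst act_lw) simp_all
  then have sw: "sw A B (A\<^bold>* \<otimes> Z) \<cdot> A \<lhd> sw (A\<^bold>*) B Z \<cdot> f\<dagger> \<rhd> (A\<^bold>* \<otimes> B \<otimes> Z) =
    B \<lhd> (f\<dagger> \<rhd> (A\<^bold>* \<otimes> Z)) \<cdot> sw B B (A\<^bold>* \<otimes> Z) \<cdot> B \<lhd> sw (A\<^bold>*) B Z"
    using assms by (simp add: sw_act')
  let ?k = "capz A Z \<cdot> sw A (A\<^bold>*) Z \<cdot> f\<dagger> \<rhd> (A\<^bold>* \<otimes> Z)"
  have "capz A (B \<otimes> Z) \<cdot> sw A (A\<^bold>*) (B \<otimes> Z) \<cdot> f\<dagger> \<rhd> (A\<^bold>* \<otimes> B \<otimes> Z)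
    = (capz A (B \<otimes> Z) \<cdot> sw A (A\<^bold>*) (B \<otimes> Z)) \<cdot> f\<dagger> \<rhd> (A\<^bold>* \<otimes> B \<otimes> Z)"
    using assms by simp
  also have "\<dots> = B \<lhd> ?k \<cdot> sw B B (A\<^bold>* \<otimes> Z) \<cdot> B \<lhd> sw (A\<^bold>*) B Z"
    using assms by (simp add: capz_sw_slide lw_comp sw)
  finally have k': "capz A (B \<otimes> Z) \<cdot> sw A (A\<^bold>*) (B \<otimes> Z) \<cdot> f\<dagger> \<rhd> (A\<^bold>* \<otimes> B \<otimes> Z)
    = B \<lhd> ?k \<cdot> sw B B (A\<^bold>* \<otimes> Z) \<cdot> B \<lhd> sw (A\<^bold>*) B Z" .
  have k: "conj_arr C f \<rhd> (B \<otimes> Z) =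
    B\<^bold>* \<lhd> (B \<lhd> ?k \<cdot> sw B B (A\<^bold>* \<otimes> Z) \<cdot> B \<lhd> sw (A\<^bold>*) B Z) \<cdot> cupz B (A\<^bold>* \<otimes> B \<otimes> Z)"
    using assms by (simp add: act_conj_arr k')
  have "capz B Z \<cdot> conj_arr C f \<rhd> (B \<otimes> Z) = 
    ?k \<cdot> (capz B (B \<otimes> A\<^bold>* \<otimes> Z) \<cdot> B\<^bold>* \<lhd> sw B B (A\<^bold>* \<otimes> Z) \<cdot> cupz B (B \<otimes> A\<^bold>* \<otimes> Z)) \<cdot> sw (A\<^bold>*) B Z"
    unfolding k using assms by (simp add: lw_comp [of "B\<^bold>*"] capz_natural' cupz_natural)
  also have "\<dots> = ?k \<cdot> sw (A\<^bold>*) B Z" using assms by (subst loopz) simp_all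
  also have "\<dots> = capz A Z \<cdot> A\<^bold>* \<lhd> (f\<dagger> \<rhd> Z)" 
    using assms by (simp add: sw_act)
  finally show ?thesis .
qed

lemma conj_arr_eqI:
  assumes "f \<in> Arr C" "u \<in> Arr C" "Dom C u = (Dom C f)\<^bold>*" "Cod C u = (Cod C f)\<^bold>*"
    and "\<And>Z. Z \<in> Ob C \<Longrightarrow> capz (Cod C f) Z \<cdot> u \<rhd> (Cod C f \<otimes> Z) = capz (Dom C f) Z \<cdot> (Dom C f)\<^bold>* \<lhd> (f\<dagger> \<rhd> Z)"
  shows "conj_arr C f = u"
proof (rule capz_eqI [of "Cod C f"])
  fix Z assume "Z \<in> Ob C"
  then show "capz (Cod C f) Z \<cdot> conj_arr C f \<rhd> (Cod C f \<otimes> Z) = capz (Cod C f) Z \<cdot> u \<rhd> (Cod C f \<otimes> Z)"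
    using assms(1) by (simp only: assms(5) conj_cap)
qed (use assms in \<open>simp_all only: conj_arr_simps cod_ob\<close>)

lemma conj_id [simp]: "A \<in> Ob C \<Longrightarrow> conj_arr C (\<one> A) = \<one> (A\<^bold>*)"
  by (rule conj_arr_eqI) simp_all

text \<open>The dagger of the cup equation for \<open>f\<close> is the cap equation that
  characterizes the conjugate of \<open>f\<dagger>\<close>.\<close>

lemma conj_dag [simp]:
  assumes "f \<in> Arr C" shows "conj_arr C (f\<dagger>) = (conj_arr C f)\<dagger>"
proof (rule conj_arr_eqI)
  fix Z assume Z: "Z \<in> Ob C"
  show "capz (Cod C (f\<dagger>)) Z \<cdot> (conj_arr C f)\<dagger> \<rhd> (Cod C (f\<dagger>) \<otimes> Z) =
    capz (Dom C (f\<dagger>)) Z \<cdot> (Dom C (f\<dagger>))\<^bold>* \<lhd> ((f\<dagger>)\<dagger> \<rhd> Z)"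
    using assms Z arg_cong [OF conj_cup [OF assms Z refl refl], of "Dag C"] by simp
qed (use assms in simp_all)

lemma conj_comp:
  assumes "f \<in> Arr C" "g \<in> Arr C" "Dom C g = Cod C f"
  shows "conj_arr C (g \<cdot> f) = conj_arr C g \<cdot> conj_arr C f"
proof (rule conj_arr_eqI)
  fix Z assume Z: "Z \<in> Ob C"
  have "capz (Cod C g) Z \<cdot> (conj_arr C g \<cdot> conj_arr C f) \<rhd> (Cod C g \<otimes> Z) =
    (capz (Cod C g) Z \<cdot> conj_arr C g \<rhd> (Cod C g \<otimes> Z)) \<cdot> conj_arr C f \<rhd> (Cod C g \<otimes> Z)"
    using assms Z by (simp add: act_comp)
  also have "\<dots> = capz (Cod C f) Z \<cdot> conj_arr C f \<rhd> (Cod C f \<otimes> Z) \<cdot> (Dom C f)\<^bold>* \<lhd> (g\<dagger> \<rhd> Z)"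
    using assms Z by (simp add: conj_cap act_lw)
  also have "\<dots> = (capz (Cod C f) Z \<cdot> conj_arr C f \<rhd> (Cod C f \<otimes> Z)) \<cdot> (Dom C f)\<^bold>* \<lhd> (g\<dagger> \<rhd> Z)"
    using assms Z by simp
  also have "\<dots> = capz (Dom C f) Z \<cdot> (Dom C f)\<^bold>* \<lhd> (f\<dagger> \<rhd> Z) \<cdot> (Dom C f)\<^bold>* \<lhd> (g\<dagger> \<rhd> Z)"
    using assms Z by (simp add: conj_cap)
  also have "\<dots> = capz (Dom C (g \<cdot> f)) Z \<cdot> (Dom C (g \<cdot> f))\<^bold>* \<lhd> ((g \<cdot> f)\<dagger> \<rhd> Z)"
    using assms Z by (simp add: act_comp lw_comp)
  finally show "capz (Cod C (g \<cdot> f)) Z \<cdot> (conj_arr C g \<cdot> conj_arr C f) \<rhd> (Cod C (g \<cdot> f) \<otimes> Z) = \<dots>" 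
    using assms by simp
qed (use assms in simp_all)


section \<open>Nested cups and caps for a product of two objects\<close>

definition cupn :: "'o \<Rightarrow> 'o \<Rightarrow> 'o \<Rightarrow> 'm" where
  "cupn X B Z = B\<^bold>* \<lhd> cupz X (B \<otimes> Z) \<cdot> cupz B Z"

definition capn :: "'o \<Rightarrow> 'o \<Rightarrow> 'o \<Rightarrow> 'm" where
  "capn X B Z = capz B Z \<cdot> B\<^bold>* \<lhd> capz X (B \<otimes> Z)"

lemma capn_simps [simp]:
  "X \<in> Ob C \<Longrightarrow> B \<in> Ob C \<Longrightarrow> Z \<in> Ob C \<Longrightarrow> cupn X B Z \<in> Arr C"
  "X \<in> Ob C \<Longrightarrow> B \<in> Ob C \<Longrightarrow> Z \<in> Ob C \<Longrightarrow> capn X B Z \<in> Arr C"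
  "Dom C (cupn X B Z) = Z"
  "Cod C (cupn X B Z) = B\<^bold>* \<otimes> (X\<^bold>* \<otimes> (X \<otimes> (B \<otimes> Z)))"
  "Dom C (capn X B Z) = B\<^bold>* \<otimes> (X\<^bold>* \<otimes> (X \<otimes> (B \<otimes> Z)))"
  "Cod C (capn X B Z) = Z"
  "X \<in> Ob C \<Longrightarrow> B \<in> Ob C \<Longrightarrow> Z \<in> Ob C \<Longrightarrow> (cupn X B Z)\<dagger> = capn X B Z"
  "X \<in> Ob C \<Longrightarrow> B \<in> Ob C \<Longrightarrow> Z \<in> Ob C \<Longrightarrow> (capn X B Z)\<dagger> = cupn X B Z"
  by (simp_all add: cupn_def capn_def)

lemma capn_natural:
  assumes "X \<in> Ob C" "B \<in> Ob C" "h \<in> Arr C" "Z = Cod C h" "B' = B\<^bold>*" "X' = X\<^bold>*"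
  shows "capn X B Z \<cdot> B' \<lhd> X' \<lhd> X \<lhd> B \<lhd> h = h \<cdot> capn X B (Dom C h)"
proof -
  have "B\<^bold>* \<lhd> (capz X (B \<otimes> Cod C h) \<cdot> X\<^bold>* \<lhd> X \<lhd> B \<lhd> h) = B\<^bold>* \<lhd> (B \<lhd> h \<cdot> capz X (B \<otimes> Dom C h))"
    using assms by (simp add: capz_natural)
  then show ?thesis using assms by (simp add: capn_def lw_comp capz_natural')
qed

lemmas capn_natural' = capn_natural [THEN reassoc]

lemma cupn_natural:
  assumes "X \<in> Ob C" "B \<in> Ob C" "h \<in> Arr C" "Z = Dom C h" "B' = B\<^bold>*" "X' = X\<^bold>*"
  shows "B' \<lhd> X' \<lhd> X \<lhd> B \<lhd> h \<cdot> cupn X B Z = cupn X B (Cod C h) \<cdot> h"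
  using arg_cong [OF capn_natural [OF assms(1,2) arr_dag [OF assms(3)] refl assms(5,6)], of "Dag C"] assms
  by simp

lemma loopz':
  assumes "A \<in> Ob C" "Z \<in> Ob C" "W = A \<otimes> Z" "k \<in> Arr C" "Cod C k = W" "A' = A\<^bold>*"
  shows "capz A W \<cdot> A' \<lhd> sw A A Z \<cdot> cupz A W \<cdot> k = k"
  using arg_cong [OF loopz [OF assms(1,2)], of "\<lambda>x. x \<cdot> k"] assms by simp

text \<open>The partial trace of the symmetry of \<open>X \<otimes> B\<close> with itself, written
  as four adjacent transpositions. The inner loop over \<open>X\<close> is removed first, then the
  outer one over \<open>B\<close>.\<close>

lemma loopn:
  assumes "X \<in> Ob C" "B \<in> Ob C" "Z \<in> Ob C"
  shows "capn X B (X \<otimes> B \<otimes> Z) \<cdot> B\<^bold>* \<lhd> X\<^bold>* \<lhd>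
      (X \<lhd> sw X B (B \<otimes> Z) \<cdot> X \<lhd> X \<lhd> sw B B Z \<cdot> sw X X (B \<otimes> B \<otimes> Z) \<cdot> X \<lhd> sw B X (B \<otimes> Z)) \<cdot>
      cupn X B (X \<otimes> B \<otimes> Z) = \<one> (X \<otimes> B \<otimes> Z)"
proof -
  let ?W = "B \<otimes> B \<otimes> Z"
  have "capz X (B \<otimes> X \<otimes> B \<otimes> Z) \<cdot> X\<^bold>* \<lhd>
      (X \<lhd> sw X B (B \<otimes> Z) \<cdot> X \<lhd> X \<lhd> sw B B Z \<cdot> sw X X ?W \<cdot> X \<lhd> sw B X (B \<otimes> Z)) \<cdot> cupz X (B \<otimes> X \<otimes> B \<otimes> Z)
    = sw X B (B \<otimes> Z) \<cdot> X \<lhd> sw B B Z \<cdot> (capz X (X \<otimes> ?W) \<cdot> X\<^bold>* \<lhd> sw X X ?W \<cdot> cupz X (X \<otimes> ?W)) \<cdot> sw B X (B \<otimes> Z)"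
    using assms by (simp add: lw_comp capz_natural' cupz_natural)
  also have "\<dots> = sw X B (B \<otimes> Z) \<cdot> X \<lhd> sw B B Z \<cdot> sw B X (B \<otimes> Z)"
    using assms by (subst loopz) simp_all
  finally have *: "capz X (B \<otimes> X \<otimes> B \<otimes> Z) \<cdot> X\<^bold>* \<lhd>
      (X \<lhd> sw X B (B \<otimes> Z) \<cdot> X \<lhd> X \<lhd> sw B B Z \<cdot> sw X X ?W \<cdot> X \<lhd> sw B X (B \<otimes> Z)) \<cdot> cupz X (B \<otimes> X \<otimes> B \<otimes> Z)
    = sw X B (B \<otimes> Z) \<cdot> X \<lhd> sw B B Z \<cdot> sw B X (B \<otimes> Z)" .
  have "B \<lhd> sw X B Z \<cdot> (sw X B (B \<otimes> Z) \<cdot> X \<lhd> sw B B Z \<cdot> sw B X (B \<otimes> Z)) 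
    = (sw B B (X \<otimes> Z) \<cdot> B \<lhd> sw X B Z \<cdot> sw X B (B \<otimes> Z)) \<cdot> sw B X (B \<otimes> Z)"
    using assms yang_baxter [of X B B Z] by (simp flip: comp_assoc')
  then have "B \<lhd> sw B X Z \<cdot> B \<lhd> sw X B Z \<cdot> (sw X B (B \<otimes> Z) \<cdot> X \<lhd> sw B B Z \<cdot> sw B X (B \<otimes> Z))
    = B \<lhd> sw B X Z \<cdot> (sw B B (X \<otimes> Z) \<cdot> B \<lhd> sw X B Z \<cdot> sw X B (B \<otimes> Z)) \<cdot> sw B X (B \<otimes> Z)"
    by simp
  \<comment> \<open>In this form of Yang-Baxter the outer crossings touch only the tail of the
    \<open>B\<close> loop. Naturality pulls them out, they cancel, and \<open>loopz\<close>
    applies.\<close>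
  then have yb: "sw X B (B \<otimes> Z) \<cdot> X \<lhd> sw B B Z \<cdot> sw B X (B \<otimes> Z) = 
      B \<lhd> sw B X Z \<cdot> sw B B (X \<otimes> Z) \<cdot> B \<lhd> sw X B Z"
    using assms by simp
  have "capn X B (X \<otimes> B \<otimes> Z) \<cdot> B\<^bold>* \<lhd> X\<^bold>* \<lhd>
      (X \<lhd> sw X B (B \<otimes> Z) \<cdot> X \<lhd> X \<lhd> sw B B Z \<cdot> sw X X ?W \<cdot> X \<lhd> sw B X (B \<otimes> Z)) \<cdot>
      cupn X B (X \<otimes> B \<otimes> Z) = capz B (X \<otimes> B \<otimes> Z) \<cdot> B\<^bold>* \<lhd> (capz X (B \<otimes> X \<otimes> B \<otimes> Z) \<cdot> X\<^bold>* \<lhd>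
      (X \<lhd> sw X B (B \<otimes> Z) \<cdot> X \<lhd> X \<lhd> sw B B Z \<cdot> sw X X ?W \<cdot> X \<lhd> sw B X (B \<otimes> Z)) \<cdot> cupz X (B \<otimes> X \<otimes> B \<otimes> Z)) \<cdot> cupz B (X \<otimes> B \<otimes> Z)"
    using assms by (simp add: capn_def cupn_def lw_comp)
  also have "\<dots> = \<one> (X \<otimes> B \<otimes> Z)"
    unfolding * yb using assms by (simp add: lw_comp capz_natural' cupz_natural loopz')
  finally show ?thesis .
qed

lemma loopn_tensor:
  assumes "X \<in> Ob C" "B \<in> Ob C" "Z \<in> Ob C" "E = X \<otimes> B"
  shows "capn X B (E \<otimes> Z) \<cdot> B\<^bold>* \<lhd> X\<^bold>* \<lhd> (\<alpha> X B (E \<otimes> Z) \<cdot> sw E E Z \<cdot> (\<alpha> X B (E \<otimes> Z))\<dagger>) \<cdot>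
      cupn X B (E \<otimes> Z) = \<one> (E \<otimes> Z)"
proof -
  have 1: "capn X B (E \<otimes> Z) = (\<alpha> X B Z)\<dagger> \<cdot> capn X B (X \<otimes> B \<otimes> Z) \<cdot> B\<^bold>* \<lhd> X\<^bold>* \<lhd> X \<lhd> B \<lhd> \<alpha> X B Z"
    using assms by (simp add: capn_natural)
  have 2: "cupn X B (E \<otimes> Z) = (B\<^bold>* \<lhd> X\<^bold>* \<lhd> X \<lhd> B \<lhd> (\<alpha> X B Z)\<dagger> \<cdot> cupn X B (X \<otimes> B \<otimes> Z)) \<cdot> \<alpha> X B Z"
    using assms by (subst cupn_natural) simp_all
  have 3: "X \<lhd> B \<lhd> \<alpha> X B Z \<cdot> (\<alpha> X B (E \<otimes> Z) \<cdot> sw E E Z \<cdot> (\<alpha> X B (E \<otimes> Z))\<dagger>) \<cdot> X \<lhd> B \<lhd> (\<alpha> X B Z)\<dagger> =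
    X \<lhd> sw X B (B \<otimes> Z) \<cdot> X \<lhd> X \<lhd> sw B B Z \<cdot> sw X X (B \<otimes> B \<otimes> Z) \<cdot> X \<lhd> sw B X (B \<otimes> Z)"
    using assms by (simp add: whisker)
  have "capn X B (E \<otimes> Z) \<cdot> B\<^bold>* \<lhd> X\<^bold>* \<lhd> (\<alpha> X B (E \<otimes> Z) \<cdot> sw E E Z \<cdot> (\<alpha> X B (E \<otimes> Z))\<dagger>) \<cdot> cupn X B (E \<otimes> Z) =
    (\<alpha> X B Z)\<dagger> \<cdot> (capn X B (X \<otimes> B \<otimes> Z) \<cdot> B\<^bold>* \<lhd> X\<^bold>* \<lhd> 
    (X \<lhd> B \<lhd> \<alpha> X B Z \<cdot> (\<alpha> X B (E \<otimes> Z) \<cdot> sw E E Z \<cdot> (\<alpha> X B (E \<otimes> Z))\<dagger>) \<cdot> X \<lhd> B \<lhd> (\<alpha> X B Z)\<dagger>) \<cdot> cupn X B (X \<otimes> B \<otimes> Z)) \<cdot> \<alpha> X B Z"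
    unfolding 1 2 using assms by (simp add: lw_comp)
  then show ?thesis unfolding 3 using assms by (simp add: loopn)
qed

text \<open>Naturality of the cap of \<open>X\<close> exposes the inner snake; once it is straight,
  the snake for \<open>B\<close> remains.\<close>

lemma snaken_dag:
  assumes "X \<in> Ob C" "B \<in> Ob C" "Z \<in> Ob C"
  shows "capn X B (B\<^bold>* \<otimes> X\<^bold>* \<otimes> Z) \<cdot> 
    B\<^bold>* \<lhd> X\<^bold>* \<lhd> (X \<lhd> (sw (B\<^bold>*) B (X\<^bold>* \<otimes> Z) \<cdot> cupz B (X\<^bold>* \<otimes> Z)) \<cdot> sw (X\<^bold>*) X Z \<cdot> cupz X Z) = \<one> (B\<^bold>* \<otimes> X\<^bold>* \<otimes> Z)"
proof -
  let ?g = "sw (B\<^bold>*) B (X\<^bold>* \<otimes> Z) \<cdot> cupz B (X\<^bold>* \<otimes> Z)"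
  have "capz X (B \<otimes> B\<^bold>* \<otimes> X\<^bold>* \<otimes> Z) \<cdot> X\<^bold>* \<lhd> (X \<lhd> ?g \<cdot> sw (X\<^bold>*) X Z \<cdot> cupz X Z) =
    (capz X (B \<otimes> B\<^bold>* \<otimes> X\<^bold>* \<otimes> Z) \<cdot> X\<^bold>* \<lhd> X \<lhd> ?g) \<cdot> X\<^bold>* \<lhd> (sw (X\<^bold>*) X Z \<cdot> cupz X Z)"
    using assms by (simp add: lw_comp)
  also have "\<dots> = ?g \<cdot> (capz X (X\<^bold>* \<otimes> Z) \<cdot> X\<^bold>* \<lhd> (sw (X\<^bold>*) X Z \<cdot> cupz X Z))"
    using assms by (subst capz_natural) simp_all
  also have "\<dots> = ?g" using assms by (subst snakez_dag) simp_all
  finally have "B\<^bold>* \<lhd> (capz X (B \<otimes> B\<^bold>* \<otimes> X\<^bold>* \<otimes> Z) \<cdot> X\<^bold>* \<lhd> (X \<lhd> ?g \<cdot> sw (X\<^bold>*) X Z \<cdot> cupz X Z)) = B\<^bold>* \<lhd> ?g" by simp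
  then have "capn X B (B\<^bold>* \<otimes> X\<^bold>* \<otimes> Z) \<cdot> 
    B\<^bold>* \<lhd> X\<^bold>* \<lhd> (X \<lhd> ?g \<cdot> sw (X\<^bold>*) X Z \<cdot> cupz X Z) = capz B (B\<^bold>* \<otimes> X\<^bold>* \<otimes> Z) \<cdot> B\<^bold>* \<lhd> ?g"
    using assms by (simp add: capn_def lw_merge del: lw_comp)
  then show ?thesis using assms by (simp add: snakez_dag)
qed

text \<open>As in \<open>capz_eqI\<close>, with both output wires bent back by the nested
  snake.\<close>

lemma capn_eqI:
  assumes X: "X \<in> Ob C" "B \<in> Ob C" and uv: "u \<in> Arr C" "v \<in> Arr C" "Dom C u = Dom C v" "Cod C u = B\<^bold>* \<otimes> X\<^bold>*" "Cod C v = B\<^bold>* \<otimes> X\<^bold>*"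
    and eq: "\<And>Z. Z \<in> Ob C \<Longrightarrow> capn X B Z \<cdot> \<alpha> (B\<^bold>*) (X\<^bold>*) (X \<otimes> B \<otimes> Z) \<cdot> u \<rhd> (X \<otimes> B \<otimes> Z) =
      capn X B Z \<cdot> \<alpha> (B\<^bold>*) (X\<^bold>*) (X \<otimes> B \<otimes> Z) \<cdot> v \<rhd> (X \<otimes> B \<otimes> Z)"
  shows "u = v"
proof (rule act_eqI)
  fix Z assume Z: "Z \<in> Ob C"
  let ?Y = "B\<^bold>* \<otimes> X\<^bold>* \<otimes> Z"
  let ?g = "X \<lhd> (sw (B\<^bold>*) B (X\<^bold>* \<otimes> Z) \<cdot> cupz B (X\<^bold>* \<otimes> Z)) \<cdot> sw (X\<^bold>*) X Z \<cdot> cupz X Z"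
  have *: "\<alpha> (B\<^bold>*) (X\<^bold>*) Z \<cdot> w \<rhd> Z = (capn X B ?Y \<cdot> \<alpha> (B\<^bold>*) (X\<^bold>*) (X \<otimes> B \<otimes> ?Y) \<cdot> w \<rhd> (X \<otimes> B \<otimes> ?Y)) \<cdot> Dom C w \<lhd> ?g"
    if "w \<in> Arr C" "Cod C w = B\<^bold>* \<otimes> X\<^bold>*" for w
  proof -
    have "\<alpha> (B\<^bold>*) (X\<^bold>*) Z \<cdot> w \<rhd> Z = (capn X B ?Y \<cdot> B\<^bold>* \<lhd> X\<^bold>* \<lhd> ?g) \<cdot> \<alpha> (B\<^bold>*) (X\<^bold>*) Z \<cdot> w \<rhd> Z"
      using snaken_dag [OF X Z] X Z that by simp
    also have "\<dots> = capn X B ?Y \<cdot> (B\<^bold>* \<lhd> X\<^bold>* \<lhd> ?g \<cdot> \<alpha> (B\<^bold>*) (X\<^bold>*) Z) \<cdot> w \<rhd> Z"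
      using X Z that by simp
    also have "B\<^bold>* \<lhd> X\<^bold>* \<lhd> ?g \<cdot> \<alpha> (B\<^bold>*) (X\<^bold>*) Z = \<alpha> (B\<^bold>*) (X\<^bold>*) (X \<otimes> B \<otimes> ?Y) \<cdot> (B\<^bold>* \<otimes> X\<^bold>*) \<lhd> ?g"
      using X Z by (subst assoc_lw) simp_all
    finally show ?thesis using X Z that by (simp add: act_lw)
  qed
  have "(\<alpha> (B\<^bold>*) (X\<^bold>*) Z)\<dagger> \<cdot> \<alpha> (B\<^bold>*) (X\<^bold>*) Z \<cdot> u \<rhd> Z = (\<alpha> (B\<^bold>*) (X\<^bold>*) Z)\<dagger> \<cdot> \<alpha> (B\<^bold>*) (X\<^bold>*) Z \<cdot> v \<rhd> Z"
    unfolding *[OF uv(1,4)] *[OF uv(2,5)] eq [OF tensor_ob [OF dual_ob [OF X(2)] tensor_ob [OF dual_ob [OF X(1)] Z]]] uv(3) ..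
  then show "u \<rhd> Z = v \<rhd> Z" using X Z uv by simp
qed (use assms in auto)

section \<open>The isomorphism from the dual of a product to the product of duals\<close>

lemma dual_tensor_simps [simp]:
  "X \<in> Ob C \<Longrightarrow> B \<in> Ob C \<Longrightarrow> dual_tensor C X B \<in> Arr C"
  "Dom C (dual_tensor C X B) = (X \<otimes> B)\<^bold>*"
  "Cod C (dual_tensor C X B) = B\<^bold>* \<otimes> X\<^bold>*"
  by (simp_all add: dual_tensor_def nested_cup_def)

lemma act_nested_cup:
  assumes "X \<in> Ob C" "B \<in> Ob C" "Z \<in> Ob C"
  shows "nested_cup C X B \<rhd> Z = (\<alpha> (B\<^bold>* \<otimes> X\<^bold>*) (X \<otimes> B) Z)\<dagger> \<cdot> (\<alpha> (B\<^bold>*) (X\<^bold>*) ((X \<otimes> B) \<otimes> Z))\<dagger> \<cdot>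
    B\<^bold>* \<lhd> X\<^bold>* \<lhd> (\<alpha> X B Z)\<dagger> \<cdot> cupn X B Z \<cdot> \<ll> Z"
  unfolding nested_cup_def lw_def [symmetric] act_def [symmetric]
  using assms by (simp add: whisker act_dag_assoc act_dag_lunit act_cup act_cupz act_capz cupn_def)

lemma act_cupn:
  assumes "X \<in> Ob C" "B \<in> Ob C" "W \<in> Ob C" "Z \<in> Ob C"
  shows "cupn X B W \<rhd> Z = (\<alpha> (B\<^bold>*) (X\<^bold>* \<otimes> X \<otimes> B \<otimes> W) Z)\<dagger> \<cdot>
    B\<^bold>* \<lhd> ((\<alpha> (X\<^bold>*) (X \<otimes> B \<otimes> W) Z)\<dagger> \<cdot> X\<^bold>* \<lhd> ((\<alpha> X (B \<otimes> W) Z)\<dagger> \<cdot> X \<lhd> (\<alpha> B W Z)\<dagger>)) \<cdot> cupn X B (W \<otimes> Z)"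
  using assms by (simp add: cupn_def act_comp act_lw_act act_cupz lw_comp cupz_natural')
    (simp add: lw_merge cupz_natural)

lemma act_dual_tensor:
  assumes "X \<in> Ob C" "B \<in> Ob C" "Z \<in> Ob C" "E = X \<otimes> B"
  shows "dual_tensor C X B \<rhd> Z = (\<alpha> (B\<^bold>*) (X\<^bold>*) Z)\<dagger> \<cdot>
    B\<^bold>* \<lhd> X\<^bold>* \<lhd> (capz E Z \<cdot> sw E (E\<^bold>*) Z \<cdot> (\<alpha> X B (E\<^bold>* \<otimes> Z))\<dagger>) \<cdot> cupn X B (E\<^bold>* \<otimes> Z)"
proof -
  have e: "\<epsilon> E \<rhd> Z = (\<ll> Z)\<dagger> \<cdot> capz E Z \<cdot> sw E (E\<^bold>*) Z \<cdot> \<alpha> E (E\<^bold>*) Z" if "E \<in> Ob C" for E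
    using that assms by (simp add: counit_def act_comp act_symm act_cup)
  show ?thesis
    unfolding dual_tensor_def lw_def [symmetric] act_def [symmetric]
    using assms by (simp add: act_comp act_runit act_lw_act e act_assoc act_act act_nested_cup act_cupn act_dag_assoc act_dag_lunit
      assoc_lw assoc_lw' lw_dag_assoc lw_dag_assoc' lw_comp lw_dag_lunit' lunit_natural' lunit_natural'')
qed

text \<open>\<open>dual_tensor\<close> is the mate of the identity between the chosen and the nested dual of \<open>X \<otimes> B\<close>;
  expressed with cups and with caps, this gives its unitarity.\<close>

lemma dual_tensor_cup:
  assumes "X \<in> Ob C" "B \<in> Ob C" "Z \<in> Ob C" "E = X \<otimes> B"
  shows "\<alpha> (B\<^bold>*) (X\<^bold>*) (E \<otimes> Z) \<cdot> dual_tensor C X B \<rhd> (E \<otimes> Z) \<cdot> cupz E Z = B\<^bold>* \<lhd> X\<^bold>* \<lhd> (\<alpha> X B Z)\<dagger> \<cdot> cupn X B Z"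
proof -
  have [simp]: "E \<in> Ob C" using assms by simp
  have c: "cupn X B (E\<^bold>* \<otimes> E \<otimes> Z) \<cdot> cupz E Z = B\<^bold>* \<lhd> X\<^bold>* \<lhd> X \<lhd> B \<lhd> cupz E Z \<cdot> cupn X B Z"
    using assms(1-3) by (simp add: cupn_natural)
  have "(\<alpha> X B (E\<^bold>* \<otimes> E \<otimes> Z))\<dagger> \<cdot> X \<lhd> B \<lhd> cupz E Z = E \<lhd> cupz E Z \<cdot> (\<alpha> X B Z)\<dagger>"
    using assms(1-3) by (subst lw_dag_assoc) (simp_all add: assms(4))
  then have "(capz E (E \<otimes> Z) \<cdot> sw E (E\<^bold>*) (E \<otimes> Z) \<cdot> (\<alpha> X B (E\<^bold>* \<otimes> E \<otimes> Z))\<dagger>) \<cdot> X \<lhd> B \<lhd> cupz E Z 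
    = (capz E (E \<otimes> Z) \<cdot> sw E (E\<^bold>*) (E \<otimes> Z) \<cdot> E \<lhd> cupz E Z) \<cdot> (\<alpha> X B Z)\<dagger>"
    using assms(1-3) assms(4)[symmetric] by simp
  also have "\<dots> = (\<alpha> X B Z)\<dagger>" using assms(1-3) assms(4)[symmetric] by (subst snakez) simp_all
  finally have e: "(capz E (E \<otimes> Z) \<cdot> sw E (E\<^bold>*) (E \<otimes> Z) \<cdot> (\<alpha> X B (E\<^bold>* \<otimes> E \<otimes> Z))\<dagger>) \<cdot> X \<lhd> B \<lhd> cupz E Z = (\<alpha> X B Z)\<dagger>" .
  have "\<alpha> (B\<^bold>*) (X\<^bold>*) (E \<otimes> Z) \<cdot> dual_tensor C X B \<rhd> (E \<otimes> Z) \<cdot> cupz E Z =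
    B\<^bold>* \<lhd> X\<^bold>* \<lhd> ((capz E (E \<otimes> Z) \<cdot> sw E (E\<^bold>*) (E \<otimes> Z) \<cdot> (\<alpha> X B (E\<^bold>* \<otimes> E \<otimes> Z))\<dagger>) \<cdot> X \<lhd> B \<lhd> cupz E Z) \<cdot> cupn X B Z"
    using assms(1-3) assms(4)[symmetric] by (simp add: act_dual_tensor c lw_comp)
  then show ?thesis unfolding e .
qed

text \<open>As for \<open>conj_cap\<close>, the cap lacks the crossing of the
  \<open>\<epsilon>\<close> in the definition of \<open>dual_tensor\<close>, so a loop remains
  instead of a snake. This one runs over \<open>X \<otimes> B\<close>, hence
  \<open>loopn_tensor\<close>.\<close>

lemma dual_tensor_cap:
  assumes "X \<in> Ob C" "B \<in> Ob C" "Z \<in> Ob C" "E = X \<otimes> B"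
  shows "capn X B Z \<cdot> B\<^bold>* \<lhd> X\<^bold>* \<lhd> \<alpha> X B Z \<cdot> \<alpha> (B\<^bold>*) (X\<^bold>*) (E \<otimes> Z) \<cdot> dual_tensor C X B \<rhd> (E \<otimes> Z) = capz E Z"
proof -
  have [simp]: "E \<in> Ob C" using assms by simp
  note a = assms(1-3) assms(4)[symmetric]
  let ?k = "capz E Z \<cdot> sw E (E\<^bold>*) Z"
  have 1: "\<alpha> X B Z \<cdot> E \<lhd> ?k = X \<lhd> B \<lhd> ?k \<cdot> \<alpha> X B (E \<otimes> E\<^bold>* \<otimes> Z)"
    using a by (subst assoc_lw) simp_all
  have 2: "E \<lhd> sw (E\<^bold>*) E Z \<cdot> (\<alpha> X B (E\<^bold>* \<otimes> E \<otimes> Z))\<dagger> = (\<alpha> X B (E \<otimes> E\<^bold>* \<otimes> Z))\<dagger> \<cdot> X \<lhd> B \<lhd> sw (E\<^bold>*) E Z"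
    using a by (subst lw_dag_assoc) simp_all
  have "\<alpha> X B Z \<cdot> (capz E (E \<otimes> Z) \<cdot> sw E (E\<^bold>*) (E \<otimes> Z)) \<cdot> (\<alpha> X B (E\<^bold>* \<otimes> E \<otimes> Z))\<dagger>
    = (\<alpha> X B Z \<cdot> E \<lhd> ?k) \<cdot> sw E E (E\<^bold>* \<otimes> Z) \<cdot> (E \<lhd> sw (E\<^bold>*) E Z \<cdot> (\<alpha> X B (E\<^bold>* \<otimes> E \<otimes> Z))\<dagger>)"
    using a by (simp add: capz_sw_slide)
  also have "\<dots> = X \<lhd> B \<lhd> ?k \<cdot> (\<alpha> X B (E \<otimes> E\<^bold>* \<otimes> Z) \<cdot> sw E E (E\<^bold>* \<otimes> Z) \<cdot> (\<alpha> X B (E \<otimes> E\<^bold>* \<otimes> Z))\<dagger>) \<cdot> X \<lhd> B \<lhd> sw (E\<^bold>*) E Z"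
    unfolding 1 2 using a by simp
  finally have 3: "\<alpha> X B Z \<cdot> (capz E (E \<otimes> Z) \<cdot> sw E (E\<^bold>*) (E \<otimes> Z)) \<cdot> (\<alpha> X B (E\<^bold>* \<otimes> E \<otimes> Z))\<dagger> = \<dots>" .
  have "capn X B Z \<cdot> B\<^bold>* \<lhd> X\<^bold>* \<lhd> \<alpha> X B Z \<cdot> \<alpha> (B\<^bold>*) (X\<^bold>*) (E \<otimes> Z) \<cdot> dual_tensor C X B \<rhd> (E \<otimes> Z) =
    capn X B Z \<cdot> B\<^bold>* \<lhd> X\<^bold>* \<lhd> (\<alpha> X B Z \<cdot> (capz E (E \<otimes> Z) \<cdot> sw E (E\<^bold>*) (E \<otimes> Z)) \<cdot> (\<alpha> X B (E\<^bold>* \<otimes> E \<otimes> Z))\<dagger>) \<cdot> cupn X B (E\<^bold>* \<otimes> E \<otimes> Z)"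
    using a by (simp add: act_dual_tensor lw_comp)
  also have "\<dots> = ?k \<cdot> (capn X B (E \<otimes> E\<^bold>* \<otimes> Z) \<cdot> B\<^bold>* \<lhd> X\<^bold>* \<lhd> (\<alpha> X B (E \<otimes> E\<^bold>* \<otimes> Z) \<cdot> sw E E (E\<^bold>* \<otimes> Z) \<cdot> (\<alpha> X B (E \<otimes> E\<^bold>* \<otimes> Z))\<dagger>) \<cdot> cupn X B (E \<otimes> E\<^bold>* \<otimes> Z)) \<cdot> sw (E\<^bold>*) E Z"
    unfolding 3 using a by (simp add: lw_comp capn_natural' cupn_natural)
  also have "\<dots> = capz E Z" using a by (subst loopn_tensor) simp_all
  finally show ?thesis .
qed

text \<open>The dagger of \<open>dual_tensor_cup\<close>. It splits the cap of a product into nested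
  caps, which is how the coherence equations below are computed.\<close>

lemma dag_dual_tensor_cap:
  assumes "X \<in> Ob C" "B \<in> Ob C" "Z \<in> Ob C" "E = X \<otimes> B"
  shows "capz E Z \<cdot> (dual_tensor C X B)\<dagger> \<rhd> (E \<otimes> Z) = capn X B Z \<cdot> B\<^bold>* \<lhd> X\<^bold>* \<lhd> \<alpha> X B Z \<cdot> \<alpha> (B\<^bold>*) (X\<^bold>*) (E \<otimes> Z)"
proof -
  have "capz E Z \<cdot> (dual_tensor C X B)\<dagger> \<rhd> (E \<otimes> Z) \<cdot> (\<alpha> (B\<^bold>*) (X\<^bold>*) (E \<otimes> Z))\<dagger> = capn X B Z \<cdot> B\<^bold>* \<lhd> X\<^bold>* \<lhd> \<alpha> X B Z"
    using arg_cong [OF dual_tensor_cup [OF assms], of "Dag C"] assms by simp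
  then have "(capz E Z \<cdot> (dual_tensor C X B)\<dagger> \<rhd> (E \<otimes> Z) \<cdot> (\<alpha> (B\<^bold>*) (X\<^bold>*) (E \<otimes> Z))\<dagger>) \<cdot> \<alpha> (B\<^bold>*) (X\<^bold>*) (E \<otimes> Z)
     = (capn X B Z \<cdot> B\<^bold>* \<lhd> X\<^bold>* \<lhd> \<alpha> X B Z) \<cdot> \<alpha> (B\<^bold>*) (X\<^bold>*) (E \<otimes> Z)" by simp
  then show ?thesis using assms by simp
qed

lemma dual_tensor_cap_nested:
  assumes "X \<in> Ob C" "B \<in> Ob C" "Z \<in> Ob C"
  shows "capn X B Z \<cdot> \<alpha> (B\<^bold>*) (X\<^bold>*) (X \<otimes> B \<otimes> Z) \<cdot> dual_tensor C X B \<rhd> (X \<otimes> B \<otimes> Z) =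
    capz (X \<otimes> B) Z \<cdot> (X \<otimes> B)\<^bold>* \<lhd> (\<alpha> X B Z)\<dagger>"
proof -
  let ?t = "dual_tensor C X B" and ?E = "X \<otimes> B"
  have "\<alpha> (B\<^bold>*) (X\<^bold>*) (X \<otimes> B \<otimes> Z) \<cdot> ?t \<rhd> (X \<otimes> B \<otimes> Z) = \<alpha> (B\<^bold>*) (X\<^bold>*) (X \<otimes> B \<otimes> Z) \<cdot> (?t \<rhd> (X \<otimes> B \<otimes> Z) \<cdot> (?E\<^bold>*) \<lhd> \<alpha> X B Z) \<cdot> (?E\<^bold>*) \<lhd> (\<alpha> X B Z)\<dagger>"
    using assms by simp
  also have "\<dots> = B\<^bold>* \<lhd> X\<^bold>* \<lhd> \<alpha> X B Z \<cdot> \<alpha> (B\<^bold>*) (X\<^bold>*) (?E \<otimes> Z) \<cdot> ?t \<rhd> (?E \<otimes> Z) \<cdot> (?E\<^bold>*) \<lhd> (\<alpha> X B Z)\<dagger>"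
    using assms by (subst act_lw) (simp_all add: assoc_lw')
  finally show ?thesis
    using arg_cong [OF dual_tensor_cap [OF assms refl], of "\<lambda>x. x \<cdot> (?E\<^bold>*) \<lhd> (\<alpha> X B Z)\<dagger>"] assms by simp
qed

text \<open>The map turns nested caps into the cap of the product and its dagger turns them back, so
  each composite leaves caps unchanged. Caps detect equality by \<open>capz_eqI\<close> and
  \<open>capn_eqI\<close>.\<close>

lemma dual_tensor_unitary [simp]:
  assumes "X \<in> Ob C" "B \<in> Ob C"
  shows "(dual_tensor C X B)\<dagger> \<cdot> dual_tensor C X B = \<one> ((X \<otimes> B)\<^bold>*)"
    and "dual_tensor C X B \<cdot> (dual_tensor C X B)\<dagger> = \<one> (B\<^bold>* \<otimes> X\<^bold>*)"
proof -
  let ?t = "dual_tensor C X B" and ?E = "X \<otimes> B"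
  show "?t\<dagger> \<cdot> ?t = \<one> (?E\<^bold>*)"
  proof (rule capz_eqI [of ?E])
    fix Z assume Z: "Z \<in> Ob C"
    have "capz ?E Z \<cdot> (?t\<dagger> \<cdot> ?t) \<rhd> (?E \<otimes> Z) = (capz ?E Z \<cdot> ?t\<dagger> \<rhd> (?E \<otimes> Z)) \<cdot> ?t \<rhd> (?E \<otimes> Z)"
      using assms Z by (simp add: act_comp)
    also have "\<dots> = capz ?E Z"
      using assms Z by (simp add: dag_dual_tensor_cap dual_tensor_cap)
    finally show "capz ?E Z \<cdot> (?t\<dagger> \<cdot> ?t) \<rhd> (?E \<otimes> Z) = capz ?E Z \<cdot> \<one> (?E\<^bold>*) \<rhd> (?E \<otimes> Z)"
      using assms Z by simp
  qed (use assms in simp_all)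
  show "?t \<cdot> ?t\<dagger> = \<one> (B\<^bold>* \<otimes> X\<^bold>*)"
  proof (rule capn_eqI [of X B])
    fix Z assume Z: "Z \<in> Ob C"
    have 2: "?t\<dagger> \<rhd> (X \<otimes> B \<otimes> Z) = (?E\<^bold>*) \<lhd> \<alpha> X B Z \<cdot> ?t\<dagger> \<rhd> (?E \<otimes> Z) \<cdot> (B\<^bold>* \<otimes> X\<^bold>*) \<lhd> (\<alpha> X B Z)\<dagger>"
      using assms Z act_lw' [of "?t\<dagger>" "\<alpha> X B Z" "B\<^bold>* \<otimes> X\<^bold>*" "X \<otimes> B \<otimes> Z" "(B\<^bold>* \<otimes> X\<^bold>*) \<lhd> (\<alpha> X B Z)\<dagger>"] by simp
    have "capn X B Z \<cdot> \<alpha> (B\<^bold>*) (X\<^bold>*) (X \<otimes> B \<otimes> Z) \<cdot> (?t \<cdot> ?t\<dagger>) \<rhd> (X \<otimes> B \<otimes> Z) =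
       (capn X B Z \<cdot> \<alpha> (B\<^bold>*) (X\<^bold>*) (X \<otimes> B \<otimes> Z) \<cdot> ?t \<rhd> (X \<otimes> B \<otimes> Z)) \<cdot> ?t\<dagger> \<rhd> (X \<otimes> B \<otimes> Z)"
      using assms Z by (simp add: act_comp)
    also have "\<dots> = (capz ?E Z \<cdot> ?t\<dagger> \<rhd> (?E \<otimes> Z)) \<cdot> (B\<^bold>* \<otimes> X\<^bold>*) \<lhd> (\<alpha> X B Z)\<dagger>"
      unfolding dual_tensor_cap_nested [OF assms Z] 2 using assms Z by simp
    also have "\<dots> = capn X B Z \<cdot> \<alpha> (B\<^bold>*) (X\<^bold>*) (X \<otimes> B \<otimes> Z)"
      using assms Z by (simp add: dag_dual_tensor_cap assoc_lw)
    finally show "capn X B Z \<cdot> \<alpha> (B\<^bold>*) (X\<^bold>*) (X \<otimes> B \<otimes> Z) \<cdot> (?t \<cdot> ?t\<dagger>) \<rhd> (X \<otimes> B \<otimes> Z) =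
      capn X B Z \<cdot> \<alpha> (B\<^bold>*) (X\<^bold>*) (X \<otimes> B \<otimes> Z) \<cdot> \<one> (B\<^bold>* \<otimes> X\<^bold>*) \<rhd> (X \<otimes> B \<otimes> Z)"
      using assms Z by simp
  qed (use assms in simp_all)
qed

text \<open>Under the cap of the codomain, \<open>f \<boxtimes> g\<close> is replaced by daggers
  inside two nested caps, where \<open>conj_cap\<close> applies to each factor separately. The
  nesting is the reason for the exchanged order on the right.\<close>

lemma conj_tensor:
  assumes "f \<in> Arr C" "g \<in> Arr C"
  shows "conj_arr C (f \<boxtimes> g) \<cdot> (dual_tensor C (Dom C f) (Dom C g))\<dagger> = (dual_tensor C (Cod C f) (Cod C g))\<dagger> \<cdot> (conj_arr C g \<boxtimes> conj_arr C f)"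
proof -
  obtain A A' B B' where ab: "Dom C f = A" "Cod C f = A'" "Dom C g = B" "Cod C g = B'" by blast
  then have [simp]: "A \<in> Ob C" "A' \<in> Ob C" "B \<in> Ob C" "B' \<in> Ob C" using assms by auto
  show ?thesis unfolding ab
  proof (rule capz_eqI [of "A' \<otimes> B'"])
    fix Z assume Z: "Z \<in> Ob C"
    let ?E = "A' \<otimes> B'"
    have cc: "capz ?E Z \<cdot> conj_arr C (f \<boxtimes> g) \<rhd> (?E \<otimes> Z) = capz (A \<otimes> B) Z \<cdot> (A \<otimes> B)\<^bold>* \<lhd> ((f\<dagger> \<boxtimes> g\<dagger>) \<rhd> Z)"
      using assms Z ab conj_cap [of "f \<boxtimes> g" Z "A \<otimes> B" ?E] by simp
    have "capz ?E Z \<cdot> (conj_arr C (f \<boxtimes> g) \<cdot> (dual_tensor C A B)\<dagger>) \<rhd> (?E \<otimes> Z) =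
      (capz ?E Z \<cdot> conj_arr C (f \<boxtimes> g) \<rhd> (?E \<otimes> Z)) \<cdot> (dual_tensor C A B)\<dagger> \<rhd> (?E \<otimes> Z)"
      using assms Z ab by (simp add: act_comp)
    also have "\<dots> = capz (A \<otimes> B) Z \<cdot> (A \<otimes> B)\<^bold>* \<lhd> ((f\<dagger> \<boxtimes> g\<dagger>) \<rhd> Z) \<cdot> (dual_tensor C A B)\<dagger> \<rhd> (?E \<otimes> Z)"
      unfolding cc using assms Z ab by simp
    also have "\<dots> = (capz (A \<otimes> B) Z \<cdot> (dual_tensor C A B)\<dagger> \<rhd> ((A \<otimes> B) \<otimes> Z)) \<cdot> (B\<^bold>* \<otimes> A\<^bold>*) \<lhd> ((f\<dagger> \<boxtimes> g\<dagger>) \<rhd> Z)"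
      using assms Z ab by (simp add: act_lw)
    also have "\<dots> = capn A B Z \<cdot> B\<^bold>* \<lhd> A\<^bold>* \<lhd> \<alpha> A B Z \<cdot> \<alpha> (B\<^bold>*) (A\<^bold>*) ((A \<otimes> B) \<otimes> Z) \<cdot> (B\<^bold>* \<otimes> A\<^bold>*) \<lhd> ((f\<dagger> \<boxtimes> g\<dagger>) \<rhd> Z)"
      using assms Z ab by (simp add: dag_dual_tensor_cap)
    also have "\<dots> = capz B Z \<cdot> B\<^bold>* \<lhd> (capz A (B \<otimes> Z) \<cdot> A\<^bold>* \<lhd> A \<lhd> (g\<dagger> \<rhd> Z)) \<cdot>
      B\<^bold>* \<lhd> A\<^bold>* \<lhd> (f\<dagger> \<rhd> (B' \<otimes> Z)) \<cdot> B\<^bold>* \<lhd> A\<^bold>* \<lhd> \<alpha> A' B' Z \<cdot> \<alpha> (B\<^bold>*) (A\<^bold>*) (?E \<otimes> Z)"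
      using assms Z ab by (simp add: assoc_lw assoc_lw' act_tensor lw_comp capn_def)
    also have "\<dots> = (capz B Z \<cdot> B\<^bold>* \<lhd> (g\<dagger> \<rhd> Z)) \<cdot> B\<^bold>* \<lhd> (capz A (B' \<otimes> Z) \<cdot> A\<^bold>* \<lhd> (f\<dagger> \<rhd> (B' \<otimes> Z))) \<cdot> 
      B\<^bold>* \<lhd> A\<^bold>* \<lhd> \<alpha> A' B' Z \<cdot> \<alpha> (B\<^bold>*) (A\<^bold>*) (?E \<otimes> Z)"
      using assms Z ab by (subst capz_natural) (simp_all add: lw_comp)
    also have "\<dots> = (capz B' Z \<cdot> conj_arr C g \<rhd> (B' \<otimes> Z)) \<cdot> B\<^bold>* \<lhd> (capz A' (B' \<otimes> Z) \<cdot> conj_arr C f \<rhd> (A' \<otimes> B' \<otimes> Z)) \<cdot> 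
      B\<^bold>* \<lhd> A\<^bold>* \<lhd> \<alpha> A' B' Z \<cdot> \<alpha> (B\<^bold>*) (A\<^bold>*) (?E \<otimes> Z)"
      using assms Z ab by (simp add: conj_cap)
    also have "\<dots> = capn A' B' Z \<cdot> B'\<^bold>* \<lhd> A'\<^bold>* \<lhd> \<alpha> A' B' Z \<cdot> \<alpha> (B'\<^bold>*) (A'\<^bold>*) (?E \<otimes> Z) \<cdot> (conj_arr C g \<boxtimes> conj_arr C f) \<rhd> (?E \<otimes> Z)"
      using assms Z ab by (simp add: act_tensor capn_def lw_comp act_lw act_lw')
         (simp add: lw_merge act_lw)
    also have "\<dots> = capz ?E Z \<cdot> ((dual_tensor C A' B')\<dagger> \<cdot> (conj_arr C g \<boxtimes> conj_arr C f)) \<rhd> (?E \<otimes> Z)"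
      using assms Z ab arg_cong [OF dag_dual_tensor_cap [of A' B' Z ?E], of "\<lambda>x. x \<cdot> (conj_arr C g \<boxtimes> conj_arr C f) \<rhd> (?E \<otimes> Z)"]
      by (simp add: act_comp)
    finally show "capz ?E Z \<cdot> (conj_arr C (f \<boxtimes> g) \<cdot> (dual_tensor C A B)\<dagger>) \<rhd> (?E \<otimes> Z) =
       capz ?E Z \<cdot> ((dual_tensor C A' B')\<dagger> \<cdot> (conj_arr C g \<boxtimes> conj_arr C f)) \<rhd> (?E \<otimes> Z)" .
  qed (use assms ab in simp_all)
qed


section \<open>Compatibility of \<open>dual_tensor\<close> with associator, symmetry and left
  unitor\<close>

lemma dual_tensor_assoc:
  assumes "A \<in> Ob C" "B \<in> Ob C" "D \<in> Ob C"
  shows "conj_arr C (\<alpha> A B D) \<cdot> (dual_tensor C (A \<otimes> B) D)\<dagger> \<cdot> D\<^bold>* \<lhd> (dual_tensor C A B)\<dagger> =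
    (dual_tensor C A (B \<otimes> D))\<dagger> \<cdot> (dual_tensor C B D)\<dagger> \<rhd> (A\<^bold>*) \<cdot> (\<alpha> (D\<^bold>*) (B\<^bold>*) (A\<^bold>*))\<dagger>"
proof (rule capz_eqI [of "A \<otimes> (B \<otimes> D)"])
  fix Z assume Z: "Z \<in> Ob C"
  let ?E = "(A \<otimes> B) \<otimes> D" and ?E' = "A \<otimes> (B \<otimes> D)"
  let ?d = "\<lambda>X Y. (dual_tensor C X Y)\<dagger>"
  have cc: "capz ?E' Z \<cdot> conj_arr C (\<alpha> A B D) \<rhd> (?E' \<otimes> Z) = capz ?E Z \<cdot> ?E\<^bold>* \<lhd> ((\<alpha> A B D)\<dagger> \<rhd> Z)"
    using assms Z conj_cap [of "\<alpha> A B D" Z ?E ?E'] by simp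
  have d: "capz (X \<otimes> Y) W \<cdot> ?d X Y \<rhd> ((X \<otimes> Y) \<otimes> W) = capn X Y W \<cdot> Y\<^bold>* \<lhd> X\<^bold>* \<lhd> \<alpha> X Y W \<cdot> \<alpha> (Y\<^bold>*) (X\<^bold>*) ((X \<otimes> Y) \<otimes> W)"
    if "X \<in> Ob C" "Y \<in> Ob C" "W \<in> Ob C" for X Y W using that by (intro dag_dual_tensor_cap) auto
  have "capz ?E' Z \<cdot> (conj_arr C (\<alpha> A B D) \<cdot> ?d (A \<otimes> B) D \<cdot> D\<^bold>* \<lhd> ?d A B) \<rhd> (?E' \<otimes> Z) =
    (capz ?E' Z \<cdot> conj_arr C (\<alpha> A B D) \<rhd> (?E' \<otimes> Z)) \<cdot> ?d (A \<otimes> B) D \<rhd> (?E' \<otimes> Z) \<cdot> (D\<^bold>* \<lhd> ?d A B) \<rhd> (?E' \<otimes> Z)"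
    using assms Z by (simp add: act_comp)
  also have "\<dots> = (capz ?E Z \<cdot> ?d (A \<otimes> B) D \<rhd> (?E \<otimes> Z)) \<cdot> (D\<^bold>* \<otimes> (A \<otimes> B)\<^bold>*) \<lhd> ((\<alpha> A B D)\<dagger> \<rhd> Z) \<cdot> (D\<^bold>* \<lhd> ?d A B) \<rhd> (?E' \<otimes> Z)"
    unfolding cc using assms Z act_lw' [of "?d (A \<otimes> B) D" "(\<alpha> A B D)\<dagger> \<rhd> Z"] by simp
  also have "\<dots> = capz D Z \<cdot> D\<^bold>* \<lhd> ((capz (A \<otimes> B) (D \<otimes> Z) \<cdot> ?d A B \<rhd> ((A \<otimes> B) \<otimes> D \<otimes> Z)) \<cdot>
     (B\<^bold>* \<otimes> A\<^bold>*) \<lhd> (\<alpha> (A \<otimes> B) D Z \<cdot> (\<alpha> A B D)\<dagger> \<rhd> Z)) \<cdot> \<alpha> (D\<^bold>*) (B\<^bold>* \<otimes> A\<^bold>*) (?E' \<otimes> Z)"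
    unfolding d [OF tensor_ob [OF assms(1,2)] assms(3) Z] capn_def
    using assms Z by (simp add: lw_comp act_lw_act assoc_lw')
      (simp add: lw_merge act_lw)
  also have "\<dots> = capz D Z \<cdot> D\<^bold>* \<lhd> (capn A B (D \<otimes> Z) \<cdot> B\<^bold>* \<lhd> A\<^bold>* \<lhd> (\<alpha> A B (D \<otimes> Z) \<cdot> \<alpha> (A \<otimes> B) D Z \<cdot> (\<alpha> A B D)\<dagger> \<rhd> Z) \<cdot> 
      \<alpha> (B\<^bold>*) (A\<^bold>*) (?E' \<otimes> Z)) \<cdot> \<alpha> (D\<^bold>*) (B\<^bold>* \<otimes> A\<^bold>*) (?E' \<otimes> Z)"
    using assms Z by (simp add: d assoc_lw assoc_lw' lw_comp)
  also have "\<alpha> A B (D \<otimes> Z) \<cdot> \<alpha> (A \<otimes> B) D Z \<cdot> (\<alpha> A B D)\<dagger> \<rhd> Z = A \<lhd> \<alpha> B D Z \<cdot> \<alpha> A (B \<otimes> D) Z"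
    using assms Z by (simp add: act_dag_assoc)
  \<comment> \<open>The normal form that the other side has to reach: the caps of \<open>A\<close>,
    \<open>B\<close> and \<open>D\<close>, each nested in the next.\<close>
  finally have L: "capz ?E' Z \<cdot> (conj_arr C (\<alpha> A B D) \<cdot> ?d (A \<otimes> B) D \<cdot> D\<^bold>* \<lhd> ?d A B) \<rhd> (?E' \<otimes> Z) =
     capz D Z \<cdot> D\<^bold>* \<lhd> (capn A B (D \<otimes> Z) \<cdot> B\<^bold>* \<lhd> A\<^bold>* \<lhd> (A \<lhd> \<alpha> B D Z \<cdot> \<alpha> A (B \<otimes> D) Z) \<cdot> 
      \<alpha> (B\<^bold>*) (A\<^bold>*) (?E' \<otimes> Z)) \<cdot> \<alpha> (D\<^bold>*) (B\<^bold>* \<otimes> A\<^bold>*) (?E' \<otimes> Z)" .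
  have "capz ?E' Z \<cdot> (?d A (B \<otimes> D) \<cdot> ?d B D \<rhd> (A\<^bold>*) \<cdot> (\<alpha> (D\<^bold>*) (B\<^bold>*) (A\<^bold>*))\<dagger>) \<rhd> (?E' \<otimes> Z) =
    (capz ?E' Z \<cdot> ?d A (B \<otimes> D) \<rhd> (?E' \<otimes> Z)) \<cdot> (?d B D \<rhd> (A\<^bold>*)) \<rhd> (?E' \<otimes> Z) \<cdot> (\<alpha> (D\<^bold>*) (B\<^bold>*) (A\<^bold>*))\<dagger> \<rhd> (?E' \<otimes> Z)"
    using assms Z by (simp add: act_comp)
  also have "\<dots> = (capz (B \<otimes> D) Z \<cdot> ?d B D \<rhd> ((B \<otimes> D) \<otimes> Z)) \<cdot> (D\<^bold>* \<otimes> B\<^bold>*) \<lhd> (capz A ((B \<otimes> D) \<otimes> Z) \<cdot> A\<^bold>* \<lhd> \<alpha> A (B \<otimes> D) Z) \<cdot> 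
    \<alpha> (D\<^bold>* \<otimes> B\<^bold>*) (A\<^bold>*) (?E' \<otimes> Z) \<cdot> (\<alpha> (D\<^bold>*) (B\<^bold>*) (A\<^bold>*))\<dagger> \<rhd> (?E' \<otimes> Z)"
    unfolding d [OF assms(1) tensor_ob [OF assms(2,3)] Z] capn_def
    using assms Z by (simp add: act_act act_lw' lw_comp)
  also have "\<dots> = capz D Z \<cdot> D\<^bold>* \<lhd> capz B (D \<otimes> Z) \<cdot> D\<^bold>* \<lhd> B\<^bold>* \<lhd> (\<alpha> B D Z \<cdot> capz A ((B \<otimes> D) \<otimes> Z) \<cdot> A\<^bold>* \<lhd> \<alpha> A (B \<otimes> D) Z)
     \<cdot> D\<^bold>* \<lhd> \<alpha> (B\<^bold>*) (A\<^bold>*) (?E' \<otimes> Z) \<cdot> \<alpha> (D\<^bold>*) (B\<^bold>* \<otimes> A\<^bold>*) (?E' \<otimes> Z)"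
    unfolding d [OF assms(2,3) Z] capn_def
    using assms Z by (simp add: lw_comp assoc_lw' act_dag_assoc)
  also have "\<alpha> B D Z \<cdot> capz A ((B \<otimes> D) \<otimes> Z) \<cdot> A\<^bold>* \<lhd> \<alpha> A (B \<otimes> D) Z = capz A (B \<otimes> D \<otimes> Z) \<cdot> A\<^bold>* \<lhd> (A \<lhd> \<alpha> B D Z \<cdot> \<alpha> A (B \<otimes> D) Z)"
    using assms Z by (simp add: lw_comp capz_natural')
  also have "capz D Z \<cdot> D\<^bold>* \<lhd> capz B (D \<otimes> Z) \<cdot> D\<^bold>* \<lhd> B\<^bold>* \<lhd> \<dots> \<cdot> D\<^bold>* \<lhd> \<alpha> (B\<^bold>*) (A\<^bold>*) (?E' \<otimes> Z) \<cdot> \<alpha> (D\<^bold>*) (B\<^bold>* \<otimes> A\<^bold>*) (?E' \<otimes> Z) =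
     capz D Z \<cdot> D\<^bold>* \<lhd> (capn A B (D \<otimes> Z) \<cdot> B\<^bold>* \<lhd> A\<^bold>* \<lhd> (A \<lhd> \<alpha> B D Z \<cdot> \<alpha> A (B \<otimes> D) Z) \<cdot> 
      \<alpha> (B\<^bold>*) (A\<^bold>*) (?E' \<otimes> Z)) \<cdot> \<alpha> (D\<^bold>*) (B\<^bold>* \<otimes> A\<^bold>*) (?E' \<otimes> Z)"
    using assms Z by (simp add: capn_def lw_comp)
  finally show "capz ?E' Z \<cdot> (conj_arr C (\<alpha> A B D) \<cdot> ?d (A \<otimes> B) D \<cdot> D\<^bold>* \<lhd> ?d A B) \<rhd> (?E' \<otimes> Z) =
    capz ?E' Z \<cdot> (?d A (B \<otimes> D) \<cdot> ?d B D \<rhd> (A\<^bold>*) \<cdot> (\<alpha> (D\<^bold>*) (B\<^bold>*) (A\<^bold>*))\<dagger>) \<rhd> (?E' \<otimes> Z)"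
    unfolding L by simp
qed (use assms in simp_all)

text \<open>Sliding each cap along a wire of the other exchanges the nesting, so crossing the dual
  wires amounts to crossing the original ones.\<close>

lemma capn_swap:
  assumes "A \<in> Ob C" "B \<in> Ob C" "Z \<in> Ob C"
  shows "capn B A Z \<cdot> sw (B\<^bold>*) (A\<^bold>*) (B \<otimes> A \<otimes> Z) = capn A B Z \<cdot> B\<^bold>* \<lhd> A\<^bold>* \<lhd> sw B A Z"
proof -
  have 1: "A\<^bold>* \<lhd> capz B (A \<otimes> Z) \<cdot> sw (B\<^bold>*) (A\<^bold>*) (B \<otimes> A \<otimes> Z) = capz B (A\<^bold>* \<otimes> A \<otimes> Z) \<cdot> B\<^bold>* \<lhd> sw (A\<^bold>*) B (A \<otimes> Z)"
    using assms by (simp flip: capz_slide)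
  have 2: "capz A (B \<otimes> Z) \<cdot> A\<^bold>* \<lhd> sw B A Z = B \<lhd> capz A Z \<cdot> sw (A\<^bold>*) B (A \<otimes> Z)"
    using assms by (simp flip: capz_slide)
  have "capn B A Z \<cdot> sw (B\<^bold>*) (A\<^bold>*) (B \<otimes> A \<otimes> Z) = (capz A Z \<cdot> capz B (A\<^bold>* \<otimes> A \<otimes> Z)) \<cdot> B\<^bold>* \<lhd> sw (A\<^bold>*) B (A \<otimes> Z)"
    using assms by (simp add: capn_def 1)
  also have "capz A Z \<cdot> capz B (A\<^bold>* \<otimes> A \<otimes> Z) = capz B Z \<cdot> B\<^bold>* \<lhd> B \<lhd> capz A Z"
    using assms by (simp add: capz_natural)
  also have "(\<dots>) \<cdot> B\<^bold>* \<lhd> sw (A\<^bold>*) B (A \<otimes> Z) = capz B Z \<cdot> B\<^bold>* \<lhd> (capz A (B \<otimes> Z) \<cdot> A\<^bold>* \<lhd> sw B A Z)"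
    unfolding 2 using assms by (simp add: lw_comp)
  finally show ?thesis using assms by (simp add: capn_def lw_comp)
qed

lemma dual_tensor_symm:
  assumes "A \<in> Ob C" "B \<in> Ob C"
  shows "conj_arr C (\<sigma> A B) \<cdot> (dual_tensor C A B)\<dagger> = (dual_tensor C B A)\<dagger> \<cdot> \<sigma> (B\<^bold>*) (A\<^bold>*)"
proof (rule capz_eqI [of "B \<otimes> A"])
  fix Z assume Z: "Z \<in> Ob C"
  let ?E = "A \<otimes> B" and ?E' = "B \<otimes> A"
  let ?d = "\<lambda>X Y. (dual_tensor C X Y)\<dagger>"
  have cc: "capz ?E' Z \<cdot> conj_arr C (\<sigma> A B) \<rhd> (?E' \<otimes> Z) = capz ?E Z \<cdot> ?E\<^bold>* \<lhd> (\<sigma> B A \<rhd> Z)"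
    using assms Z conj_cap [of "\<sigma> A B" Z ?E ?E'] by simp
  have d: "capz (X \<otimes> Y) W \<cdot> ?d X Y \<rhd> ((X \<otimes> Y) \<otimes> W) = capn X Y W \<cdot> Y\<^bold>* \<lhd> X\<^bold>* \<lhd> \<alpha> X Y W \<cdot> \<alpha> (Y\<^bold>*) (X\<^bold>*) ((X \<otimes> Y) \<otimes> W)"
    if "X \<in> Ob C" "Y \<in> Ob C" "W \<in> Ob C" for X Y W using that by (intro dag_dual_tensor_cap) auto
  have "capz ?E' Z \<cdot> (conj_arr C (\<sigma> A B) \<cdot> ?d A B) \<rhd> (?E' \<otimes> Z) = (capz ?E' Z \<cdot> conj_arr C (\<sigma> A B) \<rhd> (?E' \<otimes> Z)) \<cdot> ?d A B \<rhd> (?E' \<otimes> Z)"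
    using assms Z by (simp add: act_comp)
  also have "\<dots> = (capz ?E Z \<cdot> ?d A B \<rhd> (?E \<otimes> Z)) \<cdot> (B\<^bold>* \<otimes> A\<^bold>*) \<lhd> (\<sigma> B A \<rhd> Z)"
    unfolding cc using assms Z by (simp add: act_lw)
  also have "\<dots> = (capn A B Z \<cdot> B\<^bold>* \<lhd> A\<^bold>* \<lhd> sw B A Z) \<cdot> B\<^bold>* \<lhd> A\<^bold>* \<lhd> \<alpha> B A Z \<cdot> \<alpha> (B\<^bold>*) (A\<^bold>*) (?E' \<otimes> Z)"
    using assms Z by (simp add: d assoc_lw assoc_lw' act_symm lw_comp)
  also have "\<dots> = capn B A Z \<cdot> sw (B\<^bold>*) (A\<^bold>*) (B \<otimes> A \<otimes> Z) \<cdot> B\<^bold>* \<lhd> A\<^bold>* \<lhd> \<alpha> B A Z \<cdot> \<alpha> (B\<^bold>*) (A\<^bold>*) (?E' \<otimes> Z)"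
    using assms Z by (simp flip: capn_swap)
  also have "\<dots> = (capz ?E' Z \<cdot> ?d B A \<rhd> (?E' \<otimes> Z)) \<cdot> \<sigma> (B\<^bold>*) (A\<^bold>*) \<rhd> (?E' \<otimes> Z)"
    using assms Z by (simp add: d act_symm sw_lw_lw')
  finally show "capz ?E' Z \<cdot> (conj_arr C (\<sigma> A B) \<cdot> ?d A B) \<rhd> (?E' \<otimes> Z) = capz ?E' Z \<cdot> (?d B A \<cdot> \<sigma> (B\<^bold>*) (A\<^bold>*)) \<rhd> (?E' \<otimes> Z)"
    using assms Z by (simp add: act_comp)
qed (use assms in simp_all)

text \<open>The cup of \<open>\<I>\<close> supplies the dual of \<open>\<I>\<close> that the left
  unit law of \<open>dual_tensor\<close> needs. Under the cap of \<open>A\<close> it is contracted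
  again, and the resulting circle is trivial by \<open>unit_circle\<close>;
  \<open>snakez_dag\<close> then removes the cap of \<open>A\<close>.\<close>

lemma dual_tensor_unit:
  assumes "A \<in> Ob C" "Z \<in> Ob C"
  shows "(conj_arr C (\<ll> A) \<cdot> (dual_tensor C \<I> A)\<dagger>) \<rhd> Z \<cdot> (\<alpha> (A\<^bold>*) (\<I>\<^bold>*) Z)\<dagger> \<cdot> A\<^bold>* \<lhd> (\<I>\<^bold>* \<lhd> \<ll> Z \<cdot> cupz \<I> Z) = \<one> (A\<^bold>* \<otimes> Z)"
proof -
  let ?d = "\<lambda>X Y. (dual_tensor C X Y)\<dagger>"
  let ?v = "conj_arr C (\<ll> A) \<cdot> ?d \<I> A"
  let ?c = "\<lambda>Z. (\<alpha> (A\<^bold>*) (\<I>\<^bold>*) Z)\<dagger> \<cdot> A\<^bold>* \<lhd> (\<I>\<^bold>* \<lhd> \<ll> Z \<cdot> cupz \<I> Z)"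
  have cap: "capz A Z \<cdot> ?v \<rhd> (A \<otimes> Z) \<cdot> ?c (A \<otimes> Z) = capz A Z" if Z: "Z \<in> Ob C" for Z
  proof -
    have cc: "capz A Z \<cdot> conj_arr C (\<ll> A) \<rhd> (A \<otimes> Z) = capz (\<I> \<otimes> A) Z \<cdot> (\<I> \<otimes> A)\<^bold>* \<lhd> ((\<ll> A)\<dagger> \<rhd> Z)"
      using assms Z conj_cap [of "\<ll> A" Z "\<I> \<otimes> A" A] by simp
    have "capz A Z \<cdot> ?v \<rhd> (A \<otimes> Z) \<cdot> ?c (A \<otimes> Z) = (capz A Z \<cdot> conj_arr C (\<ll> A) \<rhd> (A \<otimes> Z)) \<cdot> ?d \<I> A \<rhd> (A \<otimes> Z) \<cdot> ?c (A \<otimes> Z)"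
      using assms Z by (simp add: act_comp)
    also have "\<dots> = (capz (\<I> \<otimes> A) Z \<cdot> ?d \<I> A \<rhd> ((\<I> \<otimes> A) \<otimes> Z)) \<cdot> (A\<^bold>* \<otimes> \<I>\<^bold>*) \<lhd> ((\<ll> A)\<dagger> \<rhd> Z) \<cdot> ?c (A \<otimes> Z)"
      unfolding cc using assms Z act_lw' [of "?d \<I> A" "(\<ll> A)\<dagger> \<rhd> Z"] by simp
    also have "\<dots> = capz A Z \<cdot> A\<^bold>* \<lhd> (capz \<I> (A \<otimes> Z) \<cdot> cupz \<I> (A \<otimes> Z))"
      using assms Z by (simp add: dag_dual_tensor_cap capn_def assoc_lw' act_dag_lunit lw_comp)
    also have "\<dots> = capz A Z" using assms Z by (simp add: unit_circle)
    finally show ?thesis .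
  qed
  have "?v \<rhd> Z \<cdot> ?c Z = (capz A (A\<^bold>* \<otimes> Z) \<cdot> A\<^bold>* \<lhd> (sw (A\<^bold>*) A Z \<cdot> cupz A Z)) \<cdot> ?v \<rhd> Z \<cdot> ?c Z"
    using assms by (simp add: snakez_dag)
  also have "\<dots> = (capz A (A\<^bold>* \<otimes> Z) \<cdot> ?v \<rhd> (A \<otimes> A\<^bold>* \<otimes> Z) \<cdot> ?c (A \<otimes> A\<^bold>* \<otimes> Z)) \<cdot> A\<^bold>* \<lhd> (sw (A\<^bold>*) A Z \<cdot> cupz A Z)"
  proof -
    let ?g = "sw (A\<^bold>*) A Z \<cdot> cupz A Z" and ?W = "A \<otimes> A\<^bold>* \<otimes> Z"
    have "cupz \<I> ?W \<cdot> ?g = \<I>\<^bold>* \<lhd> \<I> \<lhd> ?g \<cdot> cupz \<I> Z"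
      using assms by (subst cupz_natural) simp_all
    then have "?c ?W \<cdot> A\<^bold>* \<lhd> ?g = (A\<^bold>* \<otimes> \<I>\<^bold>*) \<lhd> ?g \<cdot> ?c Z"
      using assms by (simp add: lw_merge) (simp add: lw_comp lw_dag_assoc' lunit_natural' lunit_natural'') 
    then show ?thesis using assms act_lw' [of ?v ?g] by simp
  qed
  also have "\<dots> = \<one> (A\<^bold>* \<otimes> Z)" using assms by (subst cap) (simp_all add: snakez_dag)
  finally show ?thesis .
qed


section \<open>Naturality and coherence of the permutation \<open>front\<close>\<close>

lemma sw_tensor:
  assumes "f \<in> Arr C" "g \<in> Arr C" "h \<in> Arr C"
  shows "sw (Cod C f) (Cod C g) (Cod C h) \<cdot> (f \<boxtimes> (g \<boxtimes> h)) = (g \<boxtimes> (f \<boxtimes> h)) \<cdot> sw (Dom C f) (Dom C g) (Dom C h)"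
  using assms by (simp add: tensor_split lw_comp sw_lw_lw' sw_lw_act' sw_act)
    (simp add: act_lw')

lemma front_natural:
  assumes "p \<in> Arr C" "a \<in> Arr C" "q \<in> Arr C" "b \<in> Arr C"
  shows "front (Cod C p) (Cod C a) (Cod C q) (Cod C b) \<cdot> ((p \<boxtimes> a) \<boxtimes> (q \<boxtimes> b)) =
    ((q \<boxtimes> p) \<boxtimes> (a \<boxtimes> b)) \<cdot> front (Dom C p) (Dom C a) (Dom C q) (Dom C b)"
proof -
  let ?\<alpha>' = "\<alpha> (Cod C q) (Cod C p) (Cod C a \<otimes> Cod C b)" and ?\<alpha> = "\<alpha> (Dom C q) (Dom C p) (Dom C a \<otimes> Dom C b)"
  have "front (Cod C p) (Cod C a) (Cod C q) (Cod C b) \<cdot> ((p \<boxtimes> a) \<boxtimes> (q \<boxtimes> b)) =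
     ?\<alpha>'\<dagger> \<cdot> Cod C q \<lhd> \<alpha> (Cod C p) (Cod C a) (Cod C b) \<cdot> (q \<boxtimes> ((p \<boxtimes> a) \<boxtimes> b)) \<cdot> sw (Dom C p \<otimes> Dom C a) (Dom C q) (Dom C b)"
    using assms sw_tensor [of "p \<boxtimes> a" q b] by (simp add: front_def)
  also have "\<dots> = ?\<alpha>'\<dagger> \<cdot> (q \<boxtimes> (p \<boxtimes> (a \<boxtimes> b))) \<cdot> Dom C q \<lhd> \<alpha> (Dom C p) (Dom C a) (Dom C b) \<cdot> sw (Dom C p \<otimes> Dom C a) (Dom C q) (Dom C b)"
    using assms by (simp add: lw_def tensor_comp' assoc_natural')
  also have "q \<boxtimes> (p \<boxtimes> (a \<boxtimes> b)) = ?\<alpha>' \<cdot> ((q \<boxtimes> p) \<boxtimes> (a \<boxtimes> b)) \<cdot> ?\<alpha>\<dagger>"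
    using assms arg_cong [OF assoc_natural' [of q p "a \<boxtimes> b"], of "\<lambda>x. x \<cdot> ?\<alpha>\<dagger>"] by simp
  finally show ?thesis using assms by (simp add: front_def)
qed

lemma front_unitary [simp]:
  assumes "P \<in> Ob C" "A \<in> Ob C" "Q \<in> Ob C" "B \<in> Ob C"
  shows "(front P A Q B)\<dagger> \<cdot> front P A Q B = \<one> ((P \<otimes> A) \<otimes> (Q \<otimes> B))"
    and "front P A Q B \<cdot> (front P A Q B)\<dagger> = \<one> ((Q \<otimes> P) \<otimes> (A \<otimes> B))"
  using assms by (simp_all add: front_def)

text \<open>The reverse orientation of \<open>sw_lw_lw\<close>. With it and
  \<open>yang_baxter_rev\<close> the two sides of \<open>front_assoc\<close> reach a common word in
  transpositions.\<close>

lemma lw_lw_sw: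
  assumes "A \<in> Ob C" "B \<in> Ob C" "h \<in> Arr C" "Z = Dom C h"
  shows "B \<lhd> A \<lhd> h \<cdot> sw A B Z = sw A B (Cod C h) \<cdot> A \<lhd> B \<lhd> h"
  using assms by (simp add: sw_lw_lw)

lemmas lw_lw_sw' = lw_lw_sw [THEN reassoc]

lemma yang_baxter_rev:
  assumes "A \<in> Ob C" "B \<in> Ob C" "D \<in> Ob C" "Z \<in> Ob C" "k \<in> Arr C" "Cod C k = A \<otimes> (B \<otimes> (D \<otimes> Z))"
  shows "D \<lhd> sw A B Z \<cdot> sw A D (B \<otimes> Z) \<cdot> A \<lhd> sw B D Z \<cdot> k = sw B D (A \<otimes> Z) \<cdot> B \<lhd> sw A D Z \<cdot> sw A B (D \<otimes> Z) \<cdot> k"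
  using arg_cong [OF yang_baxter [OF assms(1-4)], of "\<lambda>x. x \<cdot> k"] assms by simp

lemma yang_baxter_rev_lw:
  assumes "A \<in> Ob C" "B \<in> Ob C" "D \<in> Ob C" "Z \<in> Ob C" "k \<in> Arr C" "Cod C k = P \<otimes> (A \<otimes> (B \<otimes> (D \<otimes> Z)))" "P \<in> Ob C"
  shows "P \<lhd> D \<lhd> sw A B Z \<cdot> P \<lhd> sw A D (B \<otimes> Z) \<cdot> P \<lhd> A \<lhd> sw B D Z \<cdot> k =
    P \<lhd> sw B D (A \<otimes> Z) \<cdot> P \<lhd> B \<lhd> sw A D Z \<cdot> P \<lhd> sw A B (D \<otimes> Z) \<cdot> k"
  using arg_cong [OF yang_baxter [OF assms(1-4)], of "\<lambda>x. P \<lhd> x \<cdot> k"] assms by (simp add: lw_comp)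

text \<open>Both sides realize the same permutation of six factors. After the associators have
  cancelled, their words differ by naturality and braid relations.\<close>

lemma front_assoc:
  assumes "P \<in> Ob C" "A \<in> Ob C" "Q \<in> Ob C" "B \<in> Ob C" "R \<in> Ob C" "D \<in> Ob C"
  shows "((\<alpha> R Q P)\<dagger> \<boxtimes> \<alpha> A B D) \<cdot> front (Q \<otimes> P) (A \<otimes> B) R D \<cdot> front P A Q B \<rhd> (R \<otimes> D) =
    front P A (R \<otimes> Q) (B \<otimes> D) \<cdot> (P \<otimes> A) \<lhd> front Q B R D \<cdot> \<alpha> (P \<otimes> A) (Q \<otimes> B) (R \<otimes> D)"
proof (rule act_eqI)
  fix Z assume Z: "Z \<in> Ob C"
  show "(((\<alpha> R Q P)\<dagger> \<boxtimes> \<alpha> A B D) \<cdot> front (Q \<otimes> P) (A \<otimes> B) R D \<cdot> front P A Q B \<rhd> (R \<otimes> D)) \<rhd> Z =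
    (front P A (R \<otimes> Q) (B \<otimes> D) \<cdot> (P \<otimes> A) \<lhd> front Q B R D \<cdot> \<alpha> (P \<otimes> A) (Q \<otimes> B) (R \<otimes> D)) \<rhd> Z"
    using assms Z
    by (simp add: whisker whisker1 whisker2 act_front act_dag_assoc act_sw)
      (simp add: lw_comp lw_lw_sw lw_lw_sw' lw_lw_sw [THEN lw_lift] lw_lw_sw [THEN lw_lift, THEN reassoc] yang_baxter_rev yang_baxter_rev_lw)
qed (use assms in simp_all)

lemma front_symm:
  assumes "P \<in> Ob C" "A \<in> Ob C" "Q \<in> Ob C" "B \<in> Ob C"
  shows "(\<sigma> Q P \<boxtimes> \<sigma> A B) \<cdot> front P A Q B = front Q B P A \<cdot> \<sigma> (P \<otimes> A) (Q \<otimes> B)"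
proof (rule act_eqI)
  fix Z assume Z: "Z \<in> Ob C"
  show "((\<sigma> Q P \<boxtimes> \<sigma> A B) \<cdot> front P A Q B) \<rhd> Z = (front Q B P A \<cdot> \<sigma> (P \<otimes> A) (Q \<otimes> B)) \<rhd> Z"
    using assms Z by (simp add: whisker whisker1 whisker2 act_front)
qed (use assms in simp_all)

section \<open>The doubling functor\<close>

lemma ancilla_cap_simps [simp]:
  "X \<in> Ob C \<Longrightarrow> B \<in> Ob C \<Longrightarrow> ancilla_cap C X B \<in> Arr C"
  "Dom C (ancilla_cap C X B) = (B\<^bold>* \<otimes> X\<^bold>*) \<otimes> (X \<otimes> B)"
  "Cod C (ancilla_cap C X B) = B\<^bold>* \<otimes> B"
  by (simp_all add: ancilla_cap_def)

text \<open>After undoing the permutation, the ancilla and its dual are adjacent in front, and the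
  cap of \<open>X\<close> acts as plain deletion of this pair.\<close>

lemma ancilla_cap_front:
  assumes "X \<in> Ob C" "B \<in> Ob C"
  shows "ancilla_cap C X B \<cdot> front (X\<^bold>*) X (B\<^bold>*) B = \<ll> (B\<^bold>* \<otimes> B) \<cdot> (\<eta> X)\<dagger> \<rhd> (B\<^bold>* \<otimes> B)"
proof -
  have "ancilla_cap C X B \<cdot> front (X\<^bold>*) X (B\<^bold>*) B = B\<^bold>* \<lhd> \<ll> B \<cdot> B\<^bold>* \<lhd> ((\<eta> X)\<dagger> \<rhd> B) \<cdot> sw (X\<^bold>* \<otimes> X) (B\<^bold>*) B"
    unfolding ancilla_cap_def lw_def [symmetric] act_def [symmetric] front_def
    using assms by (simp add: lw_comp)
  also have "\<dots> = B\<^bold>* \<lhd> \<ll> B \<cdot> sw \<I> (B\<^bold>*) B \<cdot> (\<eta> X)\<dagger> \<rhd> (B\<^bold>* \<otimes> B)"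
    using assms by (simp add: sw_act)
  also have "\<dots> = \<ll> (B\<^bold>* \<otimes> B) \<cdot> (\<eta> X)\<dagger> \<rhd> (B\<^bold>* \<otimes> B)"
    using assms by (simp add: sw_unit_left)
  finally show ?thesis .
qed

lemma act_ancilla_cap:
  assumes "X \<in> Ob C" "B \<in> Ob C" "Z \<in> Ob C"
  shows "ancilla_cap C X B \<rhd> Z = (\<alpha> (B\<^bold>*) B Z)\<dagger> \<cdot> B\<^bold>* \<lhd> (capz X (B \<otimes> Z) \<cdot> X\<^bold>* \<lhd> \<alpha> X B Z) \<cdot>
    \<alpha> (B\<^bold>*) (X\<^bold>*) ((X \<otimes> B) \<otimes> Z) \<cdot> \<alpha> (B\<^bold>* \<otimes> X\<^bold>*) (X \<otimes> B) Z"
  unfolding ancilla_cap_def lw_def [symmetric] act_def [symmetric]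
  using assms by (simp add: whisker act_dag_assoc act_cup act_capz)

definition dbl :: "'m \<Rightarrow> 'm" where
  "dbl f = conj_arr C f \<boxtimes> f"

text \<open>The structure map \<open>s\<close> of the doubling functor \<open>dbl\<close>: a
  permutation of the four factors followed by the coherence isomorphism of the duals.\<close>

definition ml :: "'o \<Rightarrow> 'o \<Rightarrow> 'm" where
  "ml A B = (dual_tensor C A B)\<dagger> \<rhd> (A \<otimes> B) \<cdot> front (A\<^bold>*) A (B\<^bold>*) B"

lemma dbl_simps [simp]:
  "f \<in> Arr C \<Longrightarrow> dbl f \<in> Arr C"
  "Dom C (dbl f) = (Dom C f)\<^bold>* \<otimes> Dom C f"
  "Cod C (dbl f) = (Cod C f)\<^bold>* \<otimes> Cod C f"
  "f \<in> Arr C \<Longrightarrow> (dbl f)\<dagger> = dbl (f\<dagger>)"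
  "A \<in> Ob C \<Longrightarrow> dbl (\<one> A) = \<one> (A\<^bold>* \<otimes> A)"
  by (simp_all add: dbl_def)

lemma dbl_comp:
  "f \<in> Arr C \<Longrightarrow> g \<in> Arr C \<Longrightarrow> Dom C g = Cod C f \<Longrightarrow> dbl (g \<cdot> f) = dbl g \<cdot> dbl f"
  by (simp add: dbl_def conj_comp tensor_comp')

lemma ml_simps [simp]:
  assumes "A \<in> Ob C" "B \<in> Ob C"
  shows "ml A B \<in> Arr C"
    and "(ml A B)\<dagger> \<cdot> ml A B = \<one> ((A\<^bold>* \<otimes> A) \<otimes> (B\<^bold>* \<otimes> B))"
    and "ml A B \<cdot> (ml A B)\<dagger> = \<one> ((A \<otimes> B)\<^bold>* \<otimes> (A \<otimes> B))"
proof -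
  have 1: "dual_tensor C A B \<rhd> (A \<otimes> B) \<cdot> (dual_tensor C A B)\<dagger> \<rhd> (A \<otimes> B) = \<one> ((B\<^bold>* \<otimes> A\<^bold>*) \<otimes> (A \<otimes> B))"
    "(dual_tensor C A B)\<dagger> \<rhd> (A \<otimes> B) \<cdot> dual_tensor C A B \<rhd> (A \<otimes> B) = \<one> ((A \<otimes> B)\<^bold>* \<otimes> (A \<otimes> B))"
    using assms by (simp_all flip: act_comp)
  show "ml A B \<in> Arr C" using assms by (simp add: ml_def)
  show "(ml A B)\<dagger> \<cdot> ml A B = \<one> ((A\<^bold>* \<otimes> A) \<otimes> (B\<^bold>* \<otimes> B))"
    using assms reassoc [OF 1(1), of "front (A\<^bold>*) A (B\<^bold>*) B"] by (simp add: ml_def)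
  have "front (A\<^bold>*) A (B\<^bold>*) B \<cdot> (front (A\<^bold>*) A (B\<^bold>*) B)\<dagger> \<cdot> dual_tensor C A B \<rhd> (A \<otimes> B) = dual_tensor C A B \<rhd> (A \<otimes> B)"
    using assms reassoc [OF front_unitary(2), of "A\<^bold>*" A "B\<^bold>*" B "dual_tensor C A B \<rhd> (A \<otimes> B)"] by simp
  then show "ml A B \<cdot> (ml A B)\<dagger> = \<one> ((A \<otimes> B)\<^bold>* \<otimes> (A \<otimes> B))"
    using assms 1(2) by (simp add: ml_def)
qed

lemma ml_dom_cod [simp]:
  "Dom C (ml A B) = (A\<^bold>* \<otimes> A) \<otimes> (B\<^bold>* \<otimes> B)"
  "Cod C (ml A B) = (A \<otimes> B)\<^bold>* \<otimes> (A \<otimes> B)"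
  by (simp_all add: ml_def)

lemma ml_natural:
  assumes "f \<in> Arr C" "g \<in> Arr C"
  shows "dbl (f \<boxtimes> g) \<cdot> ml (Dom C f) (Dom C g) = ml (Cod C f) (Cod C g) \<cdot> (dbl f \<boxtimes> dbl g)"
proof -
  have "dbl (f \<boxtimes> g) \<cdot> ml (Dom C f) (Dom C g) = 
    ((conj_arr C (f \<boxtimes> g) \<cdot> (dual_tensor C (Dom C f) (Dom C g))\<dagger>) \<boxtimes> (f \<boxtimes> g)) \<cdot> 
      front ((Dom C f)\<^bold>*) (Dom C f) ((Dom C g)\<^bold>*) (Dom C g)"
    using assms by (simp add: dbl_def ml_def act_def tensor_comp')
  also have "\<dots> = (((dual_tensor C (Cod C f) (Cod C g))\<dagger> \<cdot> (conj_arr C g \<boxtimes> conj_arr C f)) \<boxtimes> (f \<boxtimes> g)) \<cdot> 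
      front ((Dom C f)\<^bold>*) (Dom C f) ((Dom C g)\<^bold>*) (Dom C g)"
    using assms by (simp add: conj_tensor)
  also have "\<dots> = (dual_tensor C (Cod C f) (Cod C g))\<dagger> \<rhd> (Cod C f \<otimes> Cod C g) \<cdot> ((conj_arr C g \<boxtimes> conj_arr C f) \<boxtimes> (f \<boxtimes> g)) \<cdot> 
      front ((Dom C f)\<^bold>*) (Dom C f) ((Dom C g)\<^bold>*) (Dom C g)"
    using assms by (simp add: act_def tensor_comp')
  also have "((conj_arr C g \<boxtimes> conj_arr C f) \<boxtimes> (f \<boxtimes> g)) \<cdot> front ((Dom C f)\<^bold>*) (Dom C f) ((Dom C g)\<^bold>*) (Dom C g) =
     front ((Cod C f)\<^bold>*) (Cod C f) ((Cod C g)\<^bold>*) (Cod C g) \<cdot> (dbl f \<boxtimes> dbl g)"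
    using assms front_natural [of "conj_arr C f" f "conj_arr C g" g] by (simp add: dbl_def)
  finally show ?thesis using assms by (simp add: ml_def)
qed

text \<open>The duals are handled by \<open>dual_tensor_assoc\<close>, the permutation by
  \<open>front_assoc\<close>. Facts \<open>1\<close> and \<open>2\<close> bring the two kinds of
  maps together by naturality of \<open>front\<close>.\<close>

lemma ml_assoc:
  assumes "A \<in> Ob C" "B \<in> Ob C" "D \<in> Ob C"
  shows "dbl (\<alpha> A B D) \<cdot> ml (A \<otimes> B) D \<cdot> ml A B \<rhd> (D\<^bold>* \<otimes> D) =
    ml A (B \<otimes> D) \<cdot> (A\<^bold>* \<otimes> A) \<lhd> ml B D \<cdot> \<alpha> (A\<^bold>* \<otimes> A) (B\<^bold>* \<otimes> B) (D\<^bold>* \<otimes> D)"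
proof -
  let ?d = "\<lambda>X Y. (dual_tensor C X Y)\<dagger>"
  let ?A = "A\<^bold>*" and ?B = "B\<^bold>*" and ?D = "D\<^bold>*"
  have 1: "front ((A \<otimes> B)\<^bold>*) (A \<otimes> B) ?D D \<cdot> (?d A B \<rhd> (A \<otimes> B)) \<rhd> (?D \<otimes> D) =
     ((?D \<lhd> ?d A B) \<rhd> ((A \<otimes> B) \<otimes> D)) \<cdot> front (?B \<otimes> ?A) (A \<otimes> B) ?D D"
    using assms front_natural [of "?d A B" "\<one> (A \<otimes> B)" "\<one> ?D" "\<one> D"] by (simp add: act_def lw_def)
  have 2: "front ?A A ((B \<otimes> D)\<^bold>*) (B \<otimes> D) \<cdot> (?A \<otimes> A) \<lhd> (?d B D \<rhd> (B \<otimes> D)) =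
     ((?d B D \<rhd> ?A) \<rhd> (A \<otimes> (B \<otimes> D))) \<cdot> front ?A A (?D \<otimes> ?B) (B \<otimes> D)"
    using assms front_natural [of "\<one> ?A" "\<one> A" "?d B D" "\<one> (B \<otimes> D)"] by (simp add: act_def lw_def)
  have "dbl (\<alpha> A B D) \<cdot> ml (A \<otimes> B) D \<cdot> ml A B \<rhd> (?D \<otimes> D) =
    (conj_arr C (\<alpha> A B D) \<boxtimes> \<alpha> A B D) \<cdot> ?d (A \<otimes> B) D \<rhd> ((A \<otimes> B) \<otimes> D) \<cdot>
    (front ((A \<otimes> B)\<^bold>*) (A \<otimes> B) ?D D \<cdot> (?d A B \<rhd> (A \<otimes> B)) \<rhd> (?D \<otimes> D)) \<cdot> front ?A A ?B B \<rhd> (?D \<otimes> D)"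
    using assms by (simp add: dbl_def ml_def act_comp)
  also have "\<dots> = ((conj_arr C (\<alpha> A B D) \<cdot> ?d (A \<otimes> B) D \<cdot> ?D \<lhd> ?d A B) \<boxtimes> \<alpha> A B D) \<cdot> 
    front (?B \<otimes> ?A) (A \<otimes> B) ?D D \<cdot> front ?A A ?B B \<rhd> (?D \<otimes> D)"
    unfolding 1 using assms by (simp add: tensor_comp' act_def [of _ "(A \<otimes> B) \<otimes> D"])
  also have "\<dots> = (?d A (B \<otimes> D) \<rhd> (A \<otimes> (B \<otimes> D)) \<cdot> (?d B D \<rhd> ?A) \<rhd> (A \<otimes> (B \<otimes> D)) \<cdot> ((\<alpha> ?D ?B ?A)\<dagger> \<boxtimes> \<alpha> A B D)) \<cdot> 
    front (?B \<otimes> ?A) (A \<otimes> B) ?D D \<cdot> front ?A A ?B B \<rhd> (?D \<otimes> D)"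
    unfolding dual_tensor_assoc [OF assms]
    using assms by (simp add: tensor_comp' act_def [of _ "A \<otimes> (B \<otimes> D)"])
  also have "\<dots> = ?d A (B \<otimes> D) \<rhd> (A \<otimes> (B \<otimes> D)) \<cdot> ((?d B D \<rhd> ?A) \<rhd> (A \<otimes> (B \<otimes> D)) \<cdot> front ?A A (?D \<otimes> ?B) (B \<otimes> D)) \<cdot>
      (?A \<otimes> A) \<lhd> front ?B B ?D D \<cdot> \<alpha> (?A \<otimes> A) (?B \<otimes> B) (?D \<otimes> D)"
    using assms by (simp add: front_assoc)
  also have "\<dots> = ml A (B \<otimes> D) \<cdot> (?A \<otimes> A) \<lhd> ml B D \<cdot> \<alpha> (?A \<otimes> A) (?B \<otimes> B) (?D \<otimes> D)"
    unfolding 2 [symmetric] using assms by (simp add: ml_def lw_comp)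
  finally show ?thesis .
qed

lemma ml_symm:
  assumes "A \<in> Ob C" "B \<in> Ob C"
  shows "dbl (\<sigma> A B) \<cdot> ml A B = ml B A \<cdot> \<sigma> (A\<^bold>* \<otimes> A) (B\<^bold>* \<otimes> B)"
proof -
  let ?d = "\<lambda>X Y. (dual_tensor C X Y)\<dagger>"
  have "dbl (\<sigma> A B) \<cdot> ml A B = ((conj_arr C (\<sigma> A B) \<cdot> ?d A B) \<boxtimes> \<sigma> A B) \<cdot> front (A\<^bold>*) A (B\<^bold>*) B"
    using assms by (simp add: dbl_def ml_def act_def tensor_comp')
  also have "\<dots> = ?d B A \<rhd> (B \<otimes> A) \<cdot> (\<sigma> (B\<^bold>*) (A\<^bold>*) \<boxtimes> \<sigma> A B) \<cdot> front (A\<^bold>*) A (B\<^bold>*) B"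
    unfolding dual_tensor_symm [OF assms] using assms by (simp add: act_def tensor_comp')
  finally show ?thesis using assms by (simp add: front_symm ml_def)
qed

lemma cupz_unslide:
  assumes "A \<in> Ob C" "D \<in> Ob C" "Z \<in> Ob C"
  shows "sw (A\<^bold>*) D (A \<otimes> Z) \<cdot> A\<^bold>* \<lhd> sw A D Z \<cdot> cupz A (D \<otimes> Z) = D \<lhd> cupz A Z"
  using assms by (simp flip: cupz_slide)

lemma cupz_unslide':
  assumes "A \<in> Ob C" "D \<in> Ob C" "Z \<in> Ob C" "A' = A\<^bold>*" "k \<in> Arr C" "Cod C k = D \<otimes> Z"
  shows "sw A' D (A \<otimes> Z) \<cdot> A' \<lhd> sw A D Z \<cdot> cupz A (D \<otimes> Z) \<cdot> k = D \<lhd> cupz A Z \<cdot> k"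
  using arg_cong [OF cupz_unslide [OF assms(1-3)], of "\<lambda>x. x \<cdot> k"] assms by simp

text \<open>The left unit law of the doubling functor, with \<open>\<eta> \<I>\<close> as its unit
  map. The dual factors contribute exactly the composite of \<open>dual_tensor_unit\<close>.\<close>

lemma ml_lunit:
  assumes "A \<in> Ob C"
  shows "dbl (\<ll> A) \<cdot> ml \<I> A \<cdot> \<eta> \<I> \<rhd> (A\<^bold>* \<otimes> A) = \<ll> (A\<^bold>* \<otimes> A)"
proof (rule act_eqI)
  fix Z assume Z: "Z \<in> Ob C"
  let ?v = "conj_arr C (\<ll> A) \<cdot> (dual_tensor C \<I> A)\<dagger>"
  have 1: "dbl (\<ll> A) \<cdot> ml \<I> A = (?v \<boxtimes> \<ll> A) \<cdot> front (\<I>\<^bold>*) \<I> (A\<^bold>*) A"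
    using assms by (simp add: dbl_def ml_def act_def tensor_comp')
  have 2: "(front (\<I>\<^bold>*) \<I> (A\<^bold>*) A \<cdot> \<eta> \<I> \<rhd> (A\<^bold>* \<otimes> A)) \<rhd> Z = (\<alpha> (A\<^bold>* \<otimes> \<I>\<^bold>*) (\<I> \<otimes> A) Z)\<dagger> \<cdot> (\<alpha> (A\<^bold>*) (\<I>\<^bold>*) ((\<I> \<otimes> A) \<otimes> Z))\<dagger> \<cdot>
     A\<^bold>* \<lhd> (\<I>\<^bold>* \<lhd> (\<alpha> \<I> A Z)\<dagger> \<cdot> cupz \<I> (A \<otimes> Z)) \<cdot> \<alpha> (A\<^bold>*) A Z \<cdot> \<ll> (A\<^bold>* \<otimes> A) \<rhd> Z"
    using assms Z by (simp add: act_comp act_front act_act act_cup act_lunit lw_comp act_dag_assoc act_cupz cupz_natural' cupz_unslide')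
  have "(dbl (\<ll> A) \<cdot> ml \<I> A \<cdot> \<eta> \<I> \<rhd> (A\<^bold>* \<otimes> A)) \<rhd> Z = 
    (?v \<boxtimes> \<ll> A) \<rhd> Z \<cdot> (front (\<I>\<^bold>*) \<I> (A\<^bold>*) A \<cdot> \<eta> \<I> \<rhd> (A\<^bold>* \<otimes> A)) \<rhd> Z"
    using assms Z 1 by (simp flip: act_comp comp_assoc')
  also have "\<dots> = (\<alpha> (A\<^bold>*) A Z)\<dagger> \<cdot> (?v \<rhd> (A \<otimes> Z) \<cdot> (\<alpha> (A\<^bold>*) (\<I>\<^bold>*) (A \<otimes> Z))\<dagger> \<cdot> A\<^bold>* \<lhd> (\<I>\<^bold>* \<lhd> \<ll> (A \<otimes> Z) \<cdot> cupz \<I> (A \<otimes> Z))) 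
     \<cdot> \<alpha> (A\<^bold>*) A Z \<cdot> \<ll> (A\<^bold>* \<otimes> A) \<rhd> Z"
  proof -
    have "A\<^bold>* \<lhd> (\<ll> A \<rhd> Z) \<cdot> ?v \<rhd> ((\<I> \<otimes> A) \<otimes> Z) = ?v \<rhd> (A \<otimes> Z) \<cdot> (A\<^bold>* \<otimes> \<I>\<^bold>*) \<lhd> (\<ll> A \<rhd> Z)"
      using assms Z by (subst act_lw) simp_all
    then have "(?v \<boxtimes> \<ll> A) \<rhd> Z = (\<alpha> (A\<^bold>*) A Z)\<dagger> \<cdot> ?v \<rhd> (A \<otimes> Z) \<cdot> (A\<^bold>* \<otimes> \<I>\<^bold>*) \<lhd> (\<ll> A \<rhd> Z) \<cdot> \<alpha> (A\<^bold>* \<otimes> \<I>\<^bold>*) (\<I> \<otimes> A) Z"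
      using assms Z by (simp add: act_tensor flip: comp_assoc')
    then show ?thesis unfolding 2 using assms Z by (simp add: act_lunit lw_comp lw_dag_assoc')
  qed
  also have "\<dots> = \<ll> (A\<^bold>* \<otimes> A) \<rhd> Z"
    using assms Z by (subst dual_tensor_unit) simp_all
  finally show "(dbl (\<ll> A) \<cdot> ml \<I> A \<cdot> \<eta> \<I> \<rhd> (A\<^bold>* \<otimes> A)) \<rhd> Z = \<ll> (A\<^bold>* \<otimes> A) \<rhd> Z" .
qed (use assms in simp_all)

text \<open>Discarding is monoidal. \<open>dag_dual_tensor_cap\<close> splits the cap of the product
  into nested caps, and \<open>capz_slide\<close> moves them side by side.\<close>

lemma ml_cap:
  assumes "A \<in> Ob C" "B \<in> Ob C"
  shows "(\<eta> (A \<otimes> B))\<dagger> \<cdot> ml A B = \<ll> \<I> \<cdot> ((\<eta> A)\<dagger> \<boxtimes> (\<eta> B)\<dagger>)"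
proof (rule act_eqI)
  fix Z assume Z: "Z \<in> Ob C"
  let ?E = "A \<otimes> B"
  have "((\<eta> ?E)\<dagger> \<cdot> ml A B) \<rhd> Z = (\<ll> Z)\<dagger> \<cdot> (capz ?E Z \<cdot> (dual_tensor C A B)\<dagger> \<rhd> (?E \<otimes> Z)) \<cdot> \<alpha> (B\<^bold>* \<otimes> A\<^bold>*) ?E Z \<cdot> front (A\<^bold>*) A (B\<^bold>*) B \<rhd> Z"
    using assms Z by (simp add: ml_def act_comp act_cup act_act)
  also have "\<dots> = (\<ll> Z)\<dagger> \<cdot> capz B Z \<cdot> (B\<^bold>* \<lhd> capz A (B \<otimes> Z) \<cdot>
    sw (A\<^bold>*) (B\<^bold>*) (A \<otimes> B \<otimes> Z) \<cdot> A\<^bold>* \<lhd> sw A (B\<^bold>*) (B \<otimes> Z)) \<cdot> A\<^bold>* \<lhd> A \<lhd> \<alpha> (B\<^bold>*) B Z \<cdot> \<alpha> (A\<^bold>*) A ((B\<^bold>* \<otimes> B) \<otimes> Z) \<cdot> \<alpha> (A\<^bold>* \<otimes> A) (B\<^bold>* \<otimes> B) Z"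
    using assms Z by (simp add: dag_dual_tensor_cap capn_def act_front)
  also have "\<dots> = (\<ll> \<I> \<cdot> ((\<eta> A)\<dagger> \<boxtimes> (\<eta> B)\<dagger>)) \<rhd> Z"
    unfolding capz_slide [OF assms(1) dual_ob [OF assms(2)] tensor_ob [OF assms(2) Z]]
    using assms Z by (simp add: whisker act_cup capz_natural')
  finally show "((\<eta> ?E)\<dagger> \<cdot> ml A B) \<rhd> Z = (\<ll> \<I> \<cdot> ((\<eta> A)\<dagger> \<boxtimes> (\<eta> B)\<dagger>)) \<rhd> Z" .
qed (use assms in simp_all)

text \<open>The form of \<open>cpm_map\<close> used from here on: double, split off the doubled
  ancilla, discard it. It holds because \<open>front\<close> and its dagger may be inserted after
  \<open>ancilla_cap\<close>.\<close>

lemma cpm_map_dbl: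
  assumes "X \<in> Ob C" "B \<in> Ob C" "f \<in> Arr C" "Cod C f = X \<otimes> B"
  shows "cpm_map C B (X, f) = \<ll> (B\<^bold>* \<otimes> B) \<cdot> (\<eta> X)\<dagger> \<rhd> (B\<^bold>* \<otimes> B) \<cdot> (ml X B)\<dagger> \<cdot> dbl f"
proof -
  let ?fr = "front (X\<^bold>*) X (B\<^bold>*) B"
  have "cpm_map C B (X, f) = ancilla_cap C X B \<cdot> dual_tensor C X B \<rhd> (X \<otimes> B) \<cdot> dbl f"
    using assms by (simp add: cpm_map_def dbl_def act_def tensor_comp')
  also have "\<dots> = (ancilla_cap C X B \<cdot> ?fr) \<cdot> ?fr\<dagger> \<cdot> dual_tensor C X B \<rhd> (X \<otimes> B) \<cdot> dbl f"
    using assms reassoc [OF front_unitary(2), of "X\<^bold>*" X "B\<^bold>*" B "dual_tensor C X B \<rhd> (X \<otimes> B) \<cdot> dbl f"] by simp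
  finally show ?thesis unfolding ancilla_cap_front [OF assms(1,2)]
    using assms by (simp add: ml_def)
qed

text \<open>The cup, read as a Kraus morphism with ancilla \<open>X\<^sup>*\<close>, prepares the maximally mixed state of \<open>X\<close>.\<close>

lemma cpm_map_cup:
  assumes "X \<in> Ob C"
  shows "cpm_map C X (X\<^bold>*, \<eta> X) = \<eta> X \<cdot> (\<eta> \<I>)\<dagger>"
proof (rule act_eqI)
  fix Z assume Z: "Z \<in> Ob C"
  let ?X = "X\<^bold>*" let ?t = "dual_tensor C ?X X"
  let ?u = "?t \<cdot> conj_arr C (\<eta> X)"
  \<comment> \<open>The conjugated half of the doubled cup, with the dual of the ancilla contracted
    against an incoming ancilla wire. The facts \<open>cap\<close> and \<open>v\<close> show that
    this wire merely passes through, up to a cap on \<open>\<I>\<close>.\<close>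
  let ?v = "\<lambda>W. ?X \<lhd> capz ?X W \<cdot> \<alpha> ?X (?X\<^bold>*) (?X \<otimes> W) \<cdot> ?u \<rhd> (?X \<otimes> W)"
  have cap: "capz X W \<cdot> ?v (X \<otimes> W) = capz \<I> W \<cdot> \<I>\<^bold>* \<lhd> ((\<ll> W)\<dagger> \<cdot> capz X W)" if W: "W \<in> Ob C" for W
  proof -
    have cc: "capz (?X \<otimes> X) W \<cdot> conj_arr C (\<eta> X) \<rhd> ((?X \<otimes> X) \<otimes> W) = capz \<I> W \<cdot> \<I>\<^bold>* \<lhd> ((\<eta> X)\<dagger> \<rhd> W)"
      using assms W conj_cap [of "\<eta> X" W \<I> "?X \<otimes> X"] by simp
    have "capz X W \<cdot> ?v (X \<otimes> W) = (capn ?X X W \<cdot> \<alpha> ?X (?X\<^bold>*) (?X \<otimes> X \<otimes> W) \<cdot> ?t \<rhd> (?X \<otimes> X \<otimes> W)) \<cdot> conj_arr C (\<eta> X) \<rhd> (?X \<otimes> X \<otimes> W)"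
      using assms W by (simp add: capn_def act_comp)
    also have "\<dots> = (capz (?X \<otimes> X) W \<cdot> conj_arr C (\<eta> X) \<rhd> ((?X \<otimes> X) \<otimes> W)) \<cdot> \<I>\<^bold>* \<lhd> (\<alpha> ?X X W)\<dagger>"
      unfolding dual_tensor_cap_nested [OF dual_ob [OF assms] assms W] using assms W
      by (simp add: act_lw)
    also have "\<dots> = capz \<I> W \<cdot> \<I>\<^bold>* \<lhd> ((\<ll> W)\<dagger> \<cdot> capz X W)"
      unfolding cc using assms W by (simp add: act_cup lw_comp)
    finally show ?thesis .
  qed
  \<comment> \<open>The equation \<open>cap\<close> is known only under the cap of \<open>X\<close>;
    the cup in \<open>?g\<close> bends the wire back and frees it.\<close>
  have v: "?v W = capz \<I> (?X \<otimes> W) \<cdot> \<I>\<^bold>* \<lhd> (\<ll> (?X \<otimes> W))\<dagger>" if W: "W \<in> Ob C" for W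
  proof -
    let ?g = "sw ?X X W \<cdot> cupz X W"
    have n: "?X \<lhd> ?g \<cdot> ?v W = ?v (X \<otimes> ?X \<otimes> W) \<cdot> \<I>\<^bold>* \<lhd> ?X \<lhd> ?g"
    proof -
      have "capz ?X (X \<otimes> ?X \<otimes> W) \<cdot> ?X\<^bold>* \<lhd> ?X \<lhd> ?g = ?g \<cdot> capz ?X W"
        using assms W by (subst capz_natural) simp_all
      then have "?X \<lhd> (capz ?X (X \<otimes> ?X \<otimes> W) \<cdot> ?X\<^bold>* \<lhd> ?X \<lhd> ?g) = ?X \<lhd> (?g \<cdot> capz ?X W)" by simp
      then have "?X \<lhd> capz ?X (X \<otimes> ?X \<otimes> W) \<cdot> ?X \<lhd> ?X\<^bold>* \<lhd> ?X \<lhd> ?g = ?X \<lhd> ?g \<cdot> ?X \<lhd> capz ?X W"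
        using assms W by (subst (asm) (1 2) lw_comp) simp_all
      from reassoc [OF this, of "\<alpha> ?X (?X\<^bold>*) (?X \<otimes> W) \<cdot> ?u \<rhd> (?X \<otimes> W)"] 
      show ?thesis using assms W act_lw [of ?u "?X \<lhd> ?g"] assoc_lw' [of ?X "?X\<^bold>*" "?X \<lhd> ?g"] by simp
    qed
    have "?v W = (capz X (?X \<otimes> W) \<cdot> ?X \<lhd> ?g) \<cdot> ?v W"
      using assms W by (simp add: snakez_dag)
    also have "\<dots> = (capz X (?X \<otimes> W) \<cdot> ?v (X \<otimes> ?X \<otimes> W)) \<cdot> \<I>\<^bold>* \<lhd> ?X \<lhd> ?g"
      using assms W n by simp
    also have "\<dots> = capz \<I> (?X \<otimes> W) \<cdot> \<I>\<^bold>* \<lhd> ((\<ll> (?X \<otimes> W))\<dagger> \<cdot> (capz X (?X \<otimes> W) \<cdot> ?X \<lhd> ?g))"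
      unfolding cap [OF tensor_ob [OF dual_ob [OF assms] W]] using assms W by (simp add: lw_comp)
    finally show ?thesis using assms W by (simp add: snakez_dag)
  qed
  have "cpm_map C X (?X, \<eta> X) \<rhd> Z = (\<alpha> ?X X Z)\<dagger> \<cdot> ?v (X \<otimes> Z) \<cdot> \<I>\<^bold>* \<lhd> (cupz X Z \<cdot> \<ll> Z) \<cdot> \<alpha> (\<I>\<^bold>*) \<I> Z"
  proof -
    have "(?u \<boxtimes> \<eta> X) \<rhd> Z = (\<alpha> (?X \<otimes> ?X\<^bold>*) (?X \<otimes> X) Z)\<dagger> \<cdot> ?u \<rhd> ((?X \<otimes> X) \<otimes> Z) \<cdot> \<I>\<^bold>* \<lhd> (\<eta> X \<rhd> Z) \<cdot> \<alpha> (\<I>\<^bold>*) \<I> Z"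
      using assms Z act_lw' [of ?u "\<eta> X \<rhd> Z"] by (simp add: act_tensor)
    also have "?u \<rhd> ((?X \<otimes> X) \<otimes> Z) \<cdot> \<I>\<^bold>* \<lhd> (\<eta> X \<rhd> Z) \<cdot> \<alpha> (\<I>\<^bold>*) \<I> Z = 
      (?X \<otimes> ?X\<^bold>*) \<lhd> (\<alpha> ?X X Z)\<dagger> \<cdot> ?u \<rhd> (?X \<otimes> X \<otimes> Z) \<cdot> \<I>\<^bold>* \<lhd> (cupz X Z \<cdot> \<ll> Z) \<cdot> \<alpha> (\<I>\<^bold>*) \<I> Z"
      using assms Z act_lw' [of ?u "(\<alpha> ?X X Z)\<dagger>"] by (simp add: act_cup lw_comp)
    finally have "(?u \<boxtimes> \<eta> X) \<rhd> Z = (\<alpha> (?X \<otimes> ?X\<^bold>*) (?X \<otimes> X) Z)\<dagger> \<cdot> 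
      (?X \<otimes> ?X\<^bold>*) \<lhd> (\<alpha> ?X X Z)\<dagger> \<cdot> ?u \<rhd> (?X \<otimes> X \<otimes> Z) \<cdot> \<I>\<^bold>* \<lhd> (cupz X Z \<cdot> \<ll> Z) \<cdot> \<alpha> (\<I>\<^bold>*) \<I> Z" .
    moreover have "cpm_map C X (?X, \<eta> X) \<rhd> Z = ancilla_cap C ?X X \<rhd> Z \<cdot> (?u \<boxtimes> \<eta> X) \<rhd> Z"
      using assms Z by (simp add: cpm_map_def act_comp)
    ultimately show ?thesis using assms Z by (simp add: act_ancilla_cap lw_comp assoc_lw')
  qed
  also have "\<dots> = (\<alpha> ?X X Z)\<dagger> \<cdot> capz \<I> (?X \<otimes> X \<otimes> Z) \<cdot> \<I>\<^bold>* \<lhd> ((\<ll> (?X \<otimes> X \<otimes> Z))\<dagger> \<cdot> cupz X Z \<cdot> \<ll> Z) \<cdot> \<alpha> (\<I>\<^bold>*) \<I> Z"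
    unfolding v [OF tensor_ob [OF assms Z]] using assms Z by (simp add: lw_comp)
  also have "(\<ll> (?X \<otimes> X \<otimes> Z))\<dagger> \<cdot> cupz X Z \<cdot> \<ll> Z = \<I> \<lhd> cupz X Z"
    using assms Z lw_dag_lunit' [of "cupz X Z" Z "\<ll> Z"] by simp
  also have "(\<alpha> ?X X Z)\<dagger> \<cdot> capz \<I> (?X \<otimes> X \<otimes> Z) \<cdot> \<I>\<^bold>* \<lhd> (\<I> \<lhd> cupz X Z) \<cdot> \<alpha> (\<I>\<^bold>*) \<I> Z = 
      (\<alpha> ?X X Z)\<dagger> \<cdot> cupz X Z \<cdot> capz \<I> Z \<cdot> \<alpha> (\<I>\<^bold>*) \<I> Z"
    using assms Z by (simp add: capz_natural')
  also have "\<dots> = (\<eta> X \<cdot> (\<eta> \<I>)\<dagger>) \<rhd> Z"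
    using assms Z by (simp add: act_comp act_cup)
  finally show "cpm_map C X (?X, \<eta> X) \<rhd> Z = (\<eta> X \<cdot> (\<eta> \<I>)\<dagger>) \<rhd> Z" .
qed (use assms in \<open>simp_all add: cpm_map_def\<close>)


text \<open>The bending of the input wire. Under the cap of \<open>A\<close>,
  \<open>conj_cap\<close> exchanges \<open>f\<dagger>\<close> for the conjugate of \<open>f\<close>,
  and \<open>dual_tensor_cap\<close> splits the cap of \<open>X \<otimes> B\<close>. The inner cap
  joins the two ancillas, which produces \<open>cpm_map\<close>, and \<open>k\<close>, here for
  \<open>h\<dagger> \<cdot> h\<close>, moves out by naturality.\<close>

lemma test_cap:
  assumes "X \<in> Ob C" "B \<in> Ob C" "Y \<in> Ob C" "f \<in> Arr C" "Cod C f = X \<otimes> B" "Dom C f = A"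
    and "k \<in> Arr C" "Dom C k = B \<otimes> Y" "Cod C k = B \<otimes> Y"
  shows "capz A Y \<cdot> A\<^bold>* \<lhd> (f\<dagger> \<rhd> Y \<cdot> (\<alpha> X B Y)\<dagger> \<cdot> X \<lhd> k \<cdot> \<alpha> X B Y \<cdot> f \<rhd> Y) =
    capz B Y \<cdot> B\<^bold>* \<lhd> k \<cdot> \<alpha> (B\<^bold>*) B Y \<cdot> cpm_map C B (X, f) \<rhd> Y \<cdot> (\<alpha> (A\<^bold>*) A Y)\<dagger>"
proof -
  have [simp]: "A \<in> Ob C" using assms by auto
  let ?E = "X \<otimes> B" let ?t = "dual_tensor C X B"
  let ?u = "?t \<cdot> conj_arr C f"
  have cc: "capz ?E Y \<cdot> conj_arr C f \<rhd> (?E \<otimes> Y) = capz A Y \<cdot> A\<^bold>* \<lhd> (f\<dagger> \<rhd> Y)"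
    using assms by (intro conj_cap) simp_all
  have "capz A Y \<cdot> A\<^bold>* \<lhd> (f\<dagger> \<rhd> Y \<cdot> (\<alpha> X B Y)\<dagger> \<cdot> X \<lhd> k \<cdot> \<alpha> X B Y \<cdot> f \<rhd> Y) =
    (capz A Y \<cdot> A\<^bold>* \<lhd> (f\<dagger> \<rhd> Y)) \<cdot> A\<^bold>* \<lhd> ((\<alpha> X B Y)\<dagger> \<cdot> X \<lhd> k \<cdot> \<alpha> X B Y \<cdot> f \<rhd> Y)"
    using assms by (simp add: lw_comp)
  also have "\<dots> = (capn X B Y \<cdot> B\<^bold>* \<lhd> X\<^bold>* \<lhd> \<alpha> X B Y \<cdot> \<alpha> (B\<^bold>*) (X\<^bold>*) (?E \<otimes> Y) \<cdot> ?t \<rhd> (?E \<otimes> Y)) \<cdot>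
     conj_arr C f \<rhd> (?E \<otimes> Y) \<cdot> A\<^bold>* \<lhd> ((\<alpha> X B Y)\<dagger> \<cdot> X \<lhd> k \<cdot> \<alpha> X B Y \<cdot> f \<rhd> Y)"
    unfolding cc [symmetric] dual_tensor_cap [OF assms(1-3) refl] using assms by simp
  also have "\<dots> = capn X B Y \<cdot> B\<^bold>* \<lhd> X\<^bold>* \<lhd> \<alpha> X B Y \<cdot> \<alpha> (B\<^bold>*) (X\<^bold>*) (?E \<otimes> Y) \<cdot> 
     (?u \<rhd> (?E \<otimes> Y) \<cdot> A\<^bold>* \<lhd> ((\<alpha> X B Y)\<dagger> \<cdot> X \<lhd> k \<cdot> \<alpha> X B Y \<cdot> f \<rhd> Y))"
    using assms by (simp add: act_comp)
  also have "\<dots> = capz B Y \<cdot> B\<^bold>* \<lhd> (capz X (B \<otimes> Y) \<cdot> X\<^bold>* \<lhd> X \<lhd> k) \<cdot> B\<^bold>* \<lhd> X\<^bold>* \<lhd> \<alpha> X B Y \<cdot> \<alpha> (B\<^bold>*) (X\<^bold>*) (?E \<otimes> Y) \<cdot> 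
     (B\<^bold>* \<otimes> X\<^bold>*) \<lhd> (f \<rhd> Y) \<cdot> ?u \<rhd> (A \<otimes> Y)"
    using assms by (subst act_lw) (simp_all add: lw_comp assoc_lw' capn_def)
  also have "\<dots> = capz B Y \<cdot> B\<^bold>* \<lhd> k \<cdot> B\<^bold>* \<lhd> (capz X (B \<otimes> Y) \<cdot> X\<^bold>* \<lhd> \<alpha> X B Y) \<cdot> \<alpha> (B\<^bold>*) (X\<^bold>*) (?E \<otimes> Y) \<cdot> 
     (B\<^bold>* \<otimes> X\<^bold>*) \<lhd> (f \<rhd> Y) \<cdot> ?u \<rhd> (A \<otimes> Y)"
    using assms by (subst capz_natural) (simp_all add: lw_comp)
  also have "\<dots> = capz B Y \<cdot> B\<^bold>* \<lhd> k \<cdot> \<alpha> (B\<^bold>*) B Y \<cdot> ancilla_cap C X B \<rhd> Y \<cdot> (?u \<boxtimes> f) \<rhd> Y \<cdot> (\<alpha> (A\<^bold>*) A Y)\<dagger>"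
    using assms by (simp add: act_ancilla_cap act_tensor)
  also have "ancilla_cap C X B \<rhd> Y \<cdot> (?u \<boxtimes> f) \<rhd> Y \<cdot> (\<alpha> (A\<^bold>*) A Y)\<dagger> = cpm_map C B (X, f) \<rhd> Y \<cdot> (\<alpha> (A\<^bold>*) A Y)\<dagger>"
    using assms by (simp add: cpm_map_def act_comp)
  finally show ?thesis .
qed

text \<open>Bending the input wire loses nothing: a cup and the dagger of \<open>snakez\<close>
  recover \<open>S\<close>.\<close>

lemma capz_lw_eqI:
  assumes "A \<in> Ob C" "Y \<in> Ob C" "S \<in> Arr C" "T \<in> Arr C" "Dom C S = A \<otimes> Y" "Cod C S = A \<otimes> Y" "Dom C T = A \<otimes> Y" "Cod C T = A \<otimes> Y"
    and eq: "capz A Y \<cdot> A\<^bold>* \<lhd> S = capz A Y \<cdot> A\<^bold>* \<lhd> T"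
  shows "S = T"
proof -
  have *: "S = A \<lhd> (capz A Y \<cdot> A\<^bold>* \<lhd> S) \<cdot> sw (A\<^bold>*) A (A \<otimes> Y) \<cdot> cupz A (A \<otimes> Y)"
    if "S \<in> Arr C" "Dom C S = A \<otimes> Y" "Cod C S = A \<otimes> Y" for S
  proof -
    have "A \<lhd> (capz A Y \<cdot> A\<^bold>* \<lhd> S) \<cdot> sw (A\<^bold>*) A (A \<otimes> Y) \<cdot> cupz A (A \<otimes> Y) =
      A \<lhd> capz A Y \<cdot> (A \<lhd> A\<^bold>* \<lhd> S \<cdot> sw (A\<^bold>*) A (A \<otimes> Y)) \<cdot> cupz A (A \<otimes> Y)"
      using assms(1,2) that by (simp add: lw_comp)
    also have "A \<lhd> A\<^bold>* \<lhd> S \<cdot> sw (A\<^bold>*) A (A \<otimes> Y) = sw (A\<^bold>*) A (A \<otimes> Y) \<cdot> A\<^bold>* \<lhd> A \<lhd> S"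
      using assms(1,2) that by (subst sw_lw_lw) simp_all
    also have "A \<lhd> capz A Y \<cdot> (sw (A\<^bold>*) A (A \<otimes> Y) \<cdot> A\<^bold>* \<lhd> A \<lhd> S) \<cdot> cupz A (A \<otimes> Y) =
       (A \<lhd> capz A Y \<cdot> sw (A\<^bold>*) A (A \<otimes> Y) \<cdot> cupz A (A \<otimes> Y)) \<cdot> S"
      using assms(1,2) that by (simp add: cupz_natural)
    also have "\<dots> = S"
      using assms(1,2) that arg_cong [OF snakez [OF assms(1,2)], of "Dag C"] by simp
    finally show ?thesis by simp
  qed
  show ?thesis using * [of S] * [of T] assms by simp
qed

lemma cpm_map_simps [simp]:
  assumes "X \<in> Ob C" "B \<in> Ob C" "f \<in> Arr C" "Cod C f = X \<otimes> B"
  shows "cpm_map C B (X, f) \<in> Arr C"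
    and "Dom C (cpm_map C B (X, f)) = (Dom C f)\<^bold>* \<otimes> Dom C f"
    and "Cod C (cpm_map C B (X, f)) = B\<^bold>* \<otimes> B"
  using assms by (simp_all add: cpm_map_def)

text \<open>The single test with \<open>h = \<epsilon> B\<close>, tensored with an arbitrary object, already determines \<open>cpm_map\<close>.\<close>

lemma kraus_rel_iff:
  assumes "A \<in> Ob C" "B \<in> Ob C"
  shows "kraus_rel C A B = {(p, q). p \<in> kraus C A B \<and> q \<in> kraus C A B \<and> cpm_map C B p = cpm_map C B q}"
proof -
  have test: "kraus_test C B Y h (X, f) = f\<dagger> \<rhd> Y \<cdot> (\<alpha> X B Y)\<dagger> \<cdot> X \<lhd> (h\<dagger> \<cdot> h) \<cdot> \<alpha> X B Y \<cdot> f \<rhd> Y" for X f Y h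
    by (simp add: kraus_test_def act_def lw_def)
  have "(\<forall>Y \<in> Ob C. \<forall>Z \<in> Ob C. \<forall>h \<in> hom C (B \<otimes> Y) Z. kraus_test C B Y h (X, f) = kraus_test C B Y h (X', g)) \<longleftrightarrow>
      cpm_map C B (X, f) = cpm_map C B (X', g)" 
    if k: "(X, f) \<in> kraus C A B" "(X', g) \<in> kraus C A B" for X f X' g
  proof
    have o [simp]: "X \<in> Ob C" "X' \<in> Ob C" "f \<in> Arr C" "g \<in> Arr C" "Dom C f = A" "Dom C g = A" "Cod C f = X \<otimes> B" "Cod C g = X' \<otimes> B"
      using k by (auto simp: kraus_def)
    assume eq: "cpm_map C B (X, f) = cpm_map C B (X', g)"
    show "\<forall>Y \<in> Ob C. \<forall>Z \<in> Ob C. \<forall>h \<in> hom C (B \<otimes> Y) Z. kraus_test C B Y h (X, f) = kraus_test C B Y h (X', g)"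
    proof (intro ballI)
      fix Y Z h assume Y: "Y \<in> Ob C" "Z \<in> Ob C" and h: "h \<in> hom C (B \<otimes> Y) Z"
      show "kraus_test C B Y h (X, f) = kraus_test C B Y h (X', g)"
      proof (rule capz_lw_eqI [of A Y])
        show "capz A Y \<cdot> A\<^bold>* \<lhd> kraus_test C B Y h (X, f) = capz A Y \<cdot> A\<^bold>* \<lhd> kraus_test C B Y h (X', g)"
          unfolding test using assms Y h test_cap [of X B Y f A "h\<dagger> \<cdot> h"] test_cap [of X' B Y g A "h\<dagger> \<cdot> h"] by (simp add: eq)
      qed (use assms Y h in \<open>simp_all add: test\<close>)
    qed
  next
    have o [simp]: "X \<in> Ob C" "X' \<in> Ob C" "f \<in> Arr C" "g \<in> Arr C" "Dom C f = A" "Dom C g = A" "Cod C f = X \<otimes> B" "Cod C g = X' \<otimes> B"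
      using k by (auto simp: kraus_def)
    assume eq: "\<forall>Y \<in> Ob C. \<forall>Z \<in> Ob C. \<forall>h \<in> hom C (B \<otimes> Y) Z. kraus_test C B Y h (X, f) = kraus_test C B Y h (X', g)"
    show "cpm_map C B (X, f) = cpm_map C B (X', g)"
    proof (rule act_eqI)
      fix Z assume Z: "Z \<in> Ob C"
      let ?W = "B \<otimes> Z"
      let ?Y = "B\<^bold>* \<otimes> ?W"
      \<comment> \<open>This is \<open>\<epsilon> B\<close> on the first two factors of
        \<open>B \<otimes> ?Y\<close>, with \<open>?W\<close> as spectator. The factor
        \<open>B\<close> of \<open>?W\<close> is where the output of the map reappears in
        \<open>*\<close>.\<close>
      let ?h = "capz B ?W \<cdot> sw B (B\<^bold>*) ?W"
      \<comment> \<open>Only \<open>h\<dagger> \<cdot> h\<close> occurs in a test. For this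
        \<open>h\<close> a snake cancels the dagger, so under the cap \<open>?h\<close> itself is
        available.\<close>
      have hh: "capz B ?Y \<cdot> B\<^bold>* \<lhd> (?h\<dagger> \<cdot> ?h) = B\<^bold>* \<lhd> ?h"
      proof -
        have "capz B ?Y \<cdot> B\<^bold>* \<lhd> (?h\<dagger> \<cdot> ?h) = (capz B ?Y \<cdot> B\<^bold>* \<lhd> (sw (B\<^bold>*) B ?W \<cdot> cupz B ?W)) \<cdot> B\<^bold>* \<lhd> ?h"
          using assms Z by (simp add: lw_comp)
        then show ?thesis using assms Z by (simp add: snakez_dag)
      qed
      \<comment> \<open>The cup prepares the tail so that \<open>?h\<close> contracts the output
        with its dual leg. The snake returns it on the other leg, whence \<open>c\<close> is
        recovered.\<close>
      have *: "\<alpha> (B\<^bold>*) B Z \<cdot> c \<rhd> Z = (B\<^bold>* \<lhd> ?h \<cdot> \<alpha> (B\<^bold>*) B ?Y \<cdot> c \<rhd> ?Y) \<cdot> (A\<^bold>* \<otimes> A) \<lhd> cupz B Z"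
        if "c \<in> Arr C" "Dom C c = A\<^bold>* \<otimes> A" "Cod C c = B\<^bold>* \<otimes> B" for c
      proof -
        have "(B\<^bold>* \<lhd> ?h \<cdot> \<alpha> (B\<^bold>*) B ?Y \<cdot> c \<rhd> ?Y) \<cdot> (A\<^bold>* \<otimes> A) \<lhd> cupz B Z = 
          B\<^bold>* \<lhd> (capz B ?W \<cdot> sw B (B\<^bold>*) ?W \<cdot> B \<lhd> cupz B Z) \<cdot> \<alpha> (B\<^bold>*) B Z \<cdot> c \<rhd> Z"
          using assms Z that by (simp add: act_lw assoc_lw' lw_comp)
        then show ?thesis using assms Z that by (simp add: snakez)
      qed
      have t: "kraus_test C B ?Y ?h (X, f) = kraus_test C B ?Y ?h (X', g)"
        using assms Z by (intro eq [rule_format, of ?Y ?W]) simp_all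
      have n: "B\<^bold>* \<lhd> ?h \<cdot> \<alpha> (B\<^bold>*) B ?Y \<cdot> cpm_map C B (X'', f') \<rhd> ?Y = (capz A ?Y \<cdot> A\<^bold>* \<lhd> kraus_test C B ?Y ?h (X'', f')) \<cdot> \<alpha> (A\<^bold>*) A ?Y"
        if "X'' \<in> Ob C" "f' \<in> Arr C" "Dom C f' = A" "Cod C f' = X'' \<otimes> B" for X'' f'
      proof -
        have "capz A ?Y \<cdot> A\<^bold>* \<lhd> kraus_test C B ?Y ?h (X'', f') = (capz B ?Y \<cdot> B\<^bold>* \<lhd> (?h\<dagger> \<cdot> ?h)) \<cdot> \<alpha> (B\<^bold>*) B ?Y \<cdot> cpm_map C B (X'', f') \<rhd> ?Y \<cdot> (\<alpha> (A\<^bold>*) A ?Y)\<dagger>"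
          unfolding test using assms Z that test_cap [of X'' B ?Y f' A "?h\<dagger> \<cdot> ?h"] by simp
        then show ?thesis unfolding hh using assms Z that by simp
      qed
      have "\<alpha> (B\<^bold>*) B Z \<cdot> cpm_map C B (X, f) \<rhd> Z = \<alpha> (B\<^bold>*) B Z \<cdot> cpm_map C B (X', g) \<rhd> Z"
        using assms * [of "cpm_map C B (X, f)"] * [of "cpm_map C B (X', g)"] n [of X f] n [of X' g] t by simp
      then have "(\<alpha> (B\<^bold>*) B Z)\<dagger> \<cdot> \<alpha> (B\<^bold>*) B Z \<cdot> cpm_map C B (X, f) \<rhd> Z = (\<alpha> (B\<^bold>*) B Z)\<dagger> \<cdot> \<alpha> (B\<^bold>*) B Z \<cdot> cpm_map C B (X', g) \<rhd> Z"
        by simp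
      then show "cpm_map C B (X, f) \<rhd> Z = cpm_map C B (X', g) \<rhd> Z"
        using assms Z by simp
    qed (use assms in simp_all)
  qed
  note eq = this
  show ?thesis unfolding kraus_rel_def
    by (rule Collect_cong) (simp only: split_paired_all prod.case eq cong: conj_cong)
qed

section \<open>Kraus composition and Kraus tensor under \<open>cpm_map\<close>\<close>

lemma cap_tensor:
  assumes "X \<in> Ob C" "Y \<in> Ob C" "W \<in> Ob C"
  shows "\<ll> W \<cdot> (\<eta> (X \<otimes> Y))\<dagger> \<rhd> W = \<ll> W \<cdot> (\<eta> X)\<dagger> \<rhd> W \<cdot> (X\<^bold>* \<otimes> X) \<lhd> (\<ll> W \<cdot> (\<eta> Y)\<dagger> \<rhd> W) \<cdot> \<alpha> (X\<^bold>* \<otimes> X) (Y\<^bold>* \<otimes> Y) W \<cdot> (ml X Y)\<dagger> \<rhd> W"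
proof -
  have "(\<eta> (X \<otimes> Y))\<dagger> \<cdot> ml X Y \<cdot> (ml X Y)\<dagger> = (\<ll> \<I> \<cdot> ((\<eta> X)\<dagger> \<boxtimes> (\<eta> Y)\<dagger>)) \<cdot> (ml X Y)\<dagger>"
    using assms by (simp flip: ml_cap)
  then have "(\<eta> (X \<otimes> Y))\<dagger> = \<ll> \<I> \<cdot> ((\<eta> X)\<dagger> \<boxtimes> (\<eta> Y)\<dagger>) \<cdot> (ml X Y)\<dagger>"
    using assms by simp
  then show ?thesis using assms by (simp add: act_comp lw_comp act_tensor act_lunit act_lw act_lw' lunit_natural'')
qed

text \<open>The ancilla of \<open>f\<close> may be discarded after \<open>g\<close> instead of
  before it, by interchange. Then both ancillas are discarded together by \<open>cap_tensor\<close>,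
  while \<open>1\<close> and \<open>2\<close> move the splitting maps to the left of the doubled
  arrows.\<close>

lemma cpm_map_comp:
  assumes "X \<in> Ob C" "Y \<in> Ob C" "B \<in> Ob C" "D \<in> Ob C" "f \<in> Arr C" "Cod C f = X \<otimes> B" "g \<in> Arr C" "Dom C g = B" "Cod C g = Y \<otimes> D"
  shows "cpm_map C D (kraus_comp C D (Y, g) (X, f)) = cpm_map C D (Y, g) \<cdot> cpm_map C B (X, f)"
proof -
  let ?M = "\<lambda>A. A\<^bold>* \<otimes> A"
  let ?r = "\<ll> (?M D) \<cdot> (\<eta> Y)\<dagger> \<rhd> ?M D"
  have 1: "?M X \<lhd> (ml Y D)\<dagger> \<cdot> (ml X (Y \<otimes> D))\<dagger> = \<alpha> (?M X) (?M Y) (?M D) \<cdot> (ml X Y)\<dagger> \<rhd> ?M D \<cdot> (ml (X \<otimes> Y) D)\<dagger> \<cdot> dbl ((\<alpha> X Y D)\<dagger>)"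
    using assms arg_cong [OF ml_assoc [of X Y D], of "\<lambda>x. \<alpha> (?M X) (?M Y) (?M D) \<cdot> Dag C x"] by simp
  have 2: "?M X \<lhd> dbl g \<cdot> (ml X B)\<dagger> = (ml X (Y \<otimes> D))\<dagger> \<cdot> dbl (X \<lhd> g)"
    using assms arg_cong [OF ml_natural [of "\<one> X" "g\<dagger>"], of "Dag C"] by (simp flip: lw_def)
  have "cpm_map C D (Y, g) \<cdot> cpm_map C B (X, f) = 
    (?r \<cdot> (ml Y D)\<dagger> \<cdot> dbl g) \<cdot> \<ll> (?M B) \<cdot> (\<eta> X)\<dagger> \<rhd> ?M B \<cdot> (ml X B)\<dagger> \<cdot> dbl f"
    using assms by (simp add: cpm_map_dbl)
  also have "\<dots> = \<ll> (?M D) \<cdot> \<I> \<lhd> (?r \<cdot> (ml Y D)\<dagger> \<cdot> dbl g) \<cdot> (\<eta> X)\<dagger> \<rhd> ?M B \<cdot> (ml X B)\<dagger> \<cdot> dbl f"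
    using assms by (simp add: lunit_natural'')
  also have "\<dots> = \<ll> (?M D) \<cdot> (\<eta> X)\<dagger> \<rhd> ?M D \<cdot> ?M X \<lhd> (?r \<cdot> (ml Y D)\<dagger> \<cdot> dbl g) \<cdot> (ml X B)\<dagger> \<cdot> dbl f"
    using assms by (simp add: act_lw')
  also have "\<dots> = \<ll> (?M D) \<cdot> (\<eta> X)\<dagger> \<rhd> ?M D \<cdot> ?M X \<lhd> ?r \<cdot> ?M X \<lhd> (ml Y D)\<dagger> \<cdot> (?M X \<lhd> dbl g \<cdot> (ml X B)\<dagger>) \<cdot> dbl f"
    using assms by (simp add: lw_comp)
  also have "\<dots> = \<ll> (?M D) \<cdot> (\<eta> X)\<dagger> \<rhd> ?M D \<cdot> ?M X \<lhd> ?r \<cdot> (?M X \<lhd> (ml Y D)\<dagger> \<cdot> (ml X (Y \<otimes> D))\<dagger>) \<cdot> dbl (X \<lhd> g) \<cdot> dbl f"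
    unfolding 2 using assms by simp
  also have "\<dots> = (\<ll> (?M D) \<cdot> (\<eta> X)\<dagger> \<rhd> ?M D \<cdot> ?M X \<lhd> ?r \<cdot> \<alpha> (?M X) (?M Y) (?M D) \<cdot> (ml X Y)\<dagger> \<rhd> ?M D) \<cdot> (ml (X \<otimes> Y) D)\<dagger> \<cdot> dbl ((\<alpha> X Y D)\<dagger> \<cdot> X \<lhd> g \<cdot> f)"
    unfolding 1 using assms by (simp add: dbl_comp)
  also have "\<dots> = (\<ll> (?M D) \<cdot> (\<eta> (X \<otimes> Y))\<dagger> \<rhd> ?M D) \<cdot> (ml (X \<otimes> Y) D)\<dagger> \<cdot> dbl ((\<alpha> X Y D)\<dagger> \<cdot> X \<lhd> g \<cdot> f)"
    using assms by (simp add: cap_tensor)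
  also have "\<dots> = cpm_map C D (kraus_comp C D (Y, g) (X, f))"
    using assms by (simp add: kraus_comp_def cpm_map_dbl flip: lw_def)
  finally show ?thesis by simp
qed

lemma ml_sw:
  assumes "B \<in> Ob C" "Y \<in> Ob C" "D \<in> Ob C"
  shows "dbl (sw B Y D) \<cdot> ml B (Y \<otimes> D) \<cdot> (B\<^bold>* \<otimes> B) \<lhd> ml Y D = 
    ml Y (B \<otimes> D) \<cdot> (Y\<^bold>* \<otimes> Y) \<lhd> ml B D \<cdot> sw (B\<^bold>* \<otimes> B) (Y\<^bold>* \<otimes> Y) (D\<^bold>* \<otimes> D)"
proof -
  let ?M = "\<lambda>A. A\<^bold>* \<otimes> A"
  have a: "ml P (Q \<otimes> R) \<cdot> ?M P \<lhd> ml Q R = dbl (\<alpha> P Q R) \<cdot> ml (P \<otimes> Q) R \<cdot> ml P Q \<rhd> ?M R \<cdot> (\<alpha> (?M P) (?M Q) (?M R))\<dagger>"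
    if "P \<in> Ob C" "Q \<in> Ob C" "R \<in> Ob C" for P Q R
    using that arg_cong [OF ml_assoc [of P Q R], of "\<lambda>x. x \<cdot> (\<alpha> (?M P) (?M Q) (?M R))\<dagger>"] by simp
  have n: "dbl (\<sigma> B Y \<rhd> D) \<cdot> ml (B \<otimes> Y) D = ml (Y \<otimes> B) D \<cdot> dbl (\<sigma> B Y) \<rhd> ?M D"
    using assms ml_natural [of "\<sigma> B Y" "\<one> D"] by (simp flip: act_def)
  have s: "dbl (\<sigma> B Y) \<rhd> ?M D \<cdot> ml B Y \<rhd> ?M D = ml Y B \<rhd> ?M D \<cdot> \<sigma> (?M B) (?M Y) \<rhd> ?M D"
    using assms by (simp add: ml_symm flip: act_comp)
  have "dbl (sw B Y D) \<cdot> ml B (Y \<otimes> D) \<cdot> ?M B \<lhd> ml Y D = 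
    dbl (\<alpha> Y B D) \<cdot> (dbl (\<sigma> B Y \<rhd> D) \<cdot> ml (B \<otimes> Y) D) \<cdot> ml B Y \<rhd> ?M D \<cdot> (\<alpha> (?M B) (?M Y) (?M D))\<dagger>"
    using assms reassoc [OF dbl_comp [of "\<alpha> B Y D" "(\<alpha> B Y D)\<dagger>", symmetric], of "ml (B \<otimes> Y) D \<cdot> ml B Y \<rhd> ?M D \<cdot> (\<alpha> (?M B) (?M Y) (?M D))\<dagger>"]
    by (simp add: sw_def dbl_comp a)
  also have "\<dots> = dbl (\<alpha> Y B D) \<cdot> ml (Y \<otimes> B) D \<cdot> (dbl (\<sigma> B Y) \<rhd> ?M D \<cdot> ml B Y \<rhd> ?M D) \<cdot> (\<alpha> (?M B) (?M Y) (?M D))\<dagger>"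
    unfolding n using assms by simp
  also have "\<dots> = (dbl (\<alpha> Y B D) \<cdot> ml (Y \<otimes> B) D \<cdot> ml Y B \<rhd> ?M D \<cdot> (\<alpha> (?M Y) (?M B) (?M D))\<dagger>) \<cdot> sw (?M B) (?M Y) (?M D)"
    unfolding s using assms by (simp add: sw_def)
  finally show ?thesis using assms by (simp flip: a)
qed

lemma middle_swap_sw: "middle_swap C X B Y D = (\<alpha> X Y (B \<otimes> D))\<dagger> \<cdot> X \<lhd> sw B Y D \<cdot> \<alpha> X B (Y \<otimes> D)"
  by (simp add: middle_swap_def lw_def sw_def act_def)

lemma middle_swap_simps [simp]:
  "X \<in> Ob C \<Longrightarrow> B \<in> Ob C \<Longrightarrow> Y \<in> Ob C \<Longrightarrow> D \<in> Ob C \<Longrightarrow> middle_swap C X B Y D \<in> Arr C"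
  "Dom C (middle_swap C X B Y D) = (X \<otimes> B) \<otimes> (Y \<otimes> D)"
  "Cod C (middle_swap C X B Y D) = (X \<otimes> Y) \<otimes> (B \<otimes> D)"
  by (simp_all add: middle_swap_sw)

lemma middle_swap_natural:
  assumes "p \<in> Arr C" "a \<in> Arr C" "q \<in> Arr C" "b \<in> Arr C"
  shows "middle_swap C (Cod C p) (Cod C a) (Cod C q) (Cod C b) \<cdot> ((p \<boxtimes> a) \<boxtimes> (q \<boxtimes> b)) =
    ((p \<boxtimes> q) \<boxtimes> (a \<boxtimes> b)) \<cdot> middle_swap C (Dom C p) (Dom C a) (Dom C q) (Dom C b)"
proof -
  let ?a = "\<alpha> (Cod C p) (Cod C q) (Cod C a \<otimes> Cod C b)" and ?b = "\<alpha> (Dom C p) (Dom C q) (Dom C a \<otimes> Dom C b)"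
  have 1: "?a\<dagger> \<cdot> (p \<boxtimes> (q \<boxtimes> (a \<boxtimes> b))) = ((p \<boxtimes> q) \<boxtimes> (a \<boxtimes> b)) \<cdot> ?b\<dagger>"
    using assms arg_cong [OF assoc_natural' [of p q "a \<boxtimes> b"], of "\<lambda>x. ?a\<dagger> \<cdot> x \<cdot> ?b\<dagger>"] by simp
  have "middle_swap C (Cod C p) (Cod C a) (Cod C q) (Cod C b) \<cdot> ((p \<boxtimes> a) \<boxtimes> (q \<boxtimes> b)) =
    ?a\<dagger> \<cdot> Cod C p \<lhd> sw (Cod C a) (Cod C q) (Cod C b) \<cdot> (p \<boxtimes> (a \<boxtimes> (q \<boxtimes> b))) \<cdot> \<alpha> (Dom C p) (Dom C a) (Dom C q \<otimes> Dom C b)"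
    using assms assoc_natural' [of p a "q \<boxtimes> b"] by (simp add: middle_swap_sw)
  also have "\<dots> = (?a\<dagger> \<cdot> (p \<boxtimes> (q \<boxtimes> (a \<boxtimes> b)))) \<cdot> Dom C p \<lhd> sw (Dom C a) (Dom C q) (Dom C b) \<cdot> \<alpha> (Dom C p) (Dom C a) (Dom C q \<otimes> Dom C b)"
    using assms by (simp add: lw_def tensor_comp' sw_tensor)
  finally show ?thesis unfolding 1 using assms by (simp add: middle_swap_sw)
qed

lemma middle_swap_unit:
  assumes "B \<in> Ob C" "D \<in> Ob C"
  shows "\<ll> (B \<otimes> D) \<cdot> \<ll> \<I> \<rhd> (B \<otimes> D) \<cdot> middle_swap C \<I> B \<I> D = \<ll> B \<boxtimes> \<ll> D"
proof (rule act_eqI)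
  fix Z assume "Z \<in> Ob C"
  then show "(\<ll> (B \<otimes> D) \<cdot> \<ll> \<I> \<rhd> (B \<otimes> D) \<cdot> middle_swap C \<I> B \<I> D) \<rhd> Z = (\<ll> B \<boxtimes> \<ll> D) \<rhd> Z"
    using assms by (simp add: middle_swap_sw whisker act_sw act_dag_assoc)
qed (use assms in simp_all)

text \<open>The middle exchange consists of associators and one symmetry, and \<open>ml\<close> is
  compatible with these.\<close>

lemma ml_middle_swap:
  assumes "X \<in> Ob C" "B \<in> Ob C" "Y \<in> Ob C" "D \<in> Ob C"
  shows "dbl (middle_swap C X B Y D) \<cdot> ml (X \<otimes> B) (Y \<otimes> D) \<cdot> (ml X B \<boxtimes> ml Y D) =
    ml (X \<otimes> Y) (B \<otimes> D) \<cdot> (ml X Y \<boxtimes> ml B D) \<cdot> middle_swap C (X\<^bold>* \<otimes> X) (B\<^bold>* \<otimes> B) (Y\<^bold>* \<otimes> Y) (D\<^bold>* \<otimes> D)"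
proof -
  let ?M = "\<lambda>A. A\<^bold>* \<otimes> A"
  have t: "ml X B \<boxtimes> ml Y D = ml X B \<rhd> ?M (Y \<otimes> D) \<cdot> (?M X \<otimes> ?M B) \<lhd> ml Y D"
    "ml X Y \<boxtimes> ml B D = ml X Y \<rhd> ?M (B \<otimes> D) \<cdot> (?M X \<otimes> ?M Y) \<lhd> ml B D"
    using assms by (simp_all add: tensor_split act_lw)
  have n: "dbl (X \<lhd> sw B Y D) \<cdot> ml X (B \<otimes> Y \<otimes> D) = ml X (Y \<otimes> B \<otimes> D) \<cdot> ?M X \<lhd> dbl (sw B Y D)"
    using assms ml_natural [of "\<one> X" "sw B Y D"] by (simp flip: lw_def)
  have e: "dbl ((\<alpha> X Y (B \<otimes> D))\<dagger>) \<cdot> ml X (Y \<otimes> B \<otimes> D) \<cdot> ?M X \<lhd> ml Y (B \<otimes> D) = 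
      ml (X \<otimes> Y) (B \<otimes> D) \<cdot> ml X Y \<rhd> ?M (B \<otimes> D) \<cdot> (\<alpha> (?M X) (?M Y) (?M (B \<otimes> D)))\<dagger>"
  proof -
    let ?w = "\<alpha> X Y (B \<otimes> D)" let ?W = "\<alpha> (?M X) (?M Y) (?M (B \<otimes> D))"
    have "dbl (?w\<dagger>) \<cdot> (dbl ?w \<cdot> ml (X \<otimes> Y) (B \<otimes> D) \<cdot> ml X Y \<rhd> ?M (B \<otimes> D)) \<cdot> ?W\<dagger> =
      dbl (?w\<dagger>) \<cdot> (ml X (Y \<otimes> B \<otimes> D) \<cdot> ?M X \<lhd> ml Y (B \<otimes> D) \<cdot> ?W) \<cdot> ?W\<dagger>"
      using assms by (simp only: ml_assoc tensor_ob)
    moreover have "dbl (?w\<dagger>) \<cdot> dbl ?w \<cdot> k = k" if "k \<in> Arr C" "Cod C k = ?M ((X \<otimes> Y) \<otimes> B \<otimes> D)" for k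
      using assms that reassoc [OF dbl_comp [of ?w "?w\<dagger>", symmetric], of k] by simp
    ultimately show ?thesis using assms by simp
  qed
  have "dbl (middle_swap C X B Y D) \<cdot> ml (X \<otimes> B) (Y \<otimes> D) \<cdot> (ml X B \<boxtimes> ml Y D) = dbl ((\<alpha> X Y (B \<otimes> D))\<dagger>) \<cdot> dbl (X \<lhd> sw B Y D) \<cdot> 
    (dbl (\<alpha> X B (Y \<otimes> D)) \<cdot> ml (X \<otimes> B) (Y \<otimes> D) \<cdot> ml X B \<rhd> ?M (Y \<otimes> D)) \<cdot> (?M X \<otimes> ?M B) \<lhd> ml Y D"
    using assms by (simp add: middle_swap_sw dbl_comp t)
  also have "\<dots> = dbl ((\<alpha> X Y (B \<otimes> D))\<dagger>) \<cdot> (dbl (X \<lhd> sw B Y D) \<cdot> ml X (B \<otimes> Y \<otimes> D)) \<cdot> ?M X \<lhd> (ml B (Y \<otimes> D) \<cdot> ?M B \<lhd> ml Y D) \<cdot> \<alpha> (?M X) (?M B) (?M Y \<otimes> ?M D)"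
    unfolding ml_assoc [OF assms(1,2) tensor_ob [OF assms(3,4)]] using assms by (simp add: assoc_lw lw_comp)
  also have "\<dots> = dbl ((\<alpha> X Y (B \<otimes> D))\<dagger>) \<cdot> ml X (Y \<otimes> B \<otimes> D) \<cdot> ?M X \<lhd> (dbl (sw B Y D) \<cdot> ml B (Y \<otimes> D) \<cdot> ?M B \<lhd> ml Y D) \<cdot> \<alpha> (?M X) (?M B) (?M Y \<otimes> ?M D)"
    unfolding n using assms by (simp add: lw_comp)
  also have "\<dots> = (dbl ((\<alpha> X Y (B \<otimes> D))\<dagger>) \<cdot> ml X (Y \<otimes> B \<otimes> D) \<cdot> ?M X \<lhd> ml Y (B \<otimes> D)) \<cdot> ?M X \<lhd> (?M Y \<lhd> ml B D \<cdot> sw (?M B) (?M Y) (?M D)) \<cdot> \<alpha> (?M X) (?M B) (?M Y \<otimes> ?M D)"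
    unfolding ml_sw [OF assms(2-4)] using assms by (simp add: lw_comp)
  also have "\<dots> = ml (X \<otimes> Y) (B \<otimes> D) \<cdot> (ml X Y \<boxtimes> ml B D) \<cdot> middle_swap C (?M X) (?M B) (?M Y) (?M D)"
    unfolding e using assms by (simp add: t middle_swap_sw lw_dag_assoc' lw_comp)
  finally show ?thesis .
qed

text \<open>After \<open>ml_middle_swap\<close> the doubled ancillas stand together. By
  \<open>ml_cap\<close> they are discarded independently, and naturality lets this happen before the
  exchange, which then involves only units and disappears.\<close>

lemma cpm_map_tensor:
  assumes "X \<in> Ob C" "Y \<in> Ob C" "B \<in> Ob C" "D \<in> Ob C" "f \<in> Arr C" "Cod C f = X \<otimes> B" "g \<in> Arr C" "Cod C g = Y \<otimes> D"
  shows "cpm_map C (B \<otimes> D) (kraus_tensor C B D (X, f) (Y, g)) = 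
    ml B D \<cdot> (cpm_map C B (X, f) \<boxtimes> cpm_map C D (Y, g)) \<cdot> (ml (Dom C f) (Dom C g))\<dagger>"
proof -
  let ?M = "\<lambda>A. A\<^bold>* \<otimes> A"
  let ?s = "ml (Dom C f) (Dom C g)"
  let ?F = "(ml X B)\<dagger> \<cdot> dbl f" and ?G = "(ml Y D)\<dagger> \<cdot> dbl g"
  have 1: "dbl (f \<boxtimes> g) = ml (X \<otimes> B) (Y \<otimes> D) \<cdot> (ml X B \<boxtimes> ml Y D) \<cdot> (?F \<boxtimes> ?G) \<cdot> ?s\<dagger>"
  proof -
    have "dbl (f \<boxtimes> g) \<cdot> ?s \<cdot> ?s\<dagger> = ml (X \<otimes> B) (Y \<otimes> D) \<cdot> (dbl f \<boxtimes> dbl g) \<cdot> ?s\<dagger>"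
      using assms arg_cong [OF ml_natural [of f g], of "\<lambda>x. x \<cdot> ?s\<dagger>"] by simp
    moreover have "ml X B \<cdot> ?F = dbl f" "ml Y D \<cdot> ?G = dbl g"
      using assms by (simp_all flip: comp_assoc')
    ultimately show ?thesis using assms by (simp add: tensor_comp')
  qed
  have c: "(\<eta> (X \<otimes> Y))\<dagger> \<rhd> ?M (B \<otimes> D) \<cdot> (ml X Y \<boxtimes> ml B D) = \<I> \<lhd> ml B D \<cdot> \<ll> \<I> \<rhd> (?M B \<otimes> ?M D) \<cdot> (((\<eta> X)\<dagger> \<boxtimes> (\<eta> Y)\<dagger>) \<boxtimes> (\<one> (?M B) \<boxtimes> \<one> (?M D)))"
    using assms ml_cap [of X Y] by (simp add: act_def lw_def tensor_comp')
  have m: "(((\<eta> X)\<dagger> \<boxtimes> (\<eta> Y)\<dagger>) \<boxtimes> (\<one> (?M B) \<boxtimes> \<one> (?M D))) \<cdot> middle_swap C (?M X) (?M B) (?M Y) (?M D) =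
      middle_swap C \<I> (?M B) \<I> (?M D) \<cdot> (((\<eta> X)\<dagger> \<rhd> ?M B) \<boxtimes> ((\<eta> Y)\<dagger> \<rhd> ?M D))"
    using assms middle_swap_natural [of "(\<eta> X)\<dagger>" "\<one> (?M B)" "(\<eta> Y)\<dagger>" "\<one> (?M D)"] by (simp add: act_def)
  have "cpm_map C (B \<otimes> D) (kraus_tensor C B D (X, f) (Y, g)) =
    \<ll> (?M (B \<otimes> D)) \<cdot> (\<eta> (X \<otimes> Y))\<dagger> \<rhd> ?M (B \<otimes> D) \<cdot> (ml (X \<otimes> Y) (B \<otimes> D))\<dagger> \<cdot> 
     (dbl (middle_swap C X B Y D) \<cdot> ml (X \<otimes> B) (Y \<otimes> D) \<cdot> (ml X B \<boxtimes> ml Y D)) \<cdot> (?F \<boxtimes> ?G) \<cdot> ?s\<dagger>"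
    using assms by (simp add: kraus_tensor_def cpm_map_dbl dbl_comp 1)
  also have "\<dots> = \<ll> (?M (B \<otimes> D)) \<cdot> (\<eta> (X \<otimes> Y))\<dagger> \<rhd> ?M (B \<otimes> D) \<cdot> 
     (ml X Y \<boxtimes> ml B D) \<cdot> middle_swap C (?M X) (?M B) (?M Y) (?M D) \<cdot> (?F \<boxtimes> ?G) \<cdot> ?s\<dagger>"
    unfolding ml_middle_swap [OF assms(1,3,2,4)]
    using assms reassoc [OF ml_simps(2), of "X \<otimes> Y" "B \<otimes> D" "(ml X Y \<boxtimes> ml B D) \<cdot> middle_swap C (?M X) (?M B) (?M Y) (?M D) \<cdot> (?F \<boxtimes> ?G) \<cdot> ?s\<dagger>"] by simp
  also have "\<dots> = \<ll> (?M (B \<otimes> D)) \<cdot> \<I> \<lhd> ml B D \<cdot> \<ll> \<I> \<rhd> (?M B \<otimes> ?M D) \<cdot> 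
     ((((\<eta> X)\<dagger> \<boxtimes> (\<eta> Y)\<dagger>) \<boxtimes> (\<one> (?M B) \<boxtimes> \<one> (?M D))) \<cdot> middle_swap C (?M X) (?M B) (?M Y) (?M D)) \<cdot> (?F \<boxtimes> ?G) \<cdot> ?s\<dagger>"
    using assms reassoc [OF c, of "middle_swap C (?M X) (?M B) (?M Y) (?M D) \<cdot> (?F \<boxtimes> ?G) \<cdot> ?s\<dagger>"] by simp
  also have "\<dots> = ml B D \<cdot> (\<ll> (?M B \<otimes> ?M D) \<cdot> \<ll> \<I> \<rhd> (?M B \<otimes> ?M D) \<cdot> middle_swap C \<I> (?M B) \<I> (?M D)) \<cdot> 
     (((\<eta> X)\<dagger> \<rhd> ?M B) \<boxtimes> ((\<eta> Y)\<dagger> \<rhd> ?M D)) \<cdot> (?F \<boxtimes> ?G) \<cdot> ?s\<dagger>"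
    unfolding m using assms by (simp add: lunit_natural'')
  also have "\<dots> = ml B D \<cdot> (cpm_map C B (X, f) \<boxtimes> cpm_map C D (Y, g)) \<cdot> ?s\<dagger>"
    using assms by (simp add: middle_swap_unit cpm_map_dbl tensor_comp')
  finally show ?thesis .
qed

text \<open>Discarding the ancilla \<open>\<I>\<close> undoes its introduction, by the dagger of the
  unit law \<open>ml_lunit\<close>.\<close>

lemma cpm_map_pure:
  assumes "c \<in> Arr C" "Cod C c = B"
  shows "cpm_map C B (\<I>, (\<ll> B)\<dagger> \<cdot> c) = dbl c"
proof -
  have [simp]: "B \<in> Ob C" using assms by auto
  let ?M = "B\<^bold>* \<otimes> B"
  have "(\<eta> \<I>)\<dagger> \<rhd> ?M \<cdot> (ml \<I> B)\<dagger> \<cdot> dbl ((\<ll> B)\<dagger>) = (\<ll> ?M)\<dagger>"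
    using arg_cong [OF ml_lunit [of B], of "Dag C"] by simp
  from reassoc [OF this, of "ml \<I> B"] arg_cong [OF this, of "\<lambda>x. \<ll> ?M \<cdot> x \<cdot> dbl c"]
  show ?thesis using assms by (simp add: cpm_map_dbl dbl_comp)
qed


section \<open>CPM is dagger compact\<close>

definition cpms :: "'o \<Rightarrow> 'o \<Rightarrow> 'm set" where
  "cpms A B = {cpm_map C B p | p. p \<in> kraus C A B}"

lemma cpmsE:
  assumes "\<phi> \<in> cpms A B"
  obtains X f where "X \<in> Ob C" "f \<in> Arr C" "Dom C f = A" "Cod C f = X \<otimes> B" "\<phi> = cpm_map C B (X, f)"
  using assms by (auto simp: cpms_def kraus_def)

lemma cpmsI: "X \<in> Ob C \<Longrightarrow> f \<in> Arr C \<Longrightarrow> Dom C f = A \<Longrightarrow> Cod C f = X \<otimes> B \<Longrightarrow> cpm_map C B (X, f) \<in> cpms A B"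
  by (auto simp: cpms_def kraus_def)

lemma cpms_simps [simp]:
  assumes "\<phi> \<in> cpms A B" "B \<in> Ob C"
  shows "\<phi> \<in> Arr C" "Dom C \<phi> = A\<^bold>* \<otimes> A" "Cod C \<phi> = B\<^bold>* \<otimes> B"
  using assms by (auto elim!: cpmsE)

lemma cpms_comp:
  assumes "\<phi> \<in> cpms A B" "\<psi> \<in> cpms B D" "B \<in> Ob C" "D \<in> Ob C"
  shows "\<psi> \<cdot> \<phi> \<in> cpms A D"
proof -
  from assms(1) obtain X f where f: "X \<in> Ob C" "f \<in> Arr C" "Dom C f = A" "Cod C f = X \<otimes> B" "\<phi> = cpm_map C B (X, f)"
    by (rule cpmsE)
  from assms(2) obtain Y g where g: "Y \<in> Ob C" "g \<in> Arr C" "Dom C g = B" "Cod C g = Y \<otimes> D" "\<psi> = cpm_map C D (Y, g)"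
    by (rule cpmsE)
  have "\<psi> \<cdot> \<phi> = cpm_map C D (kraus_comp C D (Y, g) (X, f))"
    using f g assms by (simp add: cpm_map_comp)
  then show ?thesis using f g assms by (simp add: kraus_comp_def cpmsI)
qed

lemma cpms_tensor:
  assumes "\<phi> \<in> cpms A B" "\<psi> \<in> cpms A' B'" "B \<in> Ob C" "B' \<in> Ob C"
  shows "ml B B' \<cdot> (\<phi> \<boxtimes> \<psi>) \<cdot> (ml A A')\<dagger> \<in> cpms (A \<otimes> A') (B \<otimes> B')"
proof -
  from assms(1) obtain X f where f: "X \<in> Ob C" "f \<in> Arr C" "Dom C f = A" "Cod C f = X \<otimes> B" "\<phi> = cpm_map C B (X, f)"
    by (rule cpmsE)
  from assms(2) obtain Y g where g: "Y \<in> Ob C" "g \<in> Arr C" "Dom C g = A'" "Cod C g = Y \<otimes> B'" "\<psi> = cpm_map C B' (Y, g)"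
    by (rule cpmsE)
  have "ml B B' \<cdot> (\<phi> \<boxtimes> \<psi>) \<cdot> (ml A A')\<dagger> = cpm_map C (B \<otimes> B') (kraus_tensor C B B' (X, f) (Y, g))"
    using f g assms by (simp add: cpm_map_tensor)
  then show ?thesis using f g assms by (simp add: kraus_tensor_def cpmsI)
qed

lemma cpms_dbl:
  assumes "c \<in> Arr C"
  shows "dbl c \<in> cpms (Dom C c) (Cod C c)"
  using assms cpmsI [of \<I> "(\<ll> (Cod C c))\<dagger> \<cdot> c" "Dom C c" "Cod C c"] by (simp add: cpm_map_pure)

lemma ml_unit_dag:
  assumes "B \<in> Ob C"
  shows "(\<eta> \<I>)\<dagger> \<rhd> (B\<^bold>* \<otimes> B) \<cdot> (ml \<I> B)\<dagger> \<cdot> dbl ((\<ll> B)\<dagger>) = (\<ll> (B\<^bold>* \<otimes> B))\<dagger>"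
  using assms arg_cong [OF ml_lunit [of B], of "Dag C"] by simp

text \<open>The dagger of a completely positive map applies \<open>f\<^sup>\<dagger>\<close> with the maximally mixed state on the ancilla.\<close>

lemma cpms_dag:
  assumes "\<phi> \<in> cpms A B" "B \<in> Ob C"
  shows "\<phi>\<dagger> \<in> cpms B A"
proof -
  let ?M = "\<lambda>A. A\<^bold>* \<otimes> A"
  from assms(1) obtain X f where f: "X \<in> Ob C" "f \<in> Arr C" "Dom C f = A" "Cod C f = X \<otimes> B" "\<phi> = cpm_map C B (X, f)"
    by (rule cpmsE)
  have A [simp]: "A \<in> Ob C" using f by auto
  let ?e = "\<eta> X \<cdot> (\<eta> \<I>)\<dagger>"
  \<comment> \<open>By \<open>cpm_map_cup\<close> this is the map with Kraus morphism
    \<open>\<eta> X\<close>. Its factor \<open>(\<eta> \<I>)\<dagger>\<close> is absorbed through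
    \<open>ml_unit_dag\<close> at the end.\<close>
  have "?e \<in> cpms \<I> X" using f cpmsI [of "X\<^bold>*" "\<eta> X" \<I> X] by (simp add: cpm_map_cup)
  then have "ml X B \<cdot> (?e \<boxtimes> \<one> (?M B)) \<cdot> (ml \<I> B)\<dagger> \<in> cpms (\<I> \<otimes> B) (X \<otimes> B)"
    using f assms cpms_dbl [of "\<one> B"] by (intro cpms_tensor) simp_all
  moreover have "dbl ((\<ll> B)\<dagger>) \<in> cpms B (\<I> \<otimes> B)" "dbl (f\<dagger>) \<in> cpms (X \<otimes> B) A"
    using assms f cpms_dbl [of "(\<ll> B)\<dagger>"] cpms_dbl [of "f\<dagger>"] by simp_all
  ultimately have "dbl (f\<dagger>) \<cdot> (ml X B \<cdot> (?e \<boxtimes> \<one> (?M B)) \<cdot> (ml \<I> B)\<dagger>) \<cdot> dbl ((\<ll> B)\<dagger>) \<in> cpms B A"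
    using assms f by (intro cpms_comp [of _ B "X \<otimes> B"] cpms_comp [of _ B "\<I> \<otimes> B"]) simp_all
  also have "dbl (f\<dagger>) \<cdot> (ml X B \<cdot> (?e \<boxtimes> \<one> (?M B)) \<cdot> (ml \<I> B)\<dagger>) \<cdot> dbl ((\<ll> B)\<dagger>) = 
    dbl (f\<dagger>) \<cdot> ml X B \<cdot> \<eta> X \<rhd> ?M B \<cdot> ((\<eta> \<I>)\<dagger> \<rhd> ?M B \<cdot> (ml \<I> B)\<dagger> \<cdot> dbl ((\<ll> B)\<dagger>))"
    using assms f by (simp add: act_comp flip: act_def)
  also have "\<dots> = \<phi>\<dagger>" 
    unfolding ml_unit_dag [OF assms(2)] using assms f by (simp add: cpm_map_dbl)
  finally show ?thesis .
qed

section \<open>The operations of CPM in terms of \<open>ml\<close> and \<open>dbl\<close>\<close>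

abbreviation (input) K where "K \<equiv> CPM C"

text \<open>The description in \<open>CPM\<close> is unique because the value in
  \<open>cpm_map_tensor\<close> depends on the Kraus morphisms only through their maps.\<close>

lemma CPM_tensor:
  assumes "\<phi> \<in> cpms A B" "\<psi> \<in> cpms A' B'" "B \<in> Ob C" "B' \<in> Ob C"
  shows "TenA K (A, B, \<phi>) (A', B', \<psi>) = (A \<otimes> A', B \<otimes> B', ml B B' \<cdot> (\<phi> \<boxtimes> \<psi>) \<cdot> (ml A A')\<dagger>)"
proof -
  have u: "cpm_map C (B \<otimes> B') (kraus_tensor C B B' p q) = ml B B' \<cdot> (\<phi> \<boxtimes> \<psi>) \<cdot> (ml A A')\<dagger>"
    if "p \<in> kraus C A B" "q \<in> kraus C A' B'" "\<phi> = cpm_map C B p" "\<psi> = cpm_map C B' q" for p q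
    using that assms by (cases p, cases q) (auto simp: kraus_def cpm_map_tensor)
  obtain p q where "p \<in> kraus C A B" "q \<in> kraus C A' B'" "\<phi> = cpm_map C B p" "\<psi> = cpm_map C B' q"
    using assms by (auto simp: cpms_def)
  then have "(THE \<omega>. \<exists>p \<in> kraus C A B. \<exists>q \<in> kraus C A' B'. \<phi> = cpm_map C B p \<and> \<psi> = cpm_map C B' q \<and>
        \<omega> = cpm_map C (B \<otimes> B') (kraus_tensor C B B' p q)) = ml B B' \<cdot> (\<phi> \<boxtimes> \<psi>) \<cdot> (ml A A')\<dagger>"
    by - (rule the_equality, metis u, metis u)
  then show ?thesis by (simp add: CPM_def)
qed

lemma CPM_simps [simp]:
  "Ob K = Ob C" "Arr K = {(A, B, \<phi>). A \<in> Ob C \<and> B \<in> Ob C \<and> \<phi> \<in> cpms A B}"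
  "Dom K (A, B, \<phi>) = A" "Cod K (A, B, \<phi>) = B" "Id K A = (A, A, \<one> (A\<^bold>* \<otimes> A))"
  "Comp K (B', D, \<psi>) (A, B, \<phi>) = (A, D, \<psi> \<cdot> \<phi>)"
  "Unit K = \<I>" "TenO K = TenO C"
  "Assoc K A B D = ((A \<otimes> B) \<otimes> D, A \<otimes> (B \<otimes> D), dbl (\<alpha> A B D))"
  "Lunit K A = (\<I> \<otimes> A, A, dbl (\<ll> A))" "Runit K A = (A \<otimes> \<I>, A, dbl (\<rho> A))"
  "Symm K A B = (A \<otimes> B, B \<otimes> A, dbl (\<sigma> A B))"
  "Dag K (A, B, \<phi>) = (B, A, \<phi>\<dagger>)" "Dual K = Dual C" "Cup K A = (\<I>, A\<^bold>* \<otimes> A, dbl (\<eta> A))"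
  by (auto simp: CPM_def cpms_def doubled_def dbl_def)

lemma hom_CPM: "f \<in> hom K A B \<longleftrightarrow> (\<exists>\<phi>. f = (A, B, \<phi>) \<and> A \<in> Ob C \<and> B \<in> Ob C \<and> \<phi> \<in> cpms A B)"
  by (cases f) (auto simp: hom_def)

lemma ml_dag_natural:
  assumes "f \<in> Arr C" "g \<in> Arr C"
  shows "(ml (Cod C f) (Cod C g))\<dagger> \<cdot> dbl (f \<boxtimes> g) = (dbl f \<boxtimes> dbl g) \<cdot> (ml (Dom C f) (Dom C g))\<dagger>"
  using arg_cong [OF ml_natural [of "f\<dagger>" "g\<dagger>"], of "Dag C"] assms by simp

lemma dbl_tensor:
  assumes "f \<in> Arr C" "g \<in> Arr C"
  shows "TenA K (Dom C f, Cod C f, dbl f) (Dom C g, Cod C g, dbl g) = (Dom C (f \<boxtimes> g), Cod C (f \<boxtimes> g), dbl (f \<boxtimes> g))"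
proof -
  have "ml (Cod C f) (Cod C g) \<cdot> (ml (Cod C f) (Cod C g))\<dagger> \<cdot> dbl (f \<boxtimes> g) = dbl (f \<boxtimes> g)"
    using assms reassoc [OF ml_simps(3), of "Cod C f" "Cod C g" "dbl (f \<boxtimes> g)"] by simp
  then show ?thesis using assms by (simp add: CPM_tensor cpms_dbl ml_dag_natural)
qed

text \<open>The functor from \<open>C\<close> to CPM, strictly monoidal by
  \<open>dbl_tensor\<close>. Structure maps, cups and counits of CPM all lie in its image.\<close>

definition J :: "'m \<Rightarrow> 'o \<times> 'o \<times> 'm" where
  "J c = (Dom C c, Cod C c, dbl c)"

text \<open>Used from left to right, these collect a diagram of structure maps of CPM into
  \<open>J\<close> of the same diagram in \<open>C\<close>. The expanding rules of
  \<open>CPM_simps\<close> are switched off whenever this is done.\<close>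

lemma J_simps:
  "A \<in> Ob C \<Longrightarrow> Id K A = J (\<one> A)"
  "Assoc K A B D = J (\<alpha> A B D)" "Lunit K A = J (\<ll> A)" "Runit K A = J (\<rho> A)" "Symm K A B = J (\<sigma> A B)" "Cup K A = J (\<eta> A)"
  "f \<in> Arr C \<Longrightarrow> g \<in> Arr C \<Longrightarrow> Dom C g = Cod C f \<Longrightarrow> Comp K (J g) (J f) = J (g \<cdot> f)"
  "f \<in> Arr C \<Longrightarrow> g \<in> Arr C \<Longrightarrow> TenA K (J f) (J g) = J (f \<boxtimes> g)"
  "f \<in> Arr C \<Longrightarrow> Dag K (J f) = J (f\<dagger>)"
  by (simp_all add: J_def dbl_comp del: CPM_simps(13))
    (simp_all add: dbl_tensor)

lemma J_hom: "f \<in> Arr C \<Longrightarrow> J f \<in> hom K (Dom C f) (Cod C f)"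
  by (simp add: hom_CPM J_def cpms_dbl)

lemma J_iso:
  assumes "f \<in> Arr C" "f\<dagger> \<cdot> f = \<one> (Dom C f)" "f \<cdot> f\<dagger> = \<one> (Cod C f)"
  shows "J f \<in> iso_hom K (Dom C f) (Cod C f)"
  unfolding iso_hom_def using assms J_hom [of f] J_hom [of "f\<dagger>"]
  by (auto intro!: bexI [of _ "J (f\<dagger>)"] simp: J_simps simp del: CPM_simps hom_iff)

lemma counit_CPM: "A \<in> Ob C \<Longrightarrow> counit K A = J (\<epsilon> A)"
  unfolding counit_def by (simp add: J_simps del: CPM_simps(5,9-13,15))

lemma category_CPM: "category K"
proof
  fix f assume "f \<in> Arr K"
  then show "Dom K f \<in> Ob K" "Cod K f \<in> Ob K" by auto
next
  fix A assume "A \<in> Ob K"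
  then show "Id K A \<in> hom K A A" using J_hom [of "\<one> A"] by (simp add: J_simps del: CPM_simps(5))
qed (auto simp: hom_CPM cpms_comp)

section \<open>The laws of CPM that concern arbitrary completely positive maps\<close>

lemma ml_assoc_dag:
  assumes "A \<in> Ob C" "B \<in> Ob C" "D \<in> Ob C"
  shows "\<alpha> (A\<^bold>* \<otimes> A) (B\<^bold>* \<otimes> B) (D\<^bold>* \<otimes> D) \<cdot> (ml A B)\<dagger> \<rhd> (D\<^bold>* \<otimes> D) \<cdot> (ml (A \<otimes> B) D)\<dagger> = 
    (A\<^bold>* \<otimes> A) \<lhd> (ml B D)\<dagger> \<cdot> (ml A (B \<otimes> D))\<dagger> \<cdot> dbl (\<alpha> A B D)"
proof -
  let ?M = "\<lambda>A. A\<^bold>* \<otimes> A" let ?a = "\<alpha> (?M A) (?M B) (?M D)"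
  have d: "dbl ((\<alpha> A B D)\<dagger>) \<cdot> dbl (\<alpha> A B D) = \<one> (?M ((A \<otimes> B) \<otimes> D))" using assms by (simp flip: dbl_comp)
  have "?a \<cdot> ((ml A B)\<dagger> \<rhd> ?M D \<cdot> (ml (A \<otimes> B) D)\<dagger> \<cdot> dbl ((\<alpha> A B D)\<dagger>)) \<cdot> dbl (\<alpha> A B D) = 
     ?a \<cdot> (?a\<dagger> \<cdot> ?M A \<lhd> (ml B D)\<dagger> \<cdot> (ml A (B \<otimes> D))\<dagger>) \<cdot> dbl (\<alpha> A B D)"
    using assms arg_cong [OF ml_assoc [of A B D], of "\<lambda>x. Dag C x"] by simp
  then show ?thesis using assms d by simp
qed

text \<open>A map in \<open>cpms\<close> need not be of the form \<open>dbl f\<close>, so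
  functoriality does not help. Since the tensor of CPM is conjugation by \<open>ml\<close>, the law
  \<open>ml_assoc\<close> and its adjoint form reduce the claim to naturality in
  \<open>C\<close>.\<close>

lemma assoc_natural_CPM:
  assumes "\<phi> \<in> cpms A A'" "\<psi> \<in> cpms B B'" "\<chi> \<in> cpms D D'"
    and o [simp]: "A \<in> Ob C" "A' \<in> Ob C" "B \<in> Ob C" "B' \<in> Ob C" "D \<in> Ob C" "D' \<in> Ob C"
  shows "dbl (\<alpha> A' B' D') \<cdot> ml (A' \<otimes> B') D' \<cdot> ((ml A' B' \<cdot> (\<phi> \<boxtimes> \<psi>) \<cdot> (ml A B)\<dagger>) \<boxtimes> \<chi>) \<cdot> (ml (A \<otimes> B) D)\<dagger> =
    ml A' (B' \<otimes> D') \<cdot> (\<phi> \<boxtimes> (ml B' D' \<cdot> (\<psi> \<boxtimes> \<chi>) \<cdot> (ml B D)\<dagger>)) \<cdot> (ml A (B \<otimes> D))\<dagger> \<cdot> dbl (\<alpha> A B D)"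
proof -
  let ?M = "\<lambda>A. A\<^bold>* \<otimes> A"
  note a = cpms_simps [OF assms(1) o(2)] cpms_simps [OF assms(2) o(4)] cpms_simps [OF assms(3) o(6)]
  have 1: "(ml A' B' \<cdot> (\<phi> \<boxtimes> \<psi>) \<cdot> (ml A B)\<dagger>) \<boxtimes> \<chi> = ml A' B' \<rhd> ?M D' \<cdot> ((\<phi> \<boxtimes> \<psi>) \<boxtimes> \<chi>) \<cdot> (ml A B)\<dagger> \<rhd> ?M D"
    using a by (simp add: act_def tensor_comp')
  have 2: "?M A' \<lhd> ml B' D' \<cdot> (\<phi> \<boxtimes> (\<psi> \<boxtimes> \<chi>)) \<cdot> ?M A \<lhd> (ml B D)\<dagger> = \<phi> \<boxtimes> (ml B' D' \<cdot> (\<psi> \<boxtimes> \<chi>) \<cdot> (ml B D)\<dagger>)"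
    using a by (simp add: lw_def tensor_comp')
  have n: "\<alpha> (?M A') (?M B') (?M D') \<cdot> ((\<phi> \<boxtimes> \<psi>) \<boxtimes> \<chi>) = (\<phi> \<boxtimes> (\<psi> \<boxtimes> \<chi>)) \<cdot> \<alpha> (?M A) (?M B) (?M D)"
    using a assoc_natural' [of \<phi> \<psi> \<chi>] by simp
  have "dbl (\<alpha> A' B' D') \<cdot> ml (A' \<otimes> B') D' \<cdot> ((ml A' B' \<cdot> (\<phi> \<boxtimes> \<psi>) \<cdot> (ml A B)\<dagger>) \<boxtimes> \<chi>) \<cdot> (ml (A \<otimes> B) D)\<dagger> =
    (dbl (\<alpha> A' B' D') \<cdot> ml (A' \<otimes> B') D' \<cdot> ml A' B' \<rhd> ?M D') \<cdot> ((\<phi> \<boxtimes> \<psi>) \<boxtimes> \<chi>) \<cdot> (ml A B)\<dagger> \<rhd> ?M D \<cdot> (ml (A \<otimes> B) D)\<dagger>"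
    unfolding 1 using a by simp
  also have "\<dots> = ml A' (B' \<otimes> D') \<cdot> ?M A' \<lhd> ml B' D' \<cdot> (\<alpha> (?M A') (?M B') (?M D') \<cdot> ((\<phi> \<boxtimes> \<psi>) \<boxtimes> \<chi>)) \<cdot> (ml A B)\<dagger> \<rhd> ?M D \<cdot> (ml (A \<otimes> B) D)\<dagger>"
    unfolding ml_assoc [OF o(2,4,6)] using a by simp
  also have "\<dots> = ml A' (B' \<otimes> D') \<cdot> ?M A' \<lhd> ml B' D' \<cdot> (\<phi> \<boxtimes> (\<psi> \<boxtimes> \<chi>)) \<cdot> (\<alpha> (?M A) (?M B) (?M D) \<cdot> (ml A B)\<dagger> \<rhd> ?M D \<cdot> (ml (A \<otimes> B) D)\<dagger>)"
    unfolding n using a by simp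
  also have "\<dots> = ml A' (B' \<otimes> D') \<cdot> (?M A' \<lhd> ml B' D' \<cdot> (\<phi> \<boxtimes> (\<psi> \<boxtimes> \<chi>)) \<cdot> ?M A \<lhd> (ml B D)\<dagger>) \<cdot> (ml A (B \<otimes> D))\<dagger> \<cdot> dbl (\<alpha> A B D)"
    unfolding ml_assoc_dag [OF o(1,3,5)] using a by simp
  finally show ?thesis unfolding 2 .
qed

text \<open>The second half of the unitarity of \<open>\<eta> \<I>\<close>;
  \<open>unit_circle\<close> is the other. It is the dual snake at \<open>\<I>\<close>, whose
  crossing is a composite of unitors.\<close>

lemma unit_cup_cap: "\<eta> \<I> \<cdot> (\<eta> \<I>)\<dagger> = \<one> (\<I>\<^bold>* \<otimes> \<I>)"
proof (rule act_eqI)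
  fix Z assume Z: "Z \<in> Ob C"
  let ?cup = "\<lambda>Z. \<I>\<^bold>* \<lhd> \<ll> Z \<cdot> cupz \<I> Z" and ?cap = "\<lambda>Z. capz \<I> Z \<cdot> \<I>\<^bold>* \<lhd> (\<ll> Z)\<dagger>"
  have "cupz \<I> Z \<cdot> ?cap Z = \<I>\<^bold>* \<lhd> \<I> \<lhd> ?cap Z \<cdot> cupz \<I> (\<I>\<^bold>* \<otimes> Z)"
    using Z by (subst cupz_natural) simp_all
  moreover have "\<I>\<^bold>* \<lhd> (\<ll> Z \<cdot> \<I> \<lhd> ?cap Z) = \<I>\<^bold>* \<lhd> (?cap Z \<cdot> \<ll> (\<I>\<^bold>* \<otimes> Z))"
    using Z by (subst lunit_natural') simp_all
  ultimately have "?cup Z \<cdot> ?cap Z = \<I>\<^bold>* \<lhd> (?cap Z \<cdot> \<ll> (\<I>\<^bold>* \<otimes> Z)) \<cdot> cupz \<I> (\<I>\<^bold>* \<otimes> Z)"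
    using Z by (simp add: lw_merge)
  also have "\<dots> = \<one> (\<I>\<^bold>* \<otimes> Z)"
    using snakez_dual [of \<I> Z] Z by (simp add: sw_unit_left)
  finally have "\<I>\<^bold>* \<lhd> (\<ll> Z)\<dagger> \<cdot> (?cup Z \<cdot> ?cap Z) \<cdot> \<I>\<^bold>* \<lhd> \<ll> Z = \<one> (\<I>\<^bold>* \<otimes> \<I> \<otimes> Z)"
    using Z by simp
  then have "cupz \<I> Z \<cdot> capz \<I> Z = \<one> (\<I>\<^bold>* \<otimes> \<I> \<otimes> Z)" using Z by simp
  from reassoc [OF this, of "\<alpha> (\<I>\<^bold>*) \<I> Z"]
  show "(\<eta> \<I> \<cdot> (\<eta> \<I>)\<dagger>) \<rhd> Z = \<one> (\<I>\<^bold>* \<otimes> \<I>) \<rhd> Z"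
    using Z by (simp add: act_comp act_cup)
qed simp_all

lemma lunit_natural_CPM:
  assumes "\<phi> \<in> cpms A B" and o [simp]: "A \<in> Ob C" "B \<in> Ob C"
  shows "dbl (\<ll> B) \<cdot> ml \<I> B \<cdot> (\<one> (\<I>\<^bold>* \<otimes> \<I>) \<boxtimes> \<phi>) \<cdot> (ml \<I> A)\<dagger> = \<phi> \<cdot> dbl (\<ll> A)"
proof -
  let ?M = "\<lambda>A. A\<^bold>* \<otimes> A"
  note a = cpms_simps [OF assms(1) o(2)]
  \<comment> \<open>The identity is factored through \<open>\<I>\<close> by
    \<open>unit_cup_cap\<close>. This creates the \<open>\<eta> \<I>\<close> that
    \<open>ml_lunit\<close> needs and its dagger, which serves on the other side.\<close>
  have s: "(\<one> (?M \<I>) \<boxtimes> \<phi>) = \<eta> \<I> \<rhd> ?M B \<cdot> \<I> \<lhd> \<phi> \<cdot> (\<eta> \<I>)\<dagger> \<rhd> ?M A"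
    using a by (simp add: act_def lw_def tensor_comp' unit_cup_cap)
  have 2: "\<ll> (?M A) \<cdot> (\<eta> \<I>)\<dagger> \<rhd> ?M A \<cdot> (ml \<I> A)\<dagger> = dbl (\<ll> A)"
  proof -
    have "\<ll> (?M A) \<cdot> ((\<eta> \<I>)\<dagger> \<rhd> ?M A \<cdot> (ml \<I> A)\<dagger> \<cdot> dbl ((\<ll> A)\<dagger>)) \<cdot> dbl (\<ll> A) = dbl (\<ll> A)"
      unfolding ml_unit_dag [OF o(1)] by simp
    moreover have "dbl ((\<ll> A)\<dagger>) \<cdot> dbl (\<ll> A) = \<one> (?M (\<I> \<otimes> A))" by (simp flip: dbl_comp)
    ultimately show ?thesis by simp
  qed
  have "dbl (\<ll> B) \<cdot> ml \<I> B \<cdot> (\<one> (?M \<I>) \<boxtimes> \<phi>) \<cdot> (ml \<I> A)\<dagger> = (dbl (\<ll> B) \<cdot> ml \<I> B \<cdot> \<eta> \<I> \<rhd> ?M B) \<cdot> \<I> \<lhd> \<phi> \<cdot> (\<eta> \<I>)\<dagger> \<rhd> ?M A \<cdot> (ml \<I> A)\<dagger>"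
    unfolding s using a by simp
  also have "\<dots> = \<phi> \<cdot> (\<ll> (?M A) \<cdot> (\<eta> \<I>)\<dagger> \<rhd> ?M A \<cdot> (ml \<I> A)\<dagger>)"
    unfolding ml_lunit [OF o(2)] using a by (simp add: lunit_natural'')
  finally show ?thesis unfolding 2 .
qed

lemma symm_natural_CPM:
  assumes "\<phi> \<in> cpms A A'" "\<psi> \<in> cpms B B'" and o [simp]: "A \<in> Ob C" "A' \<in> Ob C" "B \<in> Ob C" "B' \<in> Ob C"
  shows "dbl (\<sigma> A' B') \<cdot> ml A' B' \<cdot> (\<phi> \<boxtimes> \<psi>) \<cdot> (ml A B)\<dagger> = ml B' A' \<cdot> (\<psi> \<boxtimes> \<phi>) \<cdot> (ml B A)\<dagger> \<cdot> dbl (\<sigma> A B)"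
proof -
  let ?M = "\<lambda>A. A\<^bold>* \<otimes> A"
  note a = cpms_simps [OF assms(1) o(2)] cpms_simps [OF assms(2) o(4)]
  have 2: "\<sigma> (?M A) (?M B) \<cdot> (ml A B)\<dagger> = (ml B A)\<dagger> \<cdot> dbl (\<sigma> A B)"
    using arg_cong [OF ml_symm [of B A], of "Dag C"] by simp
  have "dbl (\<sigma> A' B') \<cdot> ml A' B' \<cdot> (\<phi> \<boxtimes> \<psi>) \<cdot> (ml A B)\<dagger> = (dbl (\<sigma> A' B') \<cdot> ml A' B') \<cdot> (\<phi> \<boxtimes> \<psi>) \<cdot> (ml A B)\<dagger>"
    using a by simp
  also have "\<dots> = ml B' A' \<cdot> (\<sigma> (?M A') (?M B') \<cdot> (\<phi> \<boxtimes> \<psi>)) \<cdot> (ml A B)\<dagger>"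
    unfolding ml_symm [OF o(2,4)] using a by simp
  also have "\<sigma> (?M A') (?M B') \<cdot> (\<phi> \<boxtimes> \<psi>) = (\<psi> \<boxtimes> \<phi>) \<cdot> \<sigma> (?M A) (?M B)"
    using a symm_tensor [of \<phi> \<psi>] by simp
  also have "ml B' A' \<cdot> ((\<psi> \<boxtimes> \<phi>) \<cdot> \<sigma> (?M A) (?M B)) \<cdot> (ml A B)\<dagger> = ml B' A' \<cdot> (\<psi> \<boxtimes> \<phi>) \<cdot> (\<sigma> (?M A) (?M B) \<cdot> (ml A B)\<dagger>)"
    using a by simp
  finally show ?thesis unfolding 2 .
qed

lemma cpms_id: "A \<in> Ob C \<Longrightarrow> \<one> (A\<^bold>* \<otimes> A) \<in> cpms A A"
  using cpms_dbl [of "\<one> A"] by simp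

text \<open>The right unitor is the left one after a symmetry, so the two preceding naturality laws
  combine.\<close>

lemma runit_natural_CPM:
  assumes "\<phi> \<in> cpms A B" and o [simp]: "A \<in> Ob C" "B \<in> Ob C"
  shows "dbl (\<rho> B) \<cdot> ml B \<I> \<cdot> (\<phi> \<boxtimes> \<one> (\<I>\<^bold>* \<otimes> \<I>)) \<cdot> (ml A \<I>)\<dagger> = \<phi> \<cdot> dbl (\<rho> A)"
proof -
  note a = cpms_simps [OF assms(1) o(2)]
  have r: "dbl (\<rho> D) = dbl (\<ll> D) \<cdot> dbl (\<sigma> D \<I>)" if "D \<in> Ob C" for D
    using that by (simp flip: dbl_comp add: lunit_symm)
  have "dbl (\<rho> B) \<cdot> ml B \<I> \<cdot> (\<phi> \<boxtimes> \<one> (\<I>\<^bold>* \<otimes> \<I>)) \<cdot> (ml A \<I>)\<dagger> =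
    dbl (\<ll> B) \<cdot> (dbl (\<sigma> B \<I>) \<cdot> ml B \<I> \<cdot> (\<phi> \<boxtimes> \<one> (\<I>\<^bold>* \<otimes> \<I>)) \<cdot> (ml A \<I>)\<dagger>)"
    using a by (simp add: r)
  also have "\<dots> = (dbl (\<ll> B) \<cdot> ml \<I> B \<cdot> (\<one> (\<I>\<^bold>* \<otimes> \<I>) \<boxtimes> \<phi>) \<cdot> (ml \<I> A)\<dagger>) \<cdot> dbl (\<sigma> A \<I>)"
    using a symm_natural_CPM [OF assms(1) cpms_id [OF unit_ob] o unit_ob unit_ob] by simp
  also have "\<dots> = \<phi> \<cdot> dbl (\<rho> A)"
    unfolding lunit_natural_CPM [OF assms] using a by (simp add: r)
  finally show ?thesis .
qed

lemma tensor_comp_CPM: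
  assumes "\<phi> \<in> cpms A B" "\<psi> \<in> cpms B D" "\<phi>' \<in> cpms A' B'" "\<psi>' \<in> cpms B' D'"
    and o [simp]: "A \<in> Ob C" "A' \<in> Ob C" "B \<in> Ob C" "B' \<in> Ob C" "D \<in> Ob C" "D' \<in> Ob C"
  shows "ml D D' \<cdot> ((\<psi> \<cdot> \<phi>) \<boxtimes> (\<psi>' \<cdot> \<phi>')) \<cdot> (ml A A')\<dagger> =
    (ml D D' \<cdot> (\<psi> \<boxtimes> \<psi>') \<cdot> (ml B B')\<dagger>) \<cdot> (ml B B' \<cdot> (\<phi> \<boxtimes> \<phi>') \<cdot> (ml A A')\<dagger>)"
proof -
  note a = cpms_simps [OF assms(1) o(3)] cpms_simps [OF assms(2) o(5)] cpms_simps [OF assms(3) o(4)] cpms_simps [OF assms(4) o(6)]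
  show ?thesis
    using a reassoc [OF ml_simps(2), of B B' "(\<phi> \<boxtimes> \<phi>') \<cdot> (ml A A')\<dagger>"] by (simp add: tensor_comp')
qed

lemma symmetric_monoidal_category_CPM: "symmetric_monoidal_category K"
proof (intro symmetric_monoidal_category.intro category_CPM symmetric_monoidal_category_axioms.intro)
  fix f g A B A' B' assume "f \<in> hom K A B" "g \<in> hom K A' B'"
  then show "TenA K f g \<in> hom K (TenO K A A') (TenO K B B')"
    by (auto simp: hom_CPM CPM_tensor cpms_tensor)
next
  fix A B assume "A \<in> Ob K" "B \<in> Ob K"
  then show "TenA K (Id K A) (Id K B) = Id K (TenO K A B)"
    by (simp add: J_simps del: CPM_simps(5))
next
  fix f g f' g' A B D A' B' D'
  assume "f \<in> hom K A B" "g \<in> hom K B D" "f' \<in> hom K A' B'" "g' \<in> hom K B' D'"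
  then show "TenA K (Comp K g f) (Comp K g' f') = Comp K (TenA K g g') (TenA K f f')"
    by (auto simp: hom_CPM CPM_tensor cpms_comp tensor_comp_CPM)
next
  fix A B D assume "A \<in> Ob K" "B \<in> Ob K" "D \<in> Ob K"
  then show "Assoc K A B D \<in> iso_hom K (TenO K (TenO K A B) D) (TenO K A (TenO K B D))"
    using J_iso [of "\<alpha> A B D"] by (simp add: J_simps del: CPM_simps(9))
next
  fix f g h A A' B B' D D'
  assume "f \<in> hom K A A'" "g \<in> hom K B B'" "h \<in> hom K D D'"
  then obtain \<phi> \<psi> \<chi> where *: "f = (A, A', \<phi>)" "g = (B, B', \<psi>)" "h = (D, D', \<chi>)" "\<phi> \<in> cpms A A'" "\<psi> \<in> cpms B B'" "\<chi> \<in> cpms D D'"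
    "A \<in> Ob C" "A' \<in> Ob C" "B \<in> Ob C" "B' \<in> Ob C" "D \<in> Ob C" "D' \<in> Ob C"
    by (auto simp: hom_CPM)
  then show "Comp K (Assoc K A' B' D') (TenA K (TenA K f g) h) = Comp K (TenA K f (TenA K g h)) (Assoc K A B D)"
    using assoc_natural_CPM [OF *(4-12)]
    by (simp add: CPM_tensor cpms_tensor)
next
  fix A assume "A \<in> Ob K"
  then show "Lunit K A \<in> iso_hom K (TenO K (Unit K) A) A" "Runit K A \<in> iso_hom K (TenO K A (Unit K)) A"
    using J_iso [of "\<ll> A"] J_iso [of "\<rho> A"] by (simp_all add: J_simps del: CPM_simps(10,11))
next
  fix f A B assume "f \<in> hom K A B"
  then obtain \<phi> where *: "f = (A, B, \<phi>)" "\<phi> \<in> cpms A B" "A \<in> Ob C" "B \<in> Ob C" by (auto simp: hom_CPM)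
  then show "Comp K (Lunit K B) (TenA K (Id K (Unit K)) f) = Comp K f (Lunit K A)"
    and "Comp K (Runit K B) (TenA K f (Id K (Unit K))) = Comp K f (Runit K A)"
    using lunit_natural_CPM [OF *(2-4)] runit_natural_CPM [OF *(2-4)] by (simp_all add: CPM_tensor cpms_id)
next
  fix A B assume "A \<in> Ob K" "B \<in> Ob K"
  then show "Symm K A B \<in> iso_hom K (TenO K A B) (TenO K B A)"
    using J_iso [of "\<sigma> A B"] by (simp add: J_simps del: CPM_simps(12))
next
  fix f g A A' B B' assume "f \<in> hom K A A'" "g \<in> hom K B B'"
  then obtain \<phi> \<psi> where *: "f = (A, A', \<phi>)" "g = (B, B', \<psi>)" "\<phi> \<in> cpms A A'" "\<psi> \<in> cpms B B'"
    "A \<in> Ob C" "A' \<in> Ob C" "B \<in> Ob C" "B' \<in> Ob C"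
    by (auto simp: hom_CPM)
  then show "Comp K (Symm K A' B') (TenA K f g) = Comp K (TenA K g f) (Symm K A B)"
    using symm_natural_CPM [OF *(3-8)] by (simp add: CPM_tensor)
next
  fix A B assume "A \<in> Ob K" "B \<in> Ob K"
  then show "Comp K (Symm K B A) (Symm K A B) = Id K (TenO K A B)"
    by (simp add: J_simps del: CPM_simps(5,12))
next
  fix A B D E assume o: "A \<in> Ob K" "B \<in> Ob K" "D \<in> Ob K" "E \<in> Ob K"
  then show "Comp K (TenA K (Id K A) (Assoc K B D E)) (Comp K (Assoc K A (TenO K B D) E) (TenA K (Assoc K A B D) (Id K E))) =
       Comp K (Assoc K A B (TenO K D E)) (Assoc K (TenO K A B) D E)"
    using pentagon [of A B D E] by (simp add: J_simps del: CPM_simps(5,9))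
next
  fix A B assume o: "A \<in> Ob K" "B \<in> Ob K"
  then show "Comp K (TenA K (Id K A) (Lunit K B)) (Assoc K A (Unit K) B) = TenA K (Runit K A) (Id K B)"
    using triangle [of A B] by (simp add: J_simps del: CPM_simps(5,9-11))
next
  fix A B D assume o: "A \<in> Ob K" "B \<in> Ob K" "D \<in> Ob K"
  then show "Comp K (Assoc K B D A) (Comp K (Symm K A (TenO K B D)) (Assoc K A B D)) =
       Comp K (TenA K (Id K B) (Symm K A D)) (Comp K (Assoc K B A D) (TenA K (Symm K A B) (Id K D)))"
    using hexagon [of A B D] by (simp add: J_simps del: CPM_simps(5,9,12))
qed simp_all

lemma dagger_symmetric_monoidal_category_CPM: "dagger_symmetric_monoidal_category K"
proof (intro dagger_symmetric_monoidal_category.intro symmetric_monoidal_category_CPM dagger_symmetric_monoidal_category_axioms.intro)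
  fix f A B assume "f \<in> hom K A B"
  then show "Dag K f \<in> hom K B A" by (auto simp: hom_CPM cpms_dag)
next
  fix A assume "A \<in> Ob K"
  then show "Dag K (Id K A) = Id K A" by simp
next
  fix f g A B D assume "f \<in> hom K A B" "g \<in> hom K B D"
  then show "Dag K (Comp K g f) = Comp K (Dag K f) (Dag K g)" by (auto simp: hom_CPM)
next
  fix f assume "f \<in> Arr K"
  then show "Dag K (Dag K f) = f" by auto
next
  fix f g assume "f \<in> Arr K" "g \<in> Arr K"
  then show "Dag K (TenA K f g) = TenA K (Dag K f) (Dag K g)" by (auto simp: CPM_tensor cpms_dag)
qed (simp_all add: J_simps symm_unitary assoc_unitary lunit_unitary runit_unitary del: CPM_simps(5,9-12))

theorem CPM_dagger_compact: "dagger_compact_category K"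
proof (intro dagger_compact_category.intro dagger_symmetric_monoidal_category_CPM dagger_compact_category_axioms.intro)
  fix A assume "A \<in> Ob K"
  then have A: "A \<in> Ob C" by simp
  show "Cup K A \<in> hom K (Unit K) (TenO K (Dual K A) A)"
    using J_hom [of "\<eta> A"] A by (simp add: J_simps del: CPM_simps(15))
  show "Comp K (Lunit K A) (Comp K (TenA K (counit K A) (Id K A)) (Comp K (Dag K (Assoc K A (Dual K A) A))
      (Comp K (TenA K (Id K A) (Cup K A)) (Dag K (Runit K A))))) = Id K A"
    using snake [OF A] A by (simp add: J_simps counit_CPM del: CPM_simps(5,9-12,15))
  show "Comp K (Runit K (Dual K A)) (Comp K (TenA K (Id K (Dual K A)) (counit K A)) (Comp K (Assoc K (Dual K A) A (Dual K A))
      (Comp K (TenA K (Cup K A) (Id K (Dual K A))) (Dag K (Lunit K (Dual K A)))))) = Id K (Dual K A)"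
    using snake_dual [OF A] A by (simp add: J_simps counit_CPM del: CPM_simps(5,9-12,15))
qed simp_all

end

section \<open>Transport along isomorphisms\<close>

text \<open>Nothing is assumed of \<open>D\<close> beyond the isomorphism: every arrow and structure
  map of \<open>D\<close> is an image under \<open>F\<close>, so each law of \<open>D\<close> is the
  image of one of \<open>C\<close>. This serves three times: from \<open>C\<close> to its typed
  copy, from CPM of that copy to CPM of \<open>C\<close>, and from there to CP-infinity.\<close>

locale dsmc_transport = dagger_symmetric_monoidal_category C
  for C :: "('o, 'm, 'x) dsmcat_scheme" (structure) +
  fixes D :: "('o, 'n, 'y) dsmcat_scheme" and F :: "'m \<Rightarrow> 'n"
  assumes iso: "dsmc_iso C D (\<lambda>A. A) F"
begin

lemma arr_simps [simp]:
  "f \<in> Arr C \<Longrightarrow> g \<in> Arr C \<Longrightarrow> Dom C g = Cod C f \<Longrightarrow> g \<cdot> f \<in> Arr C"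
  "f \<in> Arr C \<Longrightarrow> g \<in> Arr C \<Longrightarrow> Dom C g = Cod C f \<Longrightarrow> Dom C (g \<cdot> f) = Dom C f"
  "f \<in> Arr C \<Longrightarrow> g \<in> Arr C \<Longrightarrow> Dom C g = Cod C f \<Longrightarrow> Cod C (g \<cdot> f) = Cod C g"
  "f \<in> Arr C \<Longrightarrow> g \<in> Arr C \<Longrightarrow> f \<boxtimes> g \<in> Arr C"
  "f \<in> Arr C \<Longrightarrow> g \<in> Arr C \<Longrightarrow> Dom C (f \<boxtimes> g) = Dom C f \<otimes> Dom C g"
  "f \<in> Arr C \<Longrightarrow> g \<in> Arr C \<Longrightarrow> Cod C (f \<boxtimes> g) = Cod C f \<otimes> Cod C g"
  "f \<in> Arr C \<Longrightarrow> f\<dagger> \<in> Arr C"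
  "f \<in> Arr C \<Longrightarrow> Dom C (f\<dagger>) = Cod C f"
  "f \<in> Arr C \<Longrightarrow> Cod C (f\<dagger>) = Dom C f"
  using comp_hom [of f "Dom C f" "Cod C f" g "Cod C g"] tensor_hom [of f "Dom C f" "Cod C f" g "Dom C g" "Cod C g"]
    dag_hom [of f "Dom C f" "Cod C f"]
  by (simp_all add: hom_def)

lemma const_simps [simp]:
  "A \<in> Ob C \<Longrightarrow> \<one> A \<in> Arr C" "A \<in> Ob C \<Longrightarrow> Dom C (\<one> A) = A" "A \<in> Ob C \<Longrightarrow> Cod C (\<one> A) = A"
  "A \<in> Ob C \<Longrightarrow> B \<in> Ob C \<Longrightarrow> E \<in> Ob C \<Longrightarrow> \<alpha> A B E \<in> Arr C"
  "A \<in> Ob C \<Longrightarrow> B \<in> Ob C \<Longrightarrow> E \<in> Ob C \<Longrightarrow> Dom C (\<alpha> A B E) = (A \<otimes> B) \<otimes> E"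
  "A \<in> Ob C \<Longrightarrow> B \<in> Ob C \<Longrightarrow> E \<in> Ob C \<Longrightarrow> Cod C (\<alpha> A B E) = A \<otimes> (B \<otimes> E)"
  "A \<in> Ob C \<Longrightarrow> \<ll> A \<in> Arr C" "A \<in> Ob C \<Longrightarrow> Dom C (\<ll> A) = \<I> \<otimes> A" "A \<in> Ob C \<Longrightarrow> Cod C (\<ll> A) = A"
  "A \<in> Ob C \<Longrightarrow> \<rho> A \<in> Arr C" "A \<in> Ob C \<Longrightarrow> Dom C (\<rho> A) = A \<otimes> \<I>" "A \<in> Ob C \<Longrightarrow> Cod C (\<rho> A) = A"
  "A \<in> Ob C \<Longrightarrow> B \<in> Ob C \<Longrightarrow> \<sigma> A B \<in> Arr C"
  "A \<in> Ob C \<Longrightarrow> B \<in> Ob C \<Longrightarrow> Dom C (\<sigma> A B) = A \<otimes> B" "A \<in> Ob C \<Longrightarrow> B \<in> Ob C \<Longrightarrow> Cod C (\<sigma> A B) = B \<otimes> A"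
  using id_hom [of A] assoc_iso [of A B E] lunit_iso [of A] runit_iso [of A] symm_iso [of A B]
  by (simp_all add: hom_def iso_hom_def)

lemma ob_simps [simp]:
  "f \<in> Arr C \<Longrightarrow> Dom C f \<in> Ob C" "f \<in> Arr C \<Longrightarrow> Cod C f \<in> Ob C" "\<I> \<in> Ob C" "A \<in> Ob C \<Longrightarrow> B \<in> Ob C \<Longrightarrow> A \<otimes> B \<in> Ob C"
  by (auto intro: dom_ob cod_ob unit_ob tensor_ob)

lemma preserve [simp]:
  "Ob D = Ob C"
  "Unit D = \<I>"
  "f \<in> Arr C \<Longrightarrow> F f \<in> Arr D"
  "f \<in> Arr C \<Longrightarrow> Dom D (F f) = Dom C f"
  "f \<in> Arr C \<Longrightarrow> Cod D (F f) = Cod C f"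
  "A \<in> Ob C \<Longrightarrow> Id D A = F (\<one> A)"
  "f \<in> Arr C \<Longrightarrow> g \<in> Arr C \<Longrightarrow> Dom C g = Cod C f \<Longrightarrow> Comp D (F g) (F f) = F (g \<cdot> f)"
  "A \<in> Ob C \<Longrightarrow> B \<in> Ob C \<Longrightarrow> TenO D A B = A \<otimes> B"
  "f \<in> Arr C \<Longrightarrow> g \<in> Arr C \<Longrightarrow> TenA D (F f) (F g) = F (f \<boxtimes> g)"
  "A \<in> Ob C \<Longrightarrow> B \<in> Ob C \<Longrightarrow> E \<in> Ob C \<Longrightarrow> Assoc D A B E = F (\<alpha> A B E)"
  "A \<in> Ob C \<Longrightarrow> Lunit D A = F (\<ll> A)"
  "A \<in> Ob C \<Longrightarrow> Runit D A = F (\<rho> A)"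
  "A \<in> Ob C \<Longrightarrow> B \<in> Ob C \<Longrightarrow> Symm D A B = F (\<sigma> A B)"
  "f \<in> Arr C \<Longrightarrow> Dag D (F f) = F (f\<dagger>)"
  using iso unfolding dsmc_iso_def by (auto simp: bij_betw_def)

lemma hom_D: "f \<in> hom D A B \<longleftrightarrow> (\<exists>f0 \<in> hom C A B. f = F f0)"
proof
  assume f: "f \<in> hom D A B"
  then obtain f0 where "f0 \<in> Arr C" "f = F f0"
    using iso unfolding dsmc_iso_def by (auto simp: hom_def bij_betw_def)
  then show "\<exists>f0 \<in> hom C A B. f = F f0" using f by (auto simp: hom_def)
qed (auto simp: hom_def)

lemma hom_DE:
  assumes "f \<in> hom D A B"
  obtains f0 where "f0 \<in> Arr C" "Dom C f0 = A" "Cod C f0 = B" "f = F f0"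
  using assms by (auto simp: hom_D hom_def [of C])

lemma F_hom [simp]: "f \<in> Arr C \<Longrightarrow> Dom C f = A \<Longrightarrow> Cod C f = B \<Longrightarrow> F f \<in> hom D A B"
  by (auto simp: hom_def [of D])

lemma Arr_D: "f \<in> Arr D \<longleftrightarrow> (\<exists>f0 \<in> Arr C. f = F f0)"
  using iso unfolding dsmc_iso_def by (auto simp: bij_betw_def)

lemma F_iso:
  assumes "f \<in> iso_hom C A B"
  shows "F f \<in> iso_hom D A B"
proof -
  obtain g where "f \<in> hom C A B" "g \<in> hom C B A" "g \<cdot> f = \<one> A" "f \<cdot> g = \<one> B"
    using assms by (auto simp: iso_hom_def)
  then show ?thesis
    unfolding iso_hom_def by (auto simp: hom_def [of C] intro!: bexI [of _ "F g"])
qed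

lemma category_D: "category D"
proof (intro category.intro)
  fix f A B assume "f \<in> hom D A B"
  then show "Comp D f (Id D A) = f" "Comp D (Id D B) f = f"
    by (auto elim!: hom_DE simp: comp_id [unfolded hom_def] id_comp [unfolded hom_def])
next
  fix f g h A B X Y assume "f \<in> hom D A B" "g \<in> hom D B X" "h \<in> hom D X Y"
  then obtain f0 g0 h0 where *: "f0 \<in> hom C A B" "g0 \<in> hom C B X" "h0 \<in> hom C X Y" "f = F f0" "g = F g0" "h = F h0"
    by (auto simp: hom_D)
  then show "Comp D (Comp D h g) f = Comp D h (Comp D g f)"
    using comp_assoc [OF *(1-3)] by (auto simp: hom_def [of C])
qed (auto simp: Arr_D elim!: hom_DE)

lemma symmetric_monoidal_category_D: "symmetric_monoidal_category D"
proof (intro symmetric_monoidal_category.intro category_D symmetric_monoidal_category_axioms.intro)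
  fix f g A B A' B' assume "f \<in> hom D A B" "g \<in> hom D A' B'"
  then show "TenA D f g \<in> hom D (TenO D A A') (TenO D B B')"
    by (auto elim!: hom_DE)
next
  fix f g f' g' A B X A' B' X'
  assume "f \<in> hom D A B" "g \<in> hom D B X" "f' \<in> hom D A' B'" "g' \<in> hom D B' X'"
  then obtain f0 g0 f0' g0' where *: "f0 \<in> hom C A B" "g0 \<in> hom C B X" "f0' \<in> hom C A' B'" "g0' \<in> hom C B' X'"
    "f = F f0" "g = F g0" "f' = F f0'" "g' = F g0'" by (auto simp: hom_D)
  then show "TenA D (Comp D g f) (Comp D g' f') = Comp D (TenA D g g') (TenA D f f')"
    using tensor_comp [OF *(1-4)] by (auto simp: hom_def [of C])
next
  fix f g h A A' B B' X X'
  assume "f \<in> hom D A A'" "g \<in> hom D B B'" "h \<in> hom D X X'"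
  then obtain f0 g0 h0 where *: "f0 \<in> hom C A A'" "g0 \<in> hom C B B'" "h0 \<in> hom C X X'" "f = F f0" "g = F g0" "h = F h0"
    by (auto simp: hom_D)
  then show "Comp D (Assoc D A' B' X') (TenA D (TenA D f g) h) = Comp D (TenA D f (TenA D g h)) (Assoc D A B X)"
    using assoc_natural [OF *(1-3)] by (auto simp: hom_def [of C])
next
  fix f A B assume "f \<in> hom D A B"
  then obtain f0 where *: "f0 \<in> hom C A B" "f = F f0" by (auto simp: hom_D)
  then show "Comp D (Lunit D B) (TenA D (Id D (Unit D)) f) = Comp D f (Lunit D A)"
    and "Comp D (Runit D B) (TenA D f (Id D (Unit D))) = Comp D f (Runit D A)"
    using lunit_natural [OF *(1)] runit_natural [OF *(1)] by (auto simp: hom_def [of C])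
next
  fix f g A A' B B' assume "f \<in> hom D A A'" "g \<in> hom D B B'"
  then obtain f0 g0 where *: "f0 \<in> hom C A A'" "g0 \<in> hom C B B'" "f = F f0" "g = F g0" by (auto simp: hom_D)
  then show "Comp D (Symm D A' B') (TenA D f g) = Comp D (TenA D g f) (Symm D A B)"
    using symm_natural [OF *(1-2)] by (auto simp: hom_def [of C])
qed (simp_all add: F_iso assoc_iso lunit_iso runit_iso symm_iso tensor_id symm_symm pentagon triangle hexagon)

lemma dagger_symmetric_monoidal_category_D: "dagger_symmetric_monoidal_category D"
proof (intro dagger_symmetric_monoidal_category.intro symmetric_monoidal_category_D dagger_symmetric_monoidal_category_axioms.intro)
  fix f g A B X assume "f \<in> hom D A B" "g \<in> hom D B X"
  then obtain f0 g0 where *: "f0 \<in> hom C A B" "g0 \<in> hom C B X" "f = F f0" "g = F g0" by (auto simp: hom_D)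
  then show "Dag D (Comp D g f) = Comp D (Dag D f) (Dag D g)"
    using dag_comp [OF *(1-2)] by (auto simp: hom_def [of C])
qed (auto elim!: hom_DE simp: Arr_D dag_id dag_dag dag_tensor symm_unitary assoc_unitary lunit_unitary runit_unitary)

end

locale dcc_transport = dagger_compact_category C + dsmc_transport C D F
  for C :: "('o, 'm, 'x) dccat_scheme" (structure)
    and D :: "('o, 'n, 'y) dccat_scheme" and F :: "'m \<Rightarrow> 'n" +
  assumes dual_D: "A \<in> Ob C \<Longrightarrow> Dual D A = A\<^bold>*"
    and cup_D: "A \<in> Ob C \<Longrightarrow> Cup D A = F (\<eta> A)"
begin

lemma cup_simps [simp]:
  "A \<in> Ob C \<Longrightarrow> A\<^bold>* \<in> Ob C" "A \<in> Ob C \<Longrightarrow> \<eta> A \<in> Arr C" "A \<in> Ob C \<Longrightarrow> Dom C (\<eta> A) = \<I>" "A \<in> Ob C \<Longrightarrow> Cod C (\<eta> A) = A\<^bold>* \<otimes> A"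
  using cup_hom [of A] dual_ob [of A] by (simp_all add: hom_def)

lemma counit_D: "A \<in> Ob C \<Longrightarrow> counit D A = F (\<epsilon> A)"
  by (simp add: counit_def dual_D cup_D)

lemma counit_simps [simp]:
  "A \<in> Ob C \<Longrightarrow> \<epsilon> A \<in> Arr C" "A \<in> Ob C \<Longrightarrow> Dom C (\<epsilon> A) = A \<otimes> A\<^bold>*" "A \<in> Ob C \<Longrightarrow> Cod C (\<epsilon> A) = \<I>"
  by (simp_all add: counit_def)

lemma dagger_compact_category_D: "dagger_compact_category D"
proof (intro dagger_compact_category.intro dagger_symmetric_monoidal_category_D dagger_compact_category_axioms.intro)
  fix A assume "A \<in> Ob D"
  then have A: "A \<in> Ob C" by simp
  show "Dual D A \<in> Ob D" using A by (simp add: dual_D)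
  show "Cup D A \<in> hom D (Unit D) (TenO D (Dual D A) A)"
    using A by (simp add: dual_D cup_D)
  show "Comp D (Lunit D A) (Comp D (TenA D (counit D A) (Id D A)) (Comp D (Dag D (Assoc D A (Dual D A) A))
      (Comp D (TenA D (Id D A) (Cup D A)) (Dag D (Runit D A))))) = Id D A"
    using snake [OF A] A by (simp add: counit_D dual_D cup_D)
  show "Comp D (Runit D (Dual D A)) (Comp D (TenA D (Id D (Dual D A)) (counit D A)) (Comp D (Assoc D (Dual D A) A (Dual D A))
      (Comp D (TenA D (Cup D A) (Id D (Dual D A))) (Dag D (Lunit D (Dual D A)))))) = Id D (Dual D A)"
    using snake_dual [OF A] A by (simp add: counit_D dual_D cup_D)
qed

end

section \<open>Typed arrows\<close>

text \<open>Recording domain and codomain in the arrow makes \<open>Dom\<close> and \<open>Cod\<close> of composites and tensors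
  computable without well-typedness side conditions, as required by \<open>typed_dcc\<close>.\<close>

definition typed :: "('o, 'm, 'x) dccat_scheme \<Rightarrow> ('o, 'o \<times> 'm \<times> 'o) dccat" where
  "typed C = \<lparr>
    Ob = Ob C,
    Arr = {(A, f, B). f \<in> hom C A B},
    Dom = (\<lambda>(A, f, B). A),
    Cod = (\<lambda>(A, f, B). B),
    Id = (\<lambda>A. (A, Id C A, A)),
    Comp = (\<lambda>(B', g, D) (A, f, B). (A, Comp C g f, D)),
    Unit = Unit C,
    TenO = TenO C,
    TenA = (\<lambda>(A, f, B) (A', f', B'). (TenO C A A', TenA C f f', TenO C B B')),
    Assoc = (\<lambda>A B D. (TenO C (TenO C A B) D, Assoc C A B D, TenO C A (TenO C B D))),
    Lunit = (\<lambda>A. (TenO C (Unit C) A, Lunit C A, A)),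
    Runit = (\<lambda>A. (TenO C A (Unit C), Runit C A, A)),
    Symm = (\<lambda>A B. (TenO C A B, Symm C A B, TenO C B A)),
    Dag = (\<lambda>(A, f, B). (B, Dag C f, A)),
    Dual = Dual C,
    Cup = (\<lambda>A. (Unit C, Cup C A, TenO C (Dual C A) A)) \<rparr>"

context dagger_compact_category
begin

lemma homE: "f \<in> hom C A B \<Longrightarrow> f \<in> Arr C \<and> Dom C f = A \<and> Cod C f = B"
  by (simp add: hom_def)

lemma typed_sel [simp]:
  "Ob (typed C) = Ob C" "(A, f, B) \<in> Arr (typed C) \<longleftrightarrow> f \<in> hom C A B"
  "Dom (typed C) (A, f, B) = A" "Cod (typed C) (A, f, B) = B" "Id (typed C) A = (A, \<one> A, A)"
  "Comp (typed C) (B', g, D) (A, f, B) = (A, g \<cdot> f, D)" "Unit (typed C) = \<I>" "TenO (typed C) = TenO C"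
  "TenA (typed C) (A, f, B) (A', f', B') = (A \<otimes> A', f \<boxtimes> f', B \<otimes> B')"
  "Assoc (typed C) A B D = ((A \<otimes> B) \<otimes> D, \<alpha> A B D, A \<otimes> (B \<otimes> D))"
  "Lunit (typed C) A = (\<I> \<otimes> A, \<ll> A, A)" "Runit (typed C) A = (A \<otimes> \<I>, \<rho> A, A)"
  "Symm (typed C) A B = (A \<otimes> B, \<sigma> A B, B \<otimes> A)" "Dag (typed C) (A, f, B) = (B, f\<dagger>, A)"
  "Dual (typed C) = Dual C" "Cup (typed C) A = (\<I>, \<eta> A, A\<^bold>* \<otimes> A)"
  by (simp_all add: typed_def)

lemma hom_typed: "x \<in> hom (typed C) A B \<longleftrightarrow> (\<exists>f \<in> hom C A B. x = (A, f, B))"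
  by (cases x) (auto simp: hom_def [of "typed C"])

text \<open>Attaching types is an isomorphism, so the laws are transported from \<open>C\<close>.
  The unconditional equations for domains and codomains hold by computation on triples.\<close>

lemma typed_dcc_typed: "typed_dcc (typed C)"
proof -
  let ?F = "\<lambda>f. (Dom C f, f, Cod C f)"
  have "bij_betw ?F (Arr C) (Arr (typed C))"
    by (auto simp: bij_betw_def inj_on_def image_iff hom_def)
  then have "dsmc_iso C (typed C) (\<lambda>A. A) ?F"
    using homE [OF id_hom] homE [OF comp_hom] homE [OF tensor_hom] homE [OF dag_hom]
      assoc_iso lunit_iso runit_iso symm_iso
    by (auto simp: dsmc_iso_def hom_def iso_hom_def bij_betw_def [of "\<lambda>A. A"])
  then interpret dcc_transport C "typed C" ?F
    using homE [OF cup_hom] by unfold_locales simp_all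
  interpret T: dagger_compact_category "typed C" by (rule dagger_compact_category_D)
  show ?thesis
    by unfold_locales (simp_all add: split_paired_all split: prod.split)
qed


section \<open>Kraus morphisms of \<open>C\<close> and of its typed copy\<close>

abbreviation (input) lift :: "'o \<Rightarrow> 'o \<Rightarrow> 'o \<times> 'm \<Rightarrow> 'o \<times> ('o \<times> 'm \<times> 'o)" where
  "lift A B \<equiv> (\<lambda>(X, f). (X, (A, f, X \<otimes> B)))"

lemma kraus_typed: "kraus (typed C) A B = lift A B ` kraus C A B"
  by (force simp: kraus_def hom_typed)

lemma conj_arr_typed:
  "f \<in> hom C A B \<Longrightarrow> conj_arr (typed C) (A, f, B) = (A\<^bold>*, conj_arr C f, B\<^bold>*)"
  using homE [OF dag_hom [of f A B]] by (simp add: conj_arr_def transp_def counit_def Let_def)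

lemma cpm_map_typed:
  assumes "p \<in> kraus C A B"
  shows "cpm_map (typed C) B (lift A B p) = (A\<^bold>* \<otimes> A, cpm_map C B p, B\<^bold>* \<otimes> B)"
  using assms
  by (auto simp: kraus_def cpm_map_def ancilla_cap_def dual_tensor_def nested_cup_def counit_def conj_arr_typed)

lemma kraus_test_typed:
  "kraus_test (typed C) B Y (B \<otimes> Y, h, Z) (lift A B p) = (A \<otimes> Y, kraus_test C B Y h p, A \<otimes> Y)"
  by (cases p) (simp add: kraus_test_def)

lemma kraus_comp_typed:
  "kraus_comp (typed C) D (lift B D q) (lift A B p) = lift A D (kraus_comp C D q p)"
  by (cases p, cases q) (simp add: kraus_comp_def)

lemma kraus_tensor_typed:
  "kraus_tensor (typed C) B B' (lift A B p) (lift A' B' q) = lift (A \<otimes> A') (B \<otimes> B') (kraus_tensor C B B' p q)"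
  by (cases p, cases q) (simp add: kraus_tensor_def middle_swap_def)

lemma lift_kraus: "lift A B p \<in> kraus (typed C) A B \<longleftrightarrow> p \<in> kraus C A B"
  by (cases p) (auto simp: kraus_typed)

end

context dagger_compact_category
begin

interpretation T: typed_dcc "typed C" by (rule typed_dcc_typed)

lemma krausE:
  assumes "p \<in> kraus C A B"
  obtains X f where "p = (X, f)" "X \<in> Ob C" "f \<in> hom C A (X \<otimes> B)" "A \<in> Ob C"
  using assms dom_ob by (auto simp: kraus_def hom_def)

lemma assoc_hom: "A \<in> Ob C \<Longrightarrow> B \<in> Ob C \<Longrightarrow> D \<in> Ob C \<Longrightarrow> \<alpha> A B D \<in> hom C ((A \<otimes> B) \<otimes> D) (A \<otimes> (B \<otimes> D))"
  using assoc_iso by (simp add: iso_hom_def)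

lemma symm_hom: "A \<in> Ob C \<Longrightarrow> B \<in> Ob C \<Longrightarrow> \<sigma> A B \<in> hom C (A \<otimes> B) (B \<otimes> A)"
  using symm_iso by (simp add: iso_hom_def)

lemma kraus_comp_in:
  assumes "p \<in> kraus C A B" "q \<in> kraus C B D" "D \<in> Ob C"
  shows "kraus_comp C D q p \<in> kraus C A D"
proof -
  obtain X f where f: "p = (X, f)" "X \<in> Ob C" "f \<in> hom C A (X \<otimes> B)" using assms(1) by (rule krausE)
  obtain Y g where g: "q = (Y, g)" "Y \<in> Ob C" "g \<in> hom C B (Y \<otimes> D)" using assms(2) by (rule krausE)
  show ?thesis
    using comp_hom [OF comp_hom [OF f(3) tensor_hom [OF id_hom [OF f(2)] g(3)]] dag_hom [OF assoc_hom [OF f(2) g(2) assms(3)]]]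
      comp_assoc [OF f(3) tensor_hom [OF id_hom [OF f(2)] g(3)] dag_hom [OF assoc_hom [OF f(2) g(2) assms(3)]]]
      f g by (simp add: kraus_def kraus_comp_def tensor_ob)
qed

lemma kraus_tensor_in:
  assumes "p \<in> kraus C A B" "q \<in> kraus C A' B'" "B \<in> Ob C" "B' \<in> Ob C"
  shows "kraus_tensor C B B' p q \<in> kraus C (A \<otimes> A') (B \<otimes> B')"
proof -
  obtain X f where f: "p = (X, f)" "X \<in> Ob C" "f \<in> hom C A (X \<otimes> B)" using assms(1) by (rule krausE)
  obtain Y g where g: "q = (Y, g)" "Y \<in> Ob C" "g \<in> hom C A' (Y \<otimes> B')" using assms(2) by (rule krausE)
  have "middle_swap C X B Y B' \<in> hom C ((X \<otimes> B) \<otimes> (Y \<otimes> B')) ((X \<otimes> Y) \<otimes> (B \<otimes> B'))"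
    unfolding middle_swap_def
    by (rule comp_hom dag_hom assoc_hom tensor_hom id_hom symm_hom tensor_ob f(2) g(2) assms(3,4))+
  from comp_hom [OF tensor_hom [OF f(3) g(3)] this] show ?thesis
    using f g by (simp add: kraus_def kraus_tensor_def tensor_ob)
qed

lemma cpm_map_kraus_comp:
  assumes "p \<in> kraus C A B" "q \<in> kraus C B D" "B \<in> Ob C" "D \<in> Ob C"
  shows "cpm_map C D (kraus_comp C D q p) = cpm_map C D q \<cdot> cpm_map C B p"
proof -
  obtain X f where f: "p = (X, f)" "X \<in> Ob C" "f \<in> hom C A (X \<otimes> B)" using assms(1) by (rule krausE)
  obtain Y g where g: "q = (Y, g)" "Y \<in> Ob C" "g \<in> hom C B (Y \<otimes> D)" using assms(2) by (rule krausE)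
  have "cpm_map (typed C) D (kraus_comp (typed C) D (lift B D q) (lift A B p)) =
    Comp (typed C) (cpm_map (typed C) D (lift B D q)) (cpm_map (typed C) B (lift A B p))"
    unfolding f(1) g(1) prod.case using f g assms by (intro T.cpm_map_comp) simp_all
  then show ?thesis
    unfolding kraus_comp_typed cpm_map_typed [OF assms(1)] cpm_map_typed [OF assms(2)] cpm_map_typed [OF kraus_comp_in [OF assms(1,2,4)]]
    by (simp only: typed_sel prod.inject)
qed

text \<open>The explicit formula uses \<open>T.ml\<close>, which lives in the typed copy. What is
  carried back is its consequence that the tensor depends only on the two maps.\<close>

lemma cpm_map_kraus_tensor:
  assumes "p \<in> kraus C A B" "p' \<in> kraus C A B" "q \<in> kraus C A' B'" "q' \<in> kraus C A' B'" "B \<in> Ob C" "B' \<in> Ob C"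
    and "cpm_map C B p = cpm_map C B p'" "cpm_map C B' q = cpm_map C B' q'"
  shows "cpm_map C (B \<otimes> B') (kraus_tensor C B B' p q) = cpm_map C (B \<otimes> B') (kraus_tensor C B B' p' q')"
proof -
  have *: "cpm_map (typed C) (B \<otimes> B') (lift (A \<otimes> A') (B \<otimes> B') (kraus_tensor C B B' p q)) = Comp (typed C) (T.ml B B') (Comp (typed C)
     (TenA (typed C) (cpm_map (typed C) B (lift A B p)) (cpm_map (typed C) B' (lift A' B' q))) (Dag (typed C) (T.ml A A')))"
    if pq: "p \<in> kraus C A B" "q \<in> kraus C A' B'" for p q
  proof -
    obtain X f where f: "p = (X, f)" "X \<in> Ob C" "f \<in> hom C A (X \<otimes> B)" using pq(1) by (rule krausE)
    obtain Y g where g: "q = (Y, g)" "Y \<in> Ob C" "g \<in> hom C A' (Y \<otimes> B')" using pq(2) by (rule krausE)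
    have "cpm_map (typed C) (TenO (typed C) B B') (kraus_tensor (typed C) B B' (lift A B p) (lift A' B' q)) =
       Comp (typed C) (T.ml B B') (Comp (typed C)
     (TenA (typed C) (cpm_map (typed C) B (lift A B p)) (cpm_map (typed C) B' (lift A' B' q))) 
       (Dag (typed C) (T.ml (Dom (typed C) (A, f, X \<otimes> B)) (Dom (typed C) (A', g, Y \<otimes> B')))))"
      unfolding f(1) g(1) prod.case using f g assms by (intro T.cpm_map_tensor) simp_all
    then show ?thesis by (simp only: typed_sel kraus_tensor_typed)
  qed
  have "cpm_map (typed C) (B \<otimes> B') (lift (A \<otimes> A') (B \<otimes> B') (kraus_tensor C B B' p q)) =
    cpm_map (typed C) (B \<otimes> B') (lift (A \<otimes> A') (B \<otimes> B') (kraus_tensor C B B' p' q'))"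
    unfolding * [OF assms(1,3)] * [OF assms(2,4)] cpm_map_typed [OF assms(1)] cpm_map_typed [OF assms(2)]
      cpm_map_typed [OF assms(3)] cpm_map_typed [OF assms(4)] assms(7,8) ..
  then show ?thesis
    unfolding cpm_map_typed [OF kraus_tensor_in [OF assms(1,3,5,6)]] cpm_map_typed [OF kraus_tensor_in [OF assms(2,4,5,6)]]
    by (simp only: prod.inject)
qed

text \<open>Tests in the typed copy are exactly the triples made from tests in \<open>C\<close>, so
  \<open>kraus_rel_iff\<close> descends.\<close>

lemma kraus_rel_cpm_map:
  assumes "A \<in> Ob C" "B \<in> Ob C"
  shows "kraus_rel C A B = {(p, q). p \<in> kraus C A B \<and> q \<in> kraus C A B \<and> cpm_map C B p = cpm_map C B q}"
proof -
  have "(\<forall>Y \<in> Ob C. \<forall>Z \<in> Ob C. \<forall>h \<in> hom C (B \<otimes> Y) Z. kraus_test C B Y h p = kraus_test C B Y h q) \<longleftrightarrow>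
      cpm_map C B p = cpm_map C B q" if "p \<in> kraus C A B" "q \<in> kraus C A B" for p q
  proof -
    have "(\<forall>Y \<in> Ob C. \<forall>Z \<in> Ob C. \<forall>h \<in> hom C (B \<otimes> Y) Z. kraus_test C B Y h p = kraus_test C B Y h q) \<longleftrightarrow>
      (\<forall>Y \<in> Ob C. \<forall>Z \<in> Ob C. \<forall>h \<in> hom C (B \<otimes> Y) Z. 
        kraus_test (typed C) B Y (B \<otimes> Y, h, Z) (lift A B p) = kraus_test (typed C) B Y (B \<otimes> Y, h, Z) (lift A B q))"
      by (simp only: kraus_test_typed prod.inject simp_thms)
    also have "\<dots> \<longleftrightarrow> (\<forall>Y \<in> Ob (typed C). \<forall>Z \<in> Ob (typed C). \<forall>h \<in> hom (typed C) (TenO (typed C) B Y) Z. 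
        kraus_test (typed C) B Y h (lift A B p) = kraus_test (typed C) B Y h (lift A B q))"
      by (simp only: typed_sel Ball_def hom_typed) blast
    also have "\<dots> \<longleftrightarrow> (lift A B p, lift A B q) \<in> kraus_rel (typed C) A B"
      using that by (simp only: kraus_rel_def mem_Collect_eq prod.case lift_kraus simp_thms)
    also have "\<dots> \<longleftrightarrow> cpm_map (typed C) B (lift A B p) = cpm_map (typed C) B (lift A B q)"
      using that assms by (subst T.kraus_rel_iff) (simp_all only: typed_sel mem_Collect_eq prod.case lift_kraus simp_thms)
    also have "\<dots> \<longleftrightarrow> cpm_map C B p = cpm_map C B q"
      using that by (simp only: cpm_map_typed prod.inject simp_thms)
    finally show ?thesis .
  qed
  note eq = this
  show ?thesis unfolding kraus_rel_def
    by (rule Collect_cong) (simp only: split_paired_all prod.case eq cong: conj_cong)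
qed

lemma dbl_typed:
  assumes "c \<in> hom C A B"
  shows "T.dbl (A, c, B) = (A\<^bold>* \<otimes> A, conj_arr C c \<boxtimes> c, B\<^bold>* \<otimes> B)"
  by (simp only: T.dbl_def conj_arr_typed [OF assms] typed_sel)

lemma lunit_hom: "A \<in> Ob C \<Longrightarrow> \<ll> A \<in> hom C (\<I> \<otimes> A) A"
  using lunit_iso by (simp add: iso_hom_def)

lemma runit_hom: "A \<in> Ob C \<Longrightarrow> \<rho> A \<in> hom C (A \<otimes> \<I>) A"
  using runit_iso by (simp add: iso_hom_def)

lemma cpm_map_lunit:
  assumes "c \<in> hom C A B"
  shows "(\<I>, (\<ll> B)\<dagger> \<cdot> c) \<in> kraus C A B" "cpm_map C B (\<I>, (\<ll> B)\<dagger> \<cdot> c) = conj_arr C c \<boxtimes> c"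
proof -
  have "B \<in> Ob C" using assms cod_ob by (auto simp: hom_def)
  then show *: "(\<I>, (\<ll> B)\<dagger> \<cdot> c) \<in> kraus C A B"
    using comp_hom [OF assms dag_hom [OF lunit_hom]] unit_ob by (simp add: kraus_def)
  have "cpm_map (typed C) B (Unit (typed C), Comp (typed C) (Dag (typed C) (Lunit (typed C) B)) (A, c, B)) = T.dbl (A, c, B)"
    using assms by (intro T.cpm_map_pure) (simp_all only: typed_sel)
  then have "cpm_map (typed C) B (lift A B (\<I>, (\<ll> B)\<dagger> \<cdot> c)) = T.dbl (A, c, B)"
    by (simp only: typed_sel prod.case)
  then show "cpm_map C B (\<I>, (\<ll> B)\<dagger> \<cdot> c) = conj_arr C c \<boxtimes> c"
    unfolding cpm_map_typed [OF *] dbl_typed [OF assms] by (simp only: prod.inject)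
qed

lemma TenA_CPM:
  assumes "p \<in> kraus C A B" "q \<in> kraus C A' B'" "B \<in> Ob C" "B' \<in> Ob C"
  shows "TenA (CPM C) (A, B, cpm_map C B p) (A', B', cpm_map C B' q) =
    (A \<otimes> A', B \<otimes> B', cpm_map C (B \<otimes> B') (kraus_tensor C B B' p q))"
proof -
  have "(THE \<omega>. \<exists>p'\<in>kraus C A B. \<exists>q'\<in>kraus C A' B'. cpm_map C B p = cpm_map C B p' \<and> cpm_map C B' q = cpm_map C B' q' \<and>
      \<omega> = cpm_map C (B \<otimes> B') (kraus_tensor C B B' p' q')) = cpm_map C (B \<otimes> B') (kraus_tensor C B B' p q)"
    using assms cpm_map_kraus_tensor by - (rule the_equality, blast, metis)
  then show ?thesis by (simp add: CPM_def)
qed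

lemma CPM_sel [simp]:
  "Ob (CPM C) = Ob C" 
  "Dom (CPM C) (A, B, \<phi>) = A" "Cod (CPM C) (A, B, \<phi>) = B" "Id (CPM C) A = (A, A, \<one> (A\<^bold>* \<otimes> A))"
  "Comp (CPM C) (B', D, \<psi>) (A, B, \<phi>) = (A, D, \<psi> \<cdot> \<phi>)"
  "Unit (CPM C) = \<I>" "TenO (CPM C) = TenO C"
  "Assoc (CPM C) A B D = doubled C (\<alpha> A B D)"
  "Lunit (CPM C) A = doubled C (\<ll> A)" "Runit (CPM C) A = doubled C (\<rho> A)"
  "Symm (CPM C) A B = doubled C (\<sigma> A B)"
  "Dag (CPM C) (A, B, \<phi>) = (B, A, \<phi>\<dagger>)" "Dual (CPM C) = Dual C" "Cup (CPM C) A = doubled C (\<eta> A)"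
  by (auto simp: CPM_def)

lemma Arr_CPM: "Arr (CPM C) = {(A, B, cpm_map C B p) | A B p. A \<in> Ob C \<and> B \<in> Ob C \<and> p \<in> kraus C A B}"
  by (auto simp: CPM_def)

end

context dagger_compact_category
begin

interpretation T: typed_dcc "typed C" by (rule typed_dcc_typed)

section \<open>From CPM of the typed copy to CPM of \<open>C\<close>\<close>

lemma Arr_CPM_typed:
  "Arr (CPM (typed C)) = {(A, B, (A\<^bold>* \<otimes> A, cpm_map C B p, B\<^bold>* \<otimes> B)) | A B p. A \<in> Ob C \<and> B \<in> Ob C \<and> p \<in> kraus C A B}"
proof -
  have "T.cpms A B = {(A\<^bold>* \<otimes> A, cpm_map C B p, B\<^bold>* \<otimes> B) | p. p \<in> kraus C A B}" for A B
  proof -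
    have "T.cpms A B = {cpm_map (typed C) B (lift A B p) | p. p \<in> kraus C A B}"
      unfolding T.cpms_def kraus_typed by blast
    then show ?thesis by (simp only: cpm_map_typed cong: rev_conj_cong)
  qed
  then show ?thesis unfolding T.CPM_simps typed_sel by blast
qed

text \<open>Forgets the types of the inner arrow only. They are determined by \<open>A\<close> and
  \<open>B\<close>, which is why it is injective on the arrows of CPM.\<close>

definition untyped :: "'o \<times> 'o \<times> ('o \<times> 'm \<times> 'o) \<Rightarrow> 'o \<times> 'o \<times> 'm" where
  "untyped = (\<lambda>(A, B, (M, \<phi>, N)). (A, B, \<phi>))"

lemma untyped_doubled:
  assumes "c \<in> hom C A B" shows "untyped (doubled (typed C) (A, c, B)) = doubled C c"
  using assms by (auto simp: untyped_def doubled_def conj_arr_typed hom_def [of C])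

lemma dsmc_iso_untyped: "dsmc_iso (CPM (typed C)) (CPM C) (\<lambda>A. A) untyped"
proof -
  let ?T = "CPM (typed C)"
  have "bij_betw untyped (Arr ?T) (Arr (CPM C))"
    unfolding Arr_CPM_typed Arr_CPM bij_betw_def inj_on_def untyped_def by force
  moreover have "untyped (TenA ?T f g) = TenA (CPM C) (untyped f) (untyped g)" if fg: "f \<in> Arr ?T" "g \<in> Arr ?T" for f g
  proof -
    obtain A B p where f: "f = (A, B, (A\<^bold>* \<otimes> A, cpm_map C B p, B\<^bold>* \<otimes> B))" and p: "A \<in> Ob C" "B \<in> Ob C" "p \<in> kraus C A B"
      using fg(1) unfolding Arr_CPM_typed by blast
    obtain A' B' q where g: "g = (A', B', (A'\<^bold>* \<otimes> A', cpm_map C B' q, B'\<^bold>* \<otimes> B'))" and q: "A' \<in> Ob C" "B' \<in> Ob C" "q \<in> kraus C A' B'"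
      using fg(2) unfolding Arr_CPM_typed by blast
    have "TenA ?T (A, B, cpm_map (typed C) B (lift A B p)) (A', B', cpm_map (typed C) B' (lift A' B' q)) =
      (TenO (typed C) A A', TenO (typed C) B B', cpm_map (typed C) (TenO (typed C) B B') (kraus_tensor (typed C) B B' (lift A B p) (lift A' B' q)))"
      using p q by (intro T.TenA_CPM) (simp_all only: lift_kraus typed_sel)
    then show ?thesis
      unfolding f g untyped_def kraus_tensor_typed typed_sel cpm_map_typed [OF p(3)] cpm_map_typed [OF q(3)]
        cpm_map_typed [OF kraus_tensor_in [OF p(3) q(3) p(2) q(2)]]
      using TenA_CPM [OF p(3) q(3) p(2) q(2)] by (simp only: prod.case)
  qed
  moreover have "untyped (Assoc ?T A B D) = Assoc (CPM C) A B D" if "A \<in> Ob C" "B \<in> Ob C" "D \<in> Ob C" for A B D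
    using untyped_doubled [OF assoc_hom [OF that]] by (simp only: CPM_sel T.CPM_sel typed_sel)
  moreover have "untyped (Lunit ?T A) = Lunit (CPM C) A" "untyped (Runit ?T A) = Runit (CPM C) A" if "A \<in> Ob C" for A
    using untyped_doubled [OF lunit_hom [OF that]] untyped_doubled [OF runit_hom [OF that]] by (simp_all only: CPM_sel T.CPM_sel typed_sel)
  moreover have "untyped (Symm ?T A B) = Symm (CPM C) A B" if "A \<in> Ob C" "B \<in> Ob C" for A B
    using untyped_doubled [OF symm_hom [OF that]] by (simp only: CPM_sel T.CPM_sel typed_sel)
  moreover have "Dom (CPM C) (untyped f) = Dom ?T f" "Cod (CPM C) (untyped f) = Cod ?T f" "untyped (Dag ?T f) = Dag (CPM C) (untyped f)"
    "untyped (Comp ?T g f) = Comp (CPM C) (untyped g) (untyped f)" for f g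
    by (cases f, cases g, simp only: untyped_def CPM_sel T.CPM_sel typed_sel prod.case split: prod.split)+
  moreover have "untyped (Id ?T A) = Id (CPM C) A" for A
    by (simp only: untyped_def CPM_sel T.CPM_sel typed_sel prod.case)
  ultimately show ?thesis
    unfolding dsmc_iso_def by (simp only: CPM_sel T.CPM_sel typed_sel bij_betw_id [unfolded id_def] simp_thms Ball_def) simp
qed

lemma dagger_compact_category_CPM: "dagger_compact_category (CPM C)"
proof -
  interpret K: dagger_compact_category "CPM (typed C)" by (rule T.CPM_dagger_compact)
  interpret dcc_transport "CPM (typed C)" "CPM C" untyped
  proof
    show "dsmc_iso (CPM (typed C)) (CPM C) (\<lambda>A. A) untyped" by (rule dsmc_iso_untyped)
    fix A assume "A \<in> Ob (CPM (typed C))"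
    then have "A \<in> Ob C" by (simp only: T.CPM_sel typed_sel)
    from untyped_doubled [OF cup_hom [OF this]]
    show "Cup (CPM C) A = untyped (Cup (CPM (typed C)) A)" by (simp only: CPM_sel T.CPM_sel typed_sel)
    show "Dual (CPM C) A = Dual (CPM (typed C)) A" by (simp only: CPM_sel T.CPM_sel typed_sel)
  qed
  show ?thesis by (rule dagger_compact_category_D)
qed

section \<open>Comparison with CP-infinity\<close>

lemma kraus_class_cpm_map:
  assumes "p \<in> kraus C A B" "B \<in> Ob C"
  shows "kraus_class C A B p = {q \<in> kraus C A B. cpm_map C B q = cpm_map C B p}"
proof -
  have "A \<in> Ob C" using assms dom_ob by (auto simp: kraus_def hom_def)
  then show ?thesis using assms by (auto simp: kraus_class_def kraus_rel_cpm_map)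
qed

text \<open>A completely positive map is sent to the set of all its Kraus morphisms. These fibres of
  \<open>cpm_map\<close> are precisely the classes, by \<open>kraus_rel_cpm_map\<close>.\<close>

definition cpinf_of :: "'o \<times> 'o \<times> 'm \<Rightarrow> 'o \<times> 'o \<times> ('o \<times> 'm) set" where
  "cpinf_of = (\<lambda>(A, B, \<phi>). (A, B, {p \<in> kraus C A B. cpm_map C B p = \<phi>}))"

lemma cpinf_of_cpm_map:
  "p \<in> kraus C A B \<Longrightarrow> B \<in> Ob C \<Longrightarrow> cpinf_of (A, B, cpm_map C B p) = (A, B, kraus_class C A B p)"
  by (simp add: cpinf_of_def kraus_class_cpm_map)

lemma bij_cpinf_of: "bij_betw cpinf_of (Arr (CPM C)) (Arr (CPinf C))"
proof -
  have "inj_on cpinf_of (Arr (CPM C))"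
    unfolding Arr_CPM inj_on_def cpinf_of_def by auto
  moreover have "cpinf_of ` Arr (CPM C) = Arr (CPinf C)"
  proof -
    have "Arr (CPinf C) = {(A, B, kraus_class C A B p) | A B p. A \<in> Ob C \<and> B \<in> Ob C \<and> p \<in> kraus C A B}"
      by (auto simp: CPinf_def quotient_def kraus_class_def)
    also have "\<dots> = cpinf_of ` Arr (CPM C)"
      unfolding Arr_CPM by (force simp: cpinf_of_cpm_map)
    finally show ?thesis ..
  qed
  ultimately show ?thesis by (simp add: bij_betw_def)
qed

text \<open>The dagger of CPM transported along the bijection, so that no Kraus morphism for the
  dagger of a class has to be chosen.\<close>

definition cpinf_dag :: "'o \<times> 'o \<times> ('o \<times> 'm) set \<Rightarrow> 'o \<times> 'o \<times> ('o \<times> 'm) set" where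
  "cpinf_dag x = cpinf_of (Dag (CPM C) (inv_into (Arr (CPM C)) cpinf_of x))"

lemma cpinf_of_doubled:
  assumes "c \<in> hom C A B"
  shows "cpinf_of (doubled C c) = pure_class C c"
  using assms cpm_map_lunit [OF assms] cod_ob [of c]
  by (auto simp: doubled_def pure_class_def hom_def simp flip: cpinf_of_cpm_map)

text \<open>Operations on classes are unions over representatives. Both classes are inhabited and
  all terms of the union agree, so it equals any one of them.\<close>

lemma UN_UN_const:
  assumes "a \<in> S" "b \<in> T" "\<And>x y. x \<in> S \<Longrightarrow> y \<in> T \<Longrightarrow> f x y = c"
  shows "(\<Union>x \<in> S. \<Union>y \<in> T. f x y) = c"
  using assms by (simp cong: SUP_cong) (metis empty_iff)

lemma Comp_CPinf:
  assumes "p \<in> kraus C A B" "q \<in> kraus C B D" "B \<in> Ob C" "D \<in> Ob C"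
  shows "Comp (CPinf C) (B, D, kraus_class C B D q) (A, B, kraus_class C A B p) = (A, D, kraus_class C A D (kraus_comp C D q p))"
proof -
  have "kraus_class C A D (kraus_comp C D q' p') = kraus_class C A D (kraus_comp C D q p)"
    if "q' \<in> kraus_class C B D q" "p' \<in> kraus_class C A B p" for p' q'
    using that assms kraus_comp_in [of p' A B q' D] kraus_comp_in [of p A B q D]
      cpm_map_kraus_comp [of p' A B q' D] cpm_map_kraus_comp [of p A B q D]
    by (simp add: kraus_class_cpm_map)
  moreover have "p \<in> kraus_class C A B p" "q \<in> kraus_class C B D q"
    using assms by (simp_all add: kraus_class_cpm_map)
  ultimately have "(\<Union>q' \<in> kraus_class C B D q. \<Union>p' \<in> kraus_class C A B p. kraus_class C A D (kraus_comp C D q' p')) =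
      kraus_class C A D (kraus_comp C D q p)"
    by (intro UN_UN_const)
  then show ?thesis by (simp add: CPinf_def)
qed

lemma TenA_CPinf:
  assumes "p \<in> kraus C A B" "q \<in> kraus C A' B'" "B \<in> Ob C" "B' \<in> Ob C"
  shows "TenA (CPinf C) (A, B, kraus_class C A B p) (A', B', kraus_class C A' B' q) =
    (A \<otimes> A', B \<otimes> B', kraus_class C (A \<otimes> A') (B \<otimes> B') (kraus_tensor C B B' p q))"
proof -
  have "kraus_class C (A \<otimes> A') (B \<otimes> B') (kraus_tensor C B B' p' q') = kraus_class C (A \<otimes> A') (B \<otimes> B') (kraus_tensor C B B' p q)"
    if "p' \<in> kraus_class C A B p" "q' \<in> kraus_class C A' B' q" for p' q'
    using that assms cpm_map_kraus_tensor [of p' A B p q' A' B' q] by (simp add: kraus_class_cpm_map kraus_tensor_in tensor_ob)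
  moreover have "p \<in> kraus_class C A B p" "q \<in> kraus_class C A' B' q"
    using assms by (simp_all add: kraus_class_cpm_map)
  ultimately have "(\<Union>p' \<in> kraus_class C A B p. \<Union>q' \<in> kraus_class C A' B' q. kraus_class C (A \<otimes> A') (B \<otimes> B') (kraus_tensor C B B' p' q')) =
      kraus_class C (A \<otimes> A') (B \<otimes> B') (kraus_tensor C B B' p q)"
    by (intro UN_UN_const)
  then show ?thesis by (simp add: CPinf_def)
qed

end

lemma with_dagger_sel [simp]:
  "Ob (with_dagger S d) = Ob S" "Arr (with_dagger S d) = Arr S" "Dom (with_dagger S d) = Dom S" "Cod (with_dagger S d) = Cod S"
  "Id (with_dagger S d) = Id S" "Comp (with_dagger S d) = Comp S" "Unit (with_dagger S d) = Unit S" "TenO (with_dagger S d) = TenO S"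
  "TenA (with_dagger S d) = TenA S" "Assoc (with_dagger S d) = Assoc S" "Lunit (with_dagger S d) = Lunit S" "Runit (with_dagger S d) = Runit S"
  "Symm (with_dagger S d) = Symm S" "Dag (with_dagger S d) = d"
  by (simp_all add: with_dagger_def smcat.extend_def dsmcat.fields_def)

lemma with_duals_sel [simp]:
  "Ob (with_duals S du cu) = Ob S" "Arr (with_duals S du cu) = Arr S" "Dom (with_duals S du cu) = Dom S" "Cod (with_duals S du cu) = Cod S"
  "Id (with_duals S du cu) = Id S" "Comp (with_duals S du cu) = Comp S" "Unit (with_duals S du cu) = Unit S" "TenO (with_duals S du cu) = TenO S"
  "TenA (with_duals S du cu) = TenA S" "Assoc (with_duals S du cu) = Assoc S" "Lunit (with_duals S du cu) = Lunit S" "Runit (with_duals S du cu) = Runit S"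
  "Symm (with_duals S du cu) = Symm S" "Dag (with_duals S du cu) = Dag S" "Dual (with_duals S du cu) = du" "Cup (with_duals S du cu) = cu"
  by (simp_all add: with_duals_def dsmcat.extend_def dccat.fields_def)

lemma dsmc_iso_with_duals:
  "dsmc_iso S (with_duals R du cu) F0 F \<longleftrightarrow> dsmc_iso S R F0 F"
  by (simp add: dsmc_iso_def)

context dagger_compact_category
begin

lemma CPinf_sel:
  "Ob (CPinf C) = Ob C" "Dom (CPinf C) (A, B, Q) = A" "Cod (CPinf C) (A, B, Q) = B"
  "Id (CPinf C) A = (A, A, kraus_class C A A (\<I>, (\<ll> A)\<dagger>))" "Unit (CPinf C) = \<I>" "TenO (CPinf C) = TenO C"
  "Assoc (CPinf C) A B D = pure_class C (\<alpha> A B D)" "Lunit (CPinf C) A = pure_class C (\<ll> A)"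
  "Runit (CPinf C) A = pure_class C (\<rho> A)" "Symm (CPinf C) A B = pure_class C (\<sigma> A B)"
  by (simp_all add: CPinf_def)

section \<open>The isomorphism from CPM to CP-infinity\<close>

lemma CPM_arrE:
  assumes "f \<in> Arr (CPM C)"
  obtains A B p where "f = (A, B, cpm_map C B p)" "A \<in> Ob C" "B \<in> Ob C" "p \<in> kraus C A B"
  using assms unfolding Arr_CPM by blast

lemma conj_arr_id:
  assumes "A \<in> Ob C" shows "conj_arr C (\<one> A) = \<one> (A\<^bold>*)"
proof -
  interpret T: typed_dcc "typed C" by (rule typed_dcc_typed)
  have "conj_arr (typed C) (Id (typed C) A) = Id (typed C) (Dual (typed C) A)"
    using assms by (intro T.conj_id) (simp only: typed_sel)
  then show ?thesis using conj_arr_typed [OF id_hom [OF assms]] by (simp only: typed_sel prod.inject)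
qed

text \<open>The Kraus morphism \<open>(\<ll> A)\<dagger>\<close> is the pure one for the identity
  arrow, whose doubled arrow is an identity since conjugation preserves identities.\<close>

lemma cpinf_of_id:
  assumes "A \<in> Ob C" shows "cpinf_of (Id (CPM C) A) = Id (CPinf C) A"
proof -
  note k = cpm_map_lunit [OF id_hom [OF assms]]
  have "(\<ll> A)\<dagger> \<cdot> \<one> A = (\<ll> A)\<dagger>" by (rule comp_id [OF dag_hom [OF lunit_hom [OF assms]]])
  then show ?thesis
    using k cpinf_of_cpm_map [OF k(1) assms] assms by (simp add: CPinf_sel conj_arr_id tensor_id dual_ob)
qed

lemma dsmc_iso_cpinf_of: "dsmc_iso (CPM C) (with_dagger (CPinf C) cpinf_dag) (\<lambda>A. A) cpinf_of"
proof -
  have "cpinf_of (Comp (CPM C) g f) = Comp (CPinf C) (cpinf_of g) (cpinf_of f)"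
    if fg: "f \<in> Arr (CPM C)" "g \<in> Arr (CPM C)" "Cod (CPM C) f = Dom (CPM C) g" for f g
  proof -
    obtain A B p where f: "f = (A, B, cpm_map C B p)" "A \<in> Ob C" "B \<in> Ob C" "p \<in> kraus C A B" using fg(1) by (rule CPM_arrE)
    obtain B' D q where g: "g = (B', D, cpm_map C D q)" "D \<in> Ob C" "q \<in> kraus C B' D" using fg(2) by (rule CPM_arrE)
    have [simp]: "B' = B" using fg(3) f(1) g(1) by simp
    have "g \<in> Arr (CPM C)" "q \<in> kraus C B D" using fg(2) g by simp_all
    then show ?thesis using f g kraus_comp_in [of p A B q D] cpm_map_kraus_comp [of p A B q D, symmetric]
      by (simp add: cpinf_of_cpm_map Comp_CPinf)
  qed
  moreover have "cpinf_of (TenA (CPM C) f g) = TenA (CPinf C) (cpinf_of f) (cpinf_of g)"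
    if fg: "f \<in> Arr (CPM C)" "g \<in> Arr (CPM C)" for f g
  proof -
    obtain A B p where f: "f = (A, B, cpm_map C B p)" "A \<in> Ob C" "B \<in> Ob C" "p \<in> kraus C A B" using fg(1) by (rule CPM_arrE)
    obtain A' B' q where g: "g = (A', B', cpm_map C B' q)" "A' \<in> Ob C" "B' \<in> Ob C" "q \<in> kraus C A' B'" using fg(2) by (rule CPM_arrE)
    show ?thesis using f g
      by (simp add: TenA_CPM cpinf_of_cpm_map TenA_CPinf kraus_tensor_in tensor_ob)
  qed
  moreover have "cpinf_of (Dag (CPM C) f) = cpinf_dag (cpinf_of f)" if "f \<in> Arr (CPM C)" for f
    using that bij_cpinf_of by (simp add: cpinf_dag_def bij_betw_def inv_into_f_f)
  moreover have "Dom (CPinf C) (cpinf_of f) = Dom (CPM C) f" "Cod (CPinf C) (cpinf_of f) = Cod (CPM C) f" for f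
    by (cases f, simp add: cpinf_of_def CPinf_sel)+
  ultimately show ?thesis
    unfolding dsmc_iso_def
    using bij_cpinf_of cpinf_of_doubled [OF assoc_hom] cpinf_of_doubled [OF lunit_hom] cpinf_of_doubled [OF runit_hom] cpinf_of_doubled [OF symm_hom]
    by (simp add: bij_betw_id [unfolded id_def] CPinf_sel(1,5-) cpinf_of_id del: CPM_sel(4))
qed

end

theorem proposition6:
  fixes C :: "('o, 'm) dccat"
  assumes "dagger_compact_category C"
  shows "dagger_compact_category (CPM C)
    \<and> (\<exists>d. dsmc_isomorphic (CPM C) (with_dagger (CPinf C) d)
         \<and> (\<exists>du cu. dagger_compact_category (with_duals (with_dagger (CPinf C) d) du cu)))"
proof -
  interpret C: dagger_compact_category C by fact
  interpret K: dagger_compact_category "CPM C" by (rule C.dagger_compact_category_CPM)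
  let ?D = "with_dagger (CPinf C) C.cpinf_dag"
  \<comment> \<open>Dual objects are kept, and the cups of CPM are transported along the isomorphism
    like the dagger.\<close>
  let ?E = "with_duals ?D (Dual C) (\<lambda>A. C.cpinf_of (Cup (CPM C) A))"
  interpret D: dsmc_transport "CPM C" ?D C.cpinf_of
    by unfold_locales (rule C.dsmc_iso_cpinf_of)
  interpret E: dcc_transport "CPM C" ?E C.cpinf_of
    by unfold_locales (simp_all add: dsmc_iso_with_duals C.dsmc_iso_cpinf_of)
  have "dsmc_isomorphic (CPM C) ?D"
    unfolding dsmc_isomorphic_def
    using K.dagger_symmetric_monoidal_category_axioms D.dagger_symmetric_monoidal_category_D C.dsmc_iso_cpinf_of by blast
  then show ?thesis
    using K.dagger_compact_category_axioms E.dagger_compact_category_D by blast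
qed

end
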